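(* Let $H=\bigoplus_{n=0}^{\infty}H_n$ be a graded Hopf algebra over an algebraically closed field $\mathbb{K}$ of characteristic $0$ such that $H_0=\mathbb{K}G$ for a finite abelian group $G$, and $H_n=H_{n+1}=\cdots=(0)$ for some $n>0$. Let $\sigma:G\times G\to\mathbb{K}^\times$ be a normalized 2-cocycle on $G$, extended to a Hopf algebra 2-cocycle (also denoted $\sigma$) on $H$. For each pair $(\beta,g)\in\widehat{G}\times G$ there is an isomorphism of Yetter-Drinfeld $H^\sigma$-modules $$(H\bullet_\beta g)^\sigma\;\cong\; H^\sigma\bullet_{\beta_{g,\sigma}} g,$$ where $\beta_{g,\sigma}\in\widehat{G}$ is given by $\beta_{g,\sigma}(h)=\beta(h)\,\sigma(g,h)\,\sigma(h,g)^{-1}$ for $h\in G$. The isomorphism maps $h\bullet_\beta^{\sigma} g$ to $h\bullet_{\beta_{g,\sigma}} g$ for each $h\in H$, where $\bullet_\beta^\sigma$ denotes the action of $H^\sigma$ on $(H\bullet_\beta g)^\sigma$.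
   Context: Sweedler notation is used: $\Delta(a)=\sum a_{(1)}\otimes a_{(2)}$, and $\delta(m)=\sum m_{(0)}\otimes m_{(1)}$ for right comodules. $\varepsilon$ is the counit and $S$ the antipode of $H$. Yetter-Drinfeld modules. A (left-right) Yetter-Drinfeld $H$-module is a left $H$-module $M$ (action $a\cdot m$) that is also a right $H$-comodule via $\delta:M\to M\otimes H$, such that $\sum a_{(1)}\cdot m_{(0)}\otimes a_{(2)}m_{(1)}=\sum (a_{(2)}\cdot m)_{(0)}\otimes (a_{(2)}\cdot m)_{(1)}a_{(1)}$ for all $a\in H$, $m\in M$. Morphisms are maps that are both module and comodule maps. The modules $H\bullet_\beta g$. $\widehat{G}=\mathrm{Hom}(G,\mathbb{K}^\times)$. Each $\beta\in\widehat{G}$ is identified with the algebra map $\beta:H\to\mathbb{K}$ that restricts to $\beta$ on $G$ and vanishes on $H_n$ for $n\ge 1$. Let $S^{\mathrm{op}}$ be the antipode of $H^{\mathrm{op}}$ (i.e. the inverse of $S$). For an algebra map $\beta:H\to\mathbb{K}$, the space $H$ becomes a Yetter-Drinfeld $H$-module $H_\beta$ with coaction $\Delta$ and action $$x\bullet_\beta a=\sum\beta(x_{(2)})\,x_{(3)}\,a\,S^{\mathrm{op}}(x_{(1)}),\qquad x,a\in H.$$ For a grouplike $g$, $H\bullet_\beta g=\{x\bullet_\beta g: x\in H\}$ is a Yetter-Drinfeld submodule of $H_\beta$. The module $H^\sigma\bullet_{\beta'}g$ is defined in the same way using the Hopf algebra $H^\sigma$ below, which is graded with the same grading as $H$ and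 has $(H^\sigma)_0=\mathbb{K}G$. Cocycles. A 2-cocycle on $G$ is a map $\sigma:G\times G\to\mathbb{K}^\times$ with $\sigma(g,h)\sigma(gh,k)=\sigma(h,k)\sigma(g,hk)$ for all $g,h,k\in G$; it is normalized if $\sigma(g,1)=1=\sigma(1,g)$ for all $g$. It is extended linearly to $\mathbb{K}G\otimes\mathbb{K}G$ and then to $H\otimes H$ as $\sigma\circ(\pi\otimes\pi)$, where $\pi:H\to H_0=\mathbb{K}G$ is the projection; the result is a Hopf algebra 2-cocycle on $H$, whose convolution inverse $\sigma^{-1}$ is the extension of $(g,h)\mapsto\sigma(g,h)^{-1}$. Cocycle twist. $H^\sigma=H$ as a coalgebra, with multiplication $a\cdot_\sigma b=\sum\sigma(a_{(1)}\otimes b_{(1)})\,a_{(2)}b_{(2)}\,\sigma^{-1}(a_{(3)}\otimes b_{(3)})$ and antipode $S^\sigma(a)=\sum\sigma(a_{(1)}\otimes S(a_{(2)}))\,S(a_{(3)})\,\sigma^{-1}(S(a_{(4)})\otimes a_{(5)})$. Twisted modules. For a Yetter-Drinfeld $H$-module $M$, $M^\sigma$ is the Yetter-Drinfeld $H^\sigma$-module equal to $M$ as a comodule, with $H^\sigma$-action $$a\cdot^\sigma m=\sum\sigma\big((a_{(2)}\cdot m_{(0)})_{(1)}\otimes a_{(1)}\big)\,(a_{(2)}\cdot m_{(0)})_{(0)}\,\sigma^{-1}(a_{(3)}\otimes m_{(1)}).$$ *)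

theory Defs
  imports "HOL-Algebra.Group" "HOL-Library.Function_Algebras"
    "HOL-Computational_Algebra.Polynomial"
begin

section \<open>Linear and bilinear maps on subspaces\<close>

text \<open>A vector space is a type of class \<open>ab_group_add\<close> together with a scalar multiplication
  \<open>s\<close> such that \<open>vector_space s\<close>.\<close>

definition linear_on ::
  "('k \<Rightarrow> 'v \<Rightarrow> 'v) \<Rightarrow> ('k \<Rightarrow> 'x \<Rightarrow> 'x) \<Rightarrow> 'v set \<Rightarrow> ('v::ab_group_add \<Rightarrow> 'x::ab_group_add) \<Rightarrow> bool" where
  "linear_on sv sx V f \<longleftrightarrow>
     (\<forall>v\<in>V. \<forall>v'\<in>V. f (v + v') = f v + f v') \<and> (\<forall>c. \<forall>v\<in>V. f (sv c v) = sx c (f v))"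

definition bilinear_on ::
  "('k \<Rightarrow> 'v \<Rightarrow> 'v) \<Rightarrow> ('k \<Rightarrow> 'w \<Rightarrow> 'w) \<Rightarrow> ('k \<Rightarrow> 'x \<Rightarrow> 'x) \<Rightarrow> 'v set \<Rightarrow> 'w set
    \<Rightarrow> ('v::ab_group_add \<Rightarrow> 'w::ab_group_add \<Rightarrow> 'x::ab_group_add) \<Rightarrow> bool" where
  "bilinear_on sv sw sx V W b \<longleftrightarrow>
     (\<forall>w\<in>W. linear_on sv sx V (\<lambda>v. b v w)) \<and> (\<forall>v\<in>V. linear_on sw sx W (b v))"

section \<open>Tensor products\<close>

text \<open>\<open>V \<otimes> W\<close> is realised inside the dual of the space of bilinear forms on \<open>V \<times> W\<close>: the tensor
  \<open>v \<otimes> w\<close> is evaluation at \<open>(v, w)\<close>, and \<open>V \<otimes> W\<close> is the span of these evaluations.  Over a field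
  this has the universal property of the tensor product, see \<open>tlift_sum\<close> below.  For subspaces
  \<open>V'\<close>, \<open>W'\<close> the space \<open>V' \<otimes> W'\<close> is regarded as a subspace of \<open>V \<otimes> W\<close>.\<close>

type_synonym ('v, 'w, 'k) tensor = "('v \<Rightarrow> 'w \<Rightarrow> 'k) \<Rightarrow> 'k"

definition tscl :: "'k::field \<Rightarrow> ('v, 'w, 'k) tensor \<Rightarrow> ('v, 'w, 'k) tensor" where
  "tscl c t = (\<lambda>f. c * t f)"

definition tens ::
  "('k::field \<Rightarrow> 'v \<Rightarrow> 'v) \<Rightarrow> ('k \<Rightarrow> 'w \<Rightarrow> 'w) \<Rightarrow> 'v::ab_group_add \<Rightarrow> 'w::ab_group_add
    \<Rightarrow> ('v, 'w, 'k) tensor" where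
  "tens sv sw v w = (\<lambda>f. if bilinear_on sv sw (*) UNIV UNIV f then f v w else 0)"

definition represents ::
  "('k::field \<Rightarrow> 'v \<Rightarrow> 'v) \<Rightarrow> ('k \<Rightarrow> 'w \<Rightarrow> 'w) \<Rightarrow> 'v set \<Rightarrow> 'w set
    \<Rightarrow> ('v::ab_group_add \<times> 'w::ab_group_add) list \<Rightarrow> ('v, 'w, 'k) tensor \<Rightarrow> bool" where
  "represents sv sw V W ps t \<longleftrightarrow>
     set ps \<subseteq> V \<times> W \<and> t = (\<Sum>(v, w)\<leftarrow>ps. tens sv sw v w)"

definition tensor_space ::
  "('k::field \<Rightarrow> 'v \<Rightarrow> 'v) \<Rightarrow> ('k \<Rightarrow> 'w \<Rightarrow> 'w) \<Rightarrow> 'v::ab_group_add set \<Rightarrow> 'w::ab_group_add set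
    \<Rightarrow> ('v, 'w, 'k) tensor set" where
  "tensor_space sv sw V W = {t. \<exists>ps. represents sv sw V W ps t}"

text \<open>The value at \<open>t \<in> V \<otimes> W\<close> of the linear map induced by a bilinear map \<open>b\<close> on \<open>V \<times> W\<close>, i.e.
  the Sweedler sum \<open>\<Sum> b v w\<close> for \<open>t = \<Sum> v \<otimes> w\<close>.  The choice of the representation of \<open>t\<close> is
  immaterial by \<open>tlift_sum\<close>.\<close>

definition tlift ::
  "('k::field \<Rightarrow> 'v \<Rightarrow> 'v) \<Rightarrow> ('k \<Rightarrow> 'w \<Rightarrow> 'w) \<Rightarrow> 'v set \<Rightarrow> 'w set
    \<Rightarrow> ('v::ab_group_add \<Rightarrow> 'w::ab_group_add \<Rightarrow> 'x::ab_group_add) \<Rightarrow> ('v, 'w, 'k) tensor \<Rightarrow> 'x" where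
  "tlift sv sw V W b t = (\<Sum>(v, w)\<leftarrow>(SOME ps. represents sv sw V W ps t). b v w)"

lemma sum_list_fun_apply: "(\<Sum>x\<leftarrow>xs. F x) f = (\<Sum>x\<leftarrow>xs. F x f)"
  for F :: "'a \<Rightarrow> 'b \<Rightarrow> 'c::comm_monoid_add"
  by (induction xs) auto

lemma subspace_projection:
  assumes "vector_space s" "module.subspace s V"
  obtains P where "linear_on s s UNIV P" "\<And>x. P x \<in> V" "\<And>x. x \<in> V \<Longrightarrow> P x = x"
proof -
  interpret vector_space s by fact
  interpret vector_space_pair s s ..
  obtain B where B: "B \<subseteq> V" "independent B" "V \<subseteq> span B"
    using maximal_independent_subset[of V] by blast
  have spanB: "span B = V"
    using B assms(2) by (metis span_subspace)
  obtain P where P: "Vector_Spaces.linear s s P" "range P \<subseteq> span B" "\<forall>x\<in>B. P x = x"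
    using linear_independent_extend_subspace[OF B(2), of id]
    by (metis id_apply image_id subset_refl order_eq_iff)
  interpret P: Vector_Spaces.linear s s P by fact
  have "P x = x" if "x \<in> V" for x
  proof -
    have "Vector_Spaces.linear s s id" by unfold_locales simp_all
    thus ?thesis
      using linear_eq_on[OF P(1), of id x B] that spanB P(3) by simp
  qed
  moreover have "linear_on s s UNIV P"
    by (simp add: linear_on_def P.add P.scale)
  ultimately show ?thesis using P(2) spanB that by blast
qed

lemma separating_functional:
  assumes "vector_space s" "x \<noteq> 0"
  obtains \<phi> where "linear_on s ((*) :: 'k::field \<Rightarrow> _) UNIV \<phi>" "\<phi> x \<noteq> 0"
proof -
  interpret V: vector_space s by fact
  interpret K: vector_space "(*) :: 'k \<Rightarrow> 'k \<Rightarrow> 'k"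
    by unfold_locales (auto simp: algebra_simps)
  interpret vector_space_pair s "(*) :: 'k \<Rightarrow> 'k \<Rightarrow> 'k" ..
  have "V.independent {x}" using assms(2) by simp
  then obtain \<phi> where \<phi>: "Vector_Spaces.linear s (*) \<phi>" "\<phi> x = 1"
    using linear_independent_extend[of "{x}" "\<lambda>_. 1"] by auto
  interpret \<phi>: Vector_Spaces.linear s "(*)" \<phi> by fact
  show ?thesis using that[of \<phi>] \<phi>(2) by (simp add: linear_on_def \<phi>.add \<phi>.scale)
qed

lemma linear_on_sum_list:
  assumes "linear_on sv sx UNIV f" "f 0 = 0"
  shows "f (\<Sum>p\<leftarrow>ps. g p) = (\<Sum>p\<leftarrow>ps. f (g p))"
  using assms by (induction ps) (auto simp: linear_on_def)

lemma represents_unique_value: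
  assumes vs: "vector_space sv" "vector_space sw" "vector_space sx"
    and sub: "module.subspace sv V" "module.subspace sw W"
    and b: "bilinear_on sv sw sx V W b"
    and ps: "represents sv sw V W ps t" and qs: "represents sv sw V W qs t"
  shows "(\<Sum>(v, w)\<leftarrow>ps. b v w) = (\<Sum>(v, w)\<leftarrow>qs. b v w)" (is "?p = ?q")
proof (rule ccontr)
  assume "?p \<noteq> ?q"
  then obtain \<phi> where \<phi>: "linear_on sx (*) UNIV \<phi>" "\<phi> (?p - ?q) \<noteq> 0"
    using separating_functional[OF vs(3), of "?p - ?q"] by auto
  obtain P where P: "linear_on sv sv UNIV P" "\<And>x. P x \<in> V" "\<And>x. x \<in> V \<Longrightarrow> P x = x"
    using subspace_projection[OF vs(1) sub(1)] by blast
  obtain Q where Q: "linear_on sw sw UNIV Q" "\<And>x. Q x \<in> W" "\<And>x. x \<in> W \<Longrightarrow> Q x = x"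
    using subspace_projection[OF vs(2) sub(2)] by blast
  define f where "f = (\<lambda>v w. \<phi> (b (P v) (Q w)))"
  have f: "bilinear_on sv sw (*) UNIV UNIV f"
    using P Q b \<phi>(1) by (simp add: bilinear_on_def linear_on_def f_def)
  have \<phi>add: "\<phi> (x + y) = \<phi> x + \<phi> y" for x y using \<phi>(1) by (simp add: linear_on_def)
  have \<phi>0: "\<phi> 0 = 0" using \<phi>add[of 0 0] by (metis add.right_neutral add_left_cancel)
  have \<phi>diff: "\<phi> (?p - ?q) = \<phi> ?p - \<phi> ?q" using \<phi>add[of "?p - ?q" ?q] by simp
  have val: "t f = \<phi> (\<Sum>(v, w)\<leftarrow>rs. b v w)" if "represents sv sw V W rs t" for rs
  proof -
    have rs: "set rs \<subseteq> V \<times> W" and t: "t = (\<Sum>r\<leftarrow>rs. tens sv sw (fst r) (snd r))"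
      using that by (auto simp: represents_def case_prod_unfold)
    have "t f = (\<Sum>r\<leftarrow>rs. f (fst r) (snd r))"
      by (simp add: t sum_list_fun_apply tens_def f)
    also have "\<dots> = (\<Sum>r\<leftarrow>rs. \<phi> (b (fst r) (snd r)))"
    proof (intro arg_cong[of _ _ sum_list] map_cong refl)
      fix r assume "r \<in> set rs"
      hence "fst r \<in> V" "snd r \<in> W" using rs by (auto simp: mem_Times_iff)
      thus "f (fst r) (snd r) = \<phi> (b (fst r) (snd r))" by (simp add: f_def P(3) Q(3))
    qed
    also have "\<dots> = \<phi> (\<Sum>r\<leftarrow>rs. b (fst r) (snd r))"
      using linear_on_sum_list[OF \<phi>(1) \<phi>0] by metis
    finally show ?thesis by (simp add: case_prod_unfold)
  qed
  show False using val[OF ps] val[OF qs] \<phi>(2) \<phi>diff by simp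
qed

text \<open>Existence in the universal property; uniqueness is clear, since the pure tensors span.\<close>

lemma tlift_sum:
  assumes "vector_space sv" "vector_space sw" "vector_space sx"
    and "module.subspace sv V" "module.subspace sw W"
    and "bilinear_on sv sw sx V W b" and "set ps \<subseteq> V \<times> W"
  shows "tlift sv sw V W b (\<Sum>(v, w)\<leftarrow>ps. tens sv sw v w) = (\<Sum>(v, w)\<leftarrow>ps. b v w)"
proof -
  have ps: "represents sv sw V W ps (\<Sum>(v, w)\<leftarrow>ps. tens sv sw v w)"
    using assms(7) by (simp add: represents_def)
  show ?thesis unfolding tlift_def
    by (rule represents_unique_value[OF assms(1-6) someI[of "\<lambda>qs. represents sv sw V W qs _", OF ps] ps])
qed

section \<open>Hopf algebras\<close>

record ('k, 'h) hopf =
  scl :: "'k \<Rightarrow> 'h \<Rightarrow> 'h"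
  hmult :: "'h \<Rightarrow> 'h \<Rightarrow> 'h"
  hunit :: "'h"
  comult :: "'h \<Rightarrow> ('h, 'h, 'k) tensor"
  counit :: "'h \<Rightarrow> 'k"
  antipode :: "'h \<Rightarrow> 'h"

abbreviation htens :: "('k::field, 'h::ab_group_add) hopf \<Rightarrow> 'h \<Rightarrow> 'h \<Rightarrow> ('h, 'h, 'k) tensor" where
  "htens H \<equiv> tens (scl H) (scl H)"

text \<open>\<open>sw2 H f a\<close>, \<open>sw3 H f a\<close>, \<open>sw5 H f a\<close> are the Sweedler sums \<open>\<Sum> f a\<^sub>1 a\<^sub>2\<close>,
  \<open>\<Sum> f a\<^sub>1 a\<^sub>2 a\<^sub>3\<close>, \<open>\<Sum> f a\<^sub>1 a\<^sub>2 a\<^sub>3 a\<^sub>4 a\<^sub>5\<close> for a multilinear map \<open>f\<close>.\<close>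

definition sw2 ::
  "('k::field, 'h::ab_group_add) hopf \<Rightarrow> ('h \<Rightarrow> 'h \<Rightarrow> 'x::ab_group_add) \<Rightarrow> 'h \<Rightarrow> 'x" where
  "sw2 H f a = tlift (scl H) (scl H) UNIV UNIV f (comult H a)"

definition sw3 ::
  "('k::field, 'h::ab_group_add) hopf \<Rightarrow> ('h \<Rightarrow> 'h \<Rightarrow> 'h \<Rightarrow> 'x::ab_group_add) \<Rightarrow> 'h \<Rightarrow> 'x" where
  "sw3 H f a = sw2 H (\<lambda>u a3. sw2 H (\<lambda>a1 a2. f a1 a2 a3) u) a"

definition sw5 ::
  "('k::field, 'h::ab_group_add) hopf \<Rightarrow> ('h \<Rightarrow> 'h \<Rightarrow> 'h \<Rightarrow> 'h \<Rightarrow> 'h \<Rightarrow> 'x::ab_group_add)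
    \<Rightarrow> 'h \<Rightarrow> 'x" where
  "sw5 H f a = sw3 H (\<lambda>u a4 a5. sw3 H (\<lambda>a1 a2 a3. f a1 a2 a3 a4 a5) u) a"

definition algebra_axioms :: "('k::field, 'h::ab_group_add) hopf \<Rightarrow> bool" where
  "algebra_axioms H \<longleftrightarrow>
     bilinear_on (scl H) (scl H) (scl H) UNIV UNIV (hmult H) \<and>
     (\<forall>a b c. hmult H (hmult H a b) c = hmult H a (hmult H b c)) \<and>
     (\<forall>a. hmult H (hunit H) a = a \<and> hmult H a (hunit H) = a)"

definition coalgebra_axioms :: "('k::field, 'h::ab_group_add) hopf \<Rightarrow> bool" where
  "coalgebra_axioms H \<longleftrightarrow>
     linear_on (scl H) tscl UNIV (comult H) \<and>
     (\<forall>a. comult H a \<in> tensor_space (scl H) (scl H) UNIV UNIV) \<and>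
     linear_on (scl H) (*) UNIV (counit H) \<and>
     (\<forall>a. sw3 H (\<lambda>a1 a2 a3. tens (scl H) tscl a1 (htens H a2 a3)) a =
          sw2 H (\<lambda>a1 u. tens (scl H) tscl a1 (comult H u)) a) \<and>
     (\<forall>a. sw2 H (\<lambda>a1 a2. scl H (counit H a1) a2) a = a) \<and>
     (\<forall>a. sw2 H (\<lambda>a1 a2. scl H (counit H a2) a1) a = a)"

definition bialgebra :: "('k::field, 'h::ab_group_add) hopf \<Rightarrow> bool" where
  "bialgebra H \<longleftrightarrow> vector_space (scl H) \<and> algebra_axioms H \<and> coalgebra_axioms H \<and>
     (\<forall>a b. comult H (hmult H a b) =
        sw2 H (\<lambda>a1 a2. sw2 H (\<lambda>b1 b2. htens H (hmult H a1 b1) (hmult H a2 b2)) b) a) \<and>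
     comult H (hunit H) = htens H (hunit H) (hunit H) \<and>
     (\<forall>a b. counit H (hmult H a b) = counit H a * counit H b) \<and>
     counit H (hunit H) = 1"

definition is_antipode :: "('k::field, 'h::ab_group_add) hopf \<Rightarrow> ('h \<Rightarrow> 'h) \<Rightarrow> bool" where
  "is_antipode H S \<longleftrightarrow> linear_on (scl H) (scl H) UNIV S \<and>
     (\<forall>a. sw2 H (\<lambda>a1 a2. hmult H (S a1) a2) a = scl H (counit H a) (hunit H)) \<and>
     (\<forall>a. sw2 H (\<lambda>a1 a2. hmult H a1 (S a2)) a = scl H (counit H a) (hunit H))"

definition hopf_algebra :: "('k::field, 'h::ab_group_add) hopf \<Rightarrow> bool" where
  "hopf_algebra H \<longleftrightarrow> bialgebra H \<and> is_antipode H (antipode H)"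

definition op_hopf :: "('k::field, 'h::ab_group_add) hopf \<Rightarrow> ('k, 'h) hopf" where
  "op_hopf H = (let B = H\<lparr>hmult := \<lambda>a b. hmult H b a\<rparr>
                in B\<lparr>antipode := (THE S. is_antipode B S)\<rparr>)"

section \<open>Gradings and the group algebra in degree zero\<close>

definition graded_decomp :: "(nat \<Rightarrow> 'h::ab_group_add set) \<Rightarrow> 'h \<Rightarrow> (nat \<Rightarrow> 'h) \<Rightarrow> bool" where
  "graded_decomp Gr x c \<longleftrightarrow>
     (\<forall>n. c n \<in> Gr n) \<and> finite {n. c n \<noteq> 0} \<and> x = (\<Sum>n\<in>{n. c n \<noteq> 0}. c n)"

definition graded_hopf_algebra ::
  "('k::field, 'h::ab_group_add) hopf \<Rightarrow> (nat \<Rightarrow> 'h set) \<Rightarrow> bool" where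
  "graded_hopf_algebra H Gr \<longleftrightarrow> hopf_algebra H \<and>
     (\<forall>n. module.subspace (scl H) (Gr n)) \<and>
     (\<forall>x. \<exists>!c. graded_decomp Gr x c) \<and>
     hunit H \<in> Gr 0 \<and>
     (\<forall>i j. \<forall>a\<in>Gr i. \<forall>b\<in>Gr j. hmult H a b \<in> Gr (i + j)) \<and>
     (\<forall>n. \<forall>a\<in>Gr n. \<exists>t. (\<forall>i\<le>n. t i \<in> tensor_space (scl H) (scl H) (Gr i) (Gr (n - i))) \<and>
        comult H a = (\<Sum>i\<le>n. t i)) \<and>
     (\<forall>n\<ge>1. \<forall>a\<in>Gr n. counit H a = 0) \<and>
     (\<forall>n. \<forall>a\<in>Gr n. antipode H a \<in> Gr n)"

definition deg0 :: "(nat \<Rightarrow> 'h::ab_group_add set) \<Rightarrow> 'h \<Rightarrow> 'h" where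
  "deg0 Gr x = (THE c. graded_decomp Gr x c) 0"

definition grp :: "('k, 'h) hopf \<Rightarrow> 'h set \<Rightarrow> 'h monoid" where
  "grp H G = \<lparr>carrier = G, monoid.mult = hmult H, one = hunit H\<rparr>"

text \<open>\<open>H\<^sub>0 = KG\<close> as Hopf algebras, the elements of \<open>G\<close> being identified with their images in
  \<open>H\<^sub>0\<close>.\<close>

definition degree_zero_group_algebra ::
  "('k::field, 'h::ab_group_add) hopf \<Rightarrow> (nat \<Rightarrow> 'h set) \<Rightarrow> 'h set \<Rightarrow> bool" where
  "degree_zero_group_algebra H Gr G \<longleftrightarrow>
     group (grp H G) \<and>
     \<not> module.dependent (scl H) G \<and> module.span (scl H) G = Gr 0 \<and>
     (\<forall>g\<in>G. comult H g = htens H g g \<and> counit H g = 1)"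

text \<open>Coefficient of \<open>g\<close> in the degree zero part of \<open>x\<close>.\<close>

definition gcoeff ::
  "('k::field, 'h::ab_group_add) hopf \<Rightarrow> (nat \<Rightarrow> 'h set) \<Rightarrow> 'h set \<Rightarrow> 'h \<Rightarrow> 'h \<Rightarrow> 'k" where
  "gcoeff H Gr G x g = module.representation (scl H) G (deg0 Gr x) g"

definition units_group :: "'k::field monoid" where
  "units_group = \<lparr>carrier = UNIV - {0}, monoid.mult = (*), one = 1\<rparr>"

definition characters :: "('k::field, 'h) hopf \<Rightarrow> 'h set \<Rightarrow> ('h \<Rightarrow> 'k) set" where
  "characters H G = hom (grp H G) units_group"

definition ext_char ::
  "('k::field, 'h::ab_group_add) hopf \<Rightarrow> (nat \<Rightarrow> 'h set) \<Rightarrow> 'h set \<Rightarrow> ('h \<Rightarrow> 'k) \<Rightarrow> 'h \<Rightarrow> 'k" where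
  "ext_char H Gr G \<beta> x = (\<Sum>g\<in>G. gcoeff H Gr G x g * \<beta> g)"

definition normalized_2cocycle :: "('k::field, 'h) hopf \<Rightarrow> 'h set \<Rightarrow> ('h \<Rightarrow> 'h \<Rightarrow> 'k) \<Rightarrow> bool" where
  "normalized_2cocycle H G \<sigma> \<longleftrightarrow>
     (\<forall>g\<in>G. \<forall>h\<in>G. \<sigma> g h \<noteq> 0) \<and>
     (\<forall>g\<in>G. \<forall>h\<in>G. \<forall>k\<in>G. \<sigma> g h * \<sigma> (hmult H g h) k = \<sigma> h k * \<sigma> g (hmult H h k)) \<and>
     (\<forall>g\<in>G. \<sigma> g (hunit H) = 1 \<and> \<sigma> (hunit H) g = 1)"

definition ext_cocycle ::
  "('k::field, 'h::ab_group_add) hopf \<Rightarrow> (nat \<Rightarrow> 'h set) \<Rightarrow> 'h set \<Rightarrow> ('h \<Rightarrow> 'h \<Rightarrow> 'k)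
    \<Rightarrow> 'h \<Rightarrow> 'h \<Rightarrow> 'k" where
  "ext_cocycle H Gr G \<sigma> x y = (\<Sum>g\<in>G. \<Sum>h\<in>G. gcoeff H Gr G x g * gcoeff H Gr G y h * \<sigma> g h)"

definition ext_cocycle_inv ::
  "('k::field, 'h::ab_group_add) hopf \<Rightarrow> (nat \<Rightarrow> 'h set) \<Rightarrow> 'h set \<Rightarrow> ('h \<Rightarrow> 'h \<Rightarrow> 'k)
    \<Rightarrow> 'h \<Rightarrow> 'h \<Rightarrow> 'k" where
  "ext_cocycle_inv H Gr G \<sigma> = ext_cocycle H Gr G (\<lambda>g h. inverse (\<sigma> g h))"

definition hopf_twist ::
  "('k::field, 'h::ab_group_add) hopf \<Rightarrow> (nat \<Rightarrow> 'h set) \<Rightarrow> 'h set \<Rightarrow> ('h \<Rightarrow> 'h \<Rightarrow> 'k)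
    \<Rightarrow> ('k, 'h) hopf" where
  "hopf_twist H Gr G \<sigma> =
     (let s = ext_cocycle H Gr G \<sigma>; s' = ext_cocycle_inv H Gr G \<sigma>; S = antipode H in
      H\<lparr>hmult := \<lambda>a b. sw3 H (\<lambda>a1 a2 a3. sw3 H (\<lambda>b1 b2 b3.
           scl H (s a1 b1 * s' a3 b3) (hmult H a2 b2)) b) a,
        antipode := sw5 H (\<lambda>a1 a2 a3 a4 a5. scl H (s a1 (S a2) * s' (S a4) a5) (S a3))\<rparr>)"

section \<open>Yetter-Drinfeld modules\<close>

text \<open>The underlying space is a subspace \<open>ycarrier\<close> of a vector space.\<close>

record ('k, 'h, 'm) yd =
  ycarrier :: "'m set"
  yscl :: "'k \<Rightarrow> 'm \<Rightarrow> 'm"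
  act :: "'h \<Rightarrow> 'm \<Rightarrow> 'm"
  coact :: "'m \<Rightarrow> ('m, 'h, 'k) tensor"

text \<open>The Sweedler sum \<open>\<Sum> f m\<^sub>0 m\<^sub>1\<close>.\<close>

definition swc ::
  "('k::field, 'h::ab_group_add) hopf \<Rightarrow> ('k, 'h, 'm::ab_group_add) yd
    \<Rightarrow> ('m \<Rightarrow> 'h \<Rightarrow> 'x::ab_group_add) \<Rightarrow> 'm \<Rightarrow> 'x" where
  "swc H M f m = tlift (yscl M) (scl H) (ycarrier M) UNIV f (coact M m)"

abbreviation ytens ::
  "('k::field, 'h::ab_group_add) hopf \<Rightarrow> ('k, 'h, 'm::ab_group_add) yd \<Rightarrow> 'm \<Rightarrow> 'h
    \<Rightarrow> ('m, 'h, 'k) tensor" where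
  "ytens H M \<equiv> tens (yscl M) (scl H)"

definition left_module ::
  "('k::field, 'h::ab_group_add) hopf \<Rightarrow> ('k, 'h, 'm::ab_group_add) yd \<Rightarrow> bool" where
  "left_module H M \<longleftrightarrow>
     (\<forall>a. \<forall>m\<in>ycarrier M. act M a m \<in> ycarrier M) \<and>
     bilinear_on (scl H) (yscl M) (yscl M) UNIV (ycarrier M) (act M) \<and>
     (\<forall>a b. \<forall>m\<in>ycarrier M. act M (hmult H a b) m = act M a (act M b m)) \<and>
     (\<forall>m\<in>ycarrier M. act M (hunit H) m = m)"

definition right_comodule ::
  "('k::field, 'h::ab_group_add) hopf \<Rightarrow> ('k, 'h, 'm::ab_group_add) yd \<Rightarrow> bool" where
  "right_comodule H M \<longleftrightarrow>
     (\<forall>m\<in>ycarrier M. coact M m \<in> tensor_space (yscl M) (scl H) (ycarrier M) UNIV) \<and>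
     linear_on (yscl M) tscl (ycarrier M) (coact M) \<and>
     (\<forall>m\<in>ycarrier M.
        swc H M (\<lambda>u m2. swc H M (\<lambda>m0 m1. tens (yscl M) tscl m0 (htens H m1 m2)) u) m =
        swc H M (\<lambda>m0 u. tens (yscl M) tscl m0 (comult H u)) m) \<and>
     (\<forall>m\<in>ycarrier M. swc H M (\<lambda>m0 m1. yscl M (counit H m1) m0) m = m)"

definition yd_module ::
  "('k::field, 'h::ab_group_add) hopf \<Rightarrow> ('k, 'h, 'm::ab_group_add) yd \<Rightarrow> bool" where
  "yd_module H M \<longleftrightarrow>
     vector_space (yscl M) \<and> module.subspace (yscl M) (ycarrier M) \<and>
     left_module H M \<and> right_comodule H M \<and>
     (\<forall>a. \<forall>m\<in>ycarrier M.
        sw2 H (\<lambda>a1 a2. swc H M (\<lambda>m0 m1. ytens H M (act M a1 m0) (hmult H a2 m1)) m) a =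
        sw2 H (\<lambda>a1 a2. swc H M (\<lambda>n0 n1. ytens H M n0 (hmult H n1 a1)) (act M a2 m)) a)"

definition yd_hom ::
  "('k::field, 'h::ab_group_add) hopf \<Rightarrow> ('k, 'h, 'm::ab_group_add) yd
    \<Rightarrow> ('k, 'h, 'n::ab_group_add) yd \<Rightarrow> ('m \<Rightarrow> 'n) \<Rightarrow> bool" where
  "yd_hom H M N f \<longleftrightarrow>
     (\<forall>m\<in>ycarrier M. f m \<in> ycarrier N) \<and>
     linear_on (yscl M) (yscl N) (ycarrier M) f \<and>
     (\<forall>a. \<forall>m\<in>ycarrier M. f (act M a m) = act N a (f m)) \<and>
     (\<forall>m\<in>ycarrier M. coact N (f m) = swc H M (\<lambda>m0 m1. ytens H N (f m0) m1) m)"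

definition yd_iso ::
  "('k::field, 'h::ab_group_add) hopf \<Rightarrow> ('k, 'h, 'm::ab_group_add) yd
    \<Rightarrow> ('k, 'h, 'n::ab_group_add) yd \<Rightarrow> ('m \<Rightarrow> 'n) \<Rightarrow> bool" where
  "yd_iso H M N f \<longleftrightarrow> yd_module H M \<and> yd_module H N \<and> yd_hom H M N f \<and>
     bij_betw f (ycarrier M) (ycarrier N)"

text \<open>\<open>x \<bullet>\<^sub>\<beta> a\<close> for an algebra map \<open>\<beta> : H \<rightarrow> K\<close>, and the modules \<open>H\<^sub>\<beta>\<close> and \<open>H \<bullet>\<^sub>\<beta> g\<close>.\<close>

definition bullet ::
  "('k::field, 'h::ab_group_add) hopf \<Rightarrow> ('h \<Rightarrow> 'k) \<Rightarrow> 'h \<Rightarrow> 'h \<Rightarrow> 'h" where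
  "bullet H \<beta> x a = sw3 H (\<lambda>x1 x2 x3.
     scl H (\<beta> x2) (hmult H (hmult H x3 a) (antipode (op_hopf H) x1))) x"

definition yd_regular ::
  "('k::field, 'h::ab_group_add) hopf \<Rightarrow> ('h \<Rightarrow> 'k) \<Rightarrow> ('k, 'h, 'h) yd" where
  "yd_regular H \<beta> = \<lparr>ycarrier = UNIV, yscl = scl H, act = bullet H \<beta>, coact = comult H\<rparr>"

definition yd_cyclic ::
  "('k::field, 'h::ab_group_add) hopf \<Rightarrow> ('h \<Rightarrow> 'k) \<Rightarrow> 'h \<Rightarrow> ('k, 'h, 'h) yd" where
  "yd_cyclic H \<beta> g = (yd_regular H \<beta>)\<lparr>ycarrier := {bullet H \<beta> x g | x. True}\<rparr>"

text \<open>\<open>M\<^sup>\<sigma>\<close>; below \<open>n0\<close>, \<open>n1\<close> are the legs of the coaction on \<open>a2 \<cdot> m0\<close>.\<close>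

definition yd_twist ::
  "('k::field, 'h::ab_group_add) hopf \<Rightarrow> (nat \<Rightarrow> 'h set) \<Rightarrow> 'h set \<Rightarrow> ('h \<Rightarrow> 'h \<Rightarrow> 'k)
    \<Rightarrow> ('k, 'h, 'm::ab_group_add) yd \<Rightarrow> ('k, 'h, 'm) yd" where
  "yd_twist H Gr G \<sigma> M =
     (let s = ext_cocycle H Gr G \<sigma>; s' = ext_cocycle_inv H Gr G \<sigma> in
      M\<lparr>act := \<lambda>a m. sw3 H (\<lambda>a1 a2 a3. swc H M (\<lambda>m0 m1. swc H M (\<lambda>n0 n1.
           yscl M (s n1 a1 * s' a3 m1) n0) (act M a2 m0)) m) a\<rparr>)"

definition twisted_char ::
  "('h \<Rightarrow> 'h \<Rightarrow> 'k::field) \<Rightarrow> ('h \<Rightarrow> 'k) \<Rightarrow> 'h \<Rightarrow> 'h \<Rightarrow> 'k" where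
  "twisted_char \<sigma> \<beta> g = (\<lambda>h. \<beta> h * \<sigma> g h * inverse (\<sigma> h g))"

end

(* For a Yetter-Drinfeld module N, comodule maps into the regular comodule H correspond to
   functionals on N, and such a map is H_beta-linear iff its functional is beta-equivariant.
   As H.g meets degree zero only in the line K g, the counit restricted to (H.g)^sigma is the
   functional belonging to beta_{g,sigma}, so the isomorphism is the identity of H.g.

   This is verified directly. The projection onto H_0 = K G makes H a bicomodule over K G, hence
   H is spanned by elements x of bidegree (p, q), i.e. p (x) x (x) q = sum pi(x1) (x) x2 (x) pi(x3).
   The cocycle only sees bidegrees: for x of bidegree (p, q) and y of bidegree (k, l) the twisted
   product is sigma(p, k) sigma(q, l)^-1 x y. As G is abelian, the elements of H.g have left
   degree g, and on an element of bidegree (g, r) both the action of H^sigma on (H.g)^sigma and the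
   action of H^sigma on H^sigma_{beta_{g,sigma}} multiply the original action of x by the scalar
   sigma(q r p^-1, p) sigma(q, r)^-1. *)
theory Submission
  imports Defs
begin

section \<open>Sweedler sums\<close>

text \<open>Three obstacles shape the proof. A Sweedler sum is computed from an arbitrarily chosen
  representation of the coproduct, so most of its laws hold for multilinear maps only; they are
  checked for forms, where the sum is the value of a tensor, and carried to vector-valued maps by
  separating functionals. The antipode of the opposite algebra is given by description, so it has to
  be constructed: for H as a convolution inverse, by a geometric series that the finite grading
  makes terminate, and for H^sigma by rescaling the one of H. Finally, the sum defining the action
  of H^sigma runs over an inner degree t that the final scalar must not contain. The twisted
  antipode and the two twisted products contribute sigma(g,t^-1) sigma(t,g t^-1) / sigma(t,t^-1),
  which equals sigma(t,g) / sigma(g,t) because t and g commute; the twisted character is beta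
  divided by exactly this. The Yetter-Drinfeld axioms for the twisted module are not checked from
  its formula but inherited from the cyclic module over H^sigma, with which it agrees on the
  carrier.\<close>

lemma vector_space_mult: "vector_space ((*) :: 'k::field \<Rightarrow> 'k \<Rightarrow> 'k)"
  by unfold_locales (auto simp: algebra_simps)

lemma vector_space_tscl: "vector_space (tscl :: 'k::field \<Rightarrow> ('v, 'w, 'k) tensor \<Rightarrow> _)"
  by unfold_locales (auto simp: tscl_def fun_eq_iff algebra_simps)

text \<open>Carries identities from K-valued forms, at which tensors can be evaluated, to maps into
  any vector space.\<close>

lemma eq_by_functionals:
  assumes "vector_space s"
    and "\<And>\<phi>. linear_on s ((*) :: 'k::field \<Rightarrow> _) UNIV \<phi> \<Longrightarrow> \<phi> u = \<phi> v"
  shows "u = v"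
proof (rule ccontr)
  assume "u \<noteq> v"
  then obtain \<phi> where \<phi>: "linear_on s ((*) :: 'k \<Rightarrow> _) UNIV \<phi>" "\<phi> (u - v) \<noteq> 0"
    using separating_functional[OF assms(1), of "u - v"] by auto
  have "\<phi> u = \<phi> (u - v) + \<phi> v"
    using \<phi>(1) unfolding linear_on_def by (metis UNIV_I diff_add_cancel)
  then show False using assms(2)[OF \<phi>(1)] \<phi>(2) by simp
qed

lemma additive_zero: "(\<And>x y. f (x + y) = f x + f y) \<Longrightarrow> f (0 :: 'a::ab_group_add) = (0 :: 'b::ab_group_add)"
  by (metis add.right_neutral add_left_cancel)

lemma additive_sum_list:
  fixes \<phi> :: "'a::ab_group_add \<Rightarrow> 'b::ab_group_add"
  assumes "\<And>x y. \<phi> (x + y) = \<phi> x + \<phi> y"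
  shows "\<phi> (\<Sum>p\<leftarrow>ps. f p) = (\<Sum>p\<leftarrow>ps. \<phi> (f p))"
  using additive_zero[of \<phi>, OF assms] by (induction ps) (auto simp: assms)

lemma additive_sum:
  fixes \<phi> :: "'a::ab_group_add \<Rightarrow> 'b::ab_group_add"
  assumes "\<And>x y. \<phi> (x + y) = \<phi> x + \<phi> y"
  shows "\<phi> (\<Sum>p\<in>A. f p) = (\<Sum>p\<in>A. \<phi> (f p))"
  using additive_zero[of \<phi>, OF assms]
  by (induction A rule: infinite_finite_induct) (auto simp: assms)

lemma sw2_additive:
  fixes \<phi> :: "'a::ab_group_add \<Rightarrow> 'b::ab_group_add"
  assumes "\<And>x y. \<phi> (x + y) = \<phi> x + \<phi> y"
  shows "\<phi> (sw2 B f x) = sw2 B (\<lambda>a b. \<phi> (f a b)) x"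
  unfolding sw2_def tlift_def using additive_sum_list[of \<phi>, OF assms]
  by (simp add: case_prod_unfold)

lemma sw2_apply: "sw2 B F x f = sw2 B (\<lambda>a b. F a b f) x"
  by (simp add: sw2_def tlift_def sum_list_fun_apply case_prod_unfold)

lemma sum_list_swap:
  fixes F :: "'a \<Rightarrow> 'b \<Rightarrow> 'c::ab_group_add"
  shows "(\<Sum>p\<leftarrow>xs. \<Sum>q\<leftarrow>ys. F p q) = (\<Sum>q\<leftarrow>ys. \<Sum>p\<leftarrow>xs. F p q)"
  by (induction xs) (simp_all add: sum_list_addf)

text \<open>Both sums run over fixed finite representations, so the exchange holds for arbitrary
  \<open>f\<close>. It concerns independent elements; nested sums along one coproduct are governed
  by coassociativity.\<close>

lemma sw2_swap:
  "sw2 B (\<lambda>a b. sw2 B (\<lambda>c d. f a b c d) y) x = sw2 B (\<lambda>c d. sw2 B (\<lambda>a b. f a b c d) x) y"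
  unfolding sw2_def tlift_def case_prod_unfold by (rule sum_list_swap)

lemma sw2_add: "sw2 B (\<lambda>a b. f a b + g a b) x = sw2 B f x + sw2 B g x"
  by (simp add: sw2_def tlift_def case_prod_unfold sum_list_addf)

lemma sw2_zero [simp]: "sw2 B (\<lambda>a b. 0) x = 0"
  by (simp add: sw2_def tlift_def case_prod_unfold)

lemma sw2_sum: "sw2 B (\<lambda>a b. \<Sum>i\<in>I. f i a b) x = (\<Sum>i\<in>I. sw2 B (f i) x)"
  by (induction I rule: infinite_finite_induct) (simp_all add: sw2_add)


section \<open>Sweedler calculus in a bialgebra\<close>

locale bialg =
  fixes B :: "('k::field, 'h::ab_group_add) hopf"
  assumes bialgebra: "bialgebra B"
begin

abbreviation mul (infixl "\<odot>" 70) where "x \<odot> y \<equiv> hmult B x y"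
abbreviation smul (infixr "\<star>" 75) where "c \<star> x \<equiv> scl B c x"
abbreviation counit_map ("\<epsilon>") where "\<epsilon> \<equiv> counit B"
abbreviation unit_elt ("\<e>") where "\<e> \<equiv> hunit B"
abbreviation "lin t f \<equiv> linear_on (scl B) t UNIV f"
abbreviation "klin f \<equiv> linear_on (scl B) ((*) :: 'k \<Rightarrow> 'k \<Rightarrow> 'k) UNIV f"
abbreviation "hlin f \<equiv> linear_on (scl B) (scl B) UNIV f"
abbreviation "form f \<equiv> bilinear_on (scl B) (scl B) ((*) :: 'k \<Rightarrow> 'k \<Rightarrow> 'k) UNIV UNIV f"

lemma vs: "vector_space (scl B)"
  and alg: "algebra_axioms B" and coalg: "coalgebra_axioms B"
  using bialgebra by (auto simp: bialgebra_def)

sublocale V: vector_space "scl B" by (rule vs)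

lemma assoc: "(x \<odot> y) \<odot> z = x \<odot> (y \<odot> z)"
  and unit_left [simp]: "\<e> \<odot> x = x" and unit_right [simp]: "x \<odot> \<e> = x"
  and mul_bilinear: "bilinear_on (scl B) (scl B) (scl B) UNIV UNIV (hmult B)"
  using alg by (auto simp: algebra_axioms_def)

lemma mul_add_left: "(x + y) \<odot> z = x \<odot> z + y \<odot> z"
  and mul_add_right: "z \<odot> (x + y) = z \<odot> x + z \<odot> y"
  and mul_smul_left [simp]: "(c \<star> x) \<odot> z = c \<star> (x \<odot> z)"
  and mul_smul_right [simp]: "z \<odot> (c \<star> x) = c \<star> (z \<odot> x)"
  using mul_bilinear by (auto simp: bilinear_on_def linear_on_def)

lemma counit_add: "\<epsilon> (x + y) = \<epsilon> x + \<epsilon> y"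
  and counit_smul [simp]: "\<epsilon> (c \<star> x) = c * \<epsilon> x"
  using coalg by (auto simp: coalgebra_axioms_def linear_on_def)

lemma counit_mul [simp]: "\<epsilon> (x \<odot> y) = \<epsilon> x * \<epsilon> y" and counit_unit [simp]: "\<epsilon> \<e> = 1"
  using bialgebra by (auto simp: bialgebra_def)

lemma comult_in: "comult B x \<in> tensor_space (scl B) (scl B) UNIV UNIV"
  and comult_add: "comult B (x + y) = comult B x + comult B y"
  and comult_smul: "comult B (c \<star> x) = tscl c (comult B x)"
  using coalg by (auto simp: coalgebra_axioms_def linear_on_def)

lemma linI: "(\<And>x y. f (x + y) = f x + f y) \<Longrightarrow> (\<And>c x. f (c \<star> x) = t c (f x)) \<Longrightarrow> lin t f"
  by (simp add: linear_on_def)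

lemma lin_addD: "lin t f \<Longrightarrow> f (x + y) = f x + f y"
  and lin_smulD: "lin t f \<Longrightarrow> f (c \<star> x) = t c (f x)"
  by (simp_all add: linear_on_def)

lemma lin_zeroD: "lin t f \<Longrightarrow> f 0 = 0"
  by (rule additive_zero) (simp add: lin_addD)

lemma lin_sumD: "lin t f \<Longrightarrow> f (\<Sum>i\<in>I. g i) = (\<Sum>i\<in>I. f (g i))"
  by (rule additive_sum) (simp add: lin_addD)

lemma formI: "(\<And>y. klin (\<lambda>x. f x y)) \<Longrightarrow> (\<And>x. klin (f x)) \<Longrightarrow> form f"
  by (simp add: bilinear_on_def)

lemma lin_id [simp]: "lin (scl B) (\<lambda>x. x)" by (simp add: linear_on_def)
lemma lin_mul [simp]: "hlin f \<Longrightarrow> hlin (\<lambda>x. f x \<odot> y)" "hlin f \<Longrightarrow> hlin (\<lambda>x. y \<odot> f x)"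
  by (simp_all add: linear_on_def mul_add_left mul_add_right)
lemma lin_smul [simp]: "klin \<phi> \<Longrightarrow> hlin (\<lambda>x. \<phi> x \<star> y)" "hlin f \<Longrightarrow> hlin (\<lambda>x. c \<star> f x)"
  by (simp_all add: linear_on_def V.scale_left_distrib V.scale_right_distrib mult.commute)
lemma lin_times [simp]: "klin \<phi> \<Longrightarrow> klin (\<lambda>x. \<phi> x * c)" "klin \<phi> \<Longrightarrow> klin (\<lambda>x. c * \<phi> x)"
  by (simp_all add: linear_on_def algebra_simps)
lemma lin_counit [simp]: "hlin f \<Longrightarrow> klin (\<lambda>x. \<epsilon> (f x))"
  by (simp add: linear_on_def counit_add)
lemma lin_form [simp]: "form F \<Longrightarrow> hlin f \<Longrightarrow> klin (\<lambda>x. F (f x) y)"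
    "form F \<Longrightarrow> hlin f \<Longrightarrow> klin (\<lambda>x. F y (f x))"
  by (simp_all add: bilinear_on_def linear_on_def)
lemma lin_sum [simp]:
  assumes "vector_space t" "\<And>i. i \<in> I \<Longrightarrow> lin t (f i)" shows "lin t (\<lambda>x. \<Sum>i\<in>I. f i x)"
proof -
  interpret T: vector_space t by fact
  show ?thesis using assms(2) by (simp add: linear_on_def sum.distrib T.scale_sum_right)
qed
lemma lin_sum_H [simp]: "(\<And>i. i \<in> I \<Longrightarrow> hlin (f i)) \<Longrightarrow> hlin (\<lambda>x. \<Sum>i\<in>I. f i x)"
  and lin_sum_K [simp]: "(\<And>i. i \<in> I \<Longrightarrow> klin (\<phi> i)) \<Longrightarrow> klin (\<lambda>x. \<Sum>i\<in>I. \<phi> i x)"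
  by (auto intro: lin_sum vs vector_space_mult)

lemma lin_if [simp]: "klin \<phi> \<Longrightarrow> klin (\<lambda>x. if P then \<phi> x else 0)"
  by (simp add: linear_on_def)
lemma lin_comp: "lin s f \<Longrightarrow> linear_on s t UNIV \<phi> \<Longrightarrow> lin t (\<lambda>x. \<phi> (f x))"
  by (simp add: linear_on_def)

lemma sw2_scale: "vector_space t \<Longrightarrow> t c (sw2 B f x) = sw2 B (\<lambda>a b. t c (f a b)) x"
  by (rule sw2_additive) (simp add: vector_space.vector_space_assms(1))

lemma lin_sw2_inner:
  assumes "vector_space t" "\<And>a b. lin t (\<lambda>x. F a b x)"
  shows "lin t (\<lambda>x. sw2 B (\<lambda>a b. F a b x) y)"
  using assms(2) sw2_scale[OF assms(1)] by (simp add: linear_on_def sw2_add)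
lemmas lin_sw2_inner_HK [simp] = lin_sw2_inner[OF vs] lin_sw2_inner[OF vector_space_mult]

text \<open>A tensor is a functional on bilinear forms, and a pure tensor evaluates a form at its
  two legs. For forms the choice of a representation therefore disappears.\<close>

lemma comult_form: "form f \<Longrightarrow> comult B x f = sw2 B f x"
proof -
  assume f: "form f"
  define ps where "ps = (SOME ps. represents (scl B) (scl B) UNIV UNIV ps (comult B x))"
  have "\<exists>ps. represents (scl B) (scl B) UNIV UNIV ps (comult B x)"
    using comult_in[of x] by (simp add: tensor_space_def)
  then have "represents (scl B) (scl B) UNIV UNIV ps (comult B x)"
    unfolding ps_def by (rule someI_ex)
  then have "comult B x = (\<Sum>p\<leftarrow>ps. htens B (fst p) (snd p))"
    by (simp add: represents_def case_prod_unfold)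
  then have "comult B x f = (\<Sum>p\<leftarrow>ps. f (fst p) (snd p))"
    using f by (simp add: sum_list_fun_apply tens_def)
  then show "comult B x f = sw2 B f x"
    unfolding sw2_def tlift_def ps_def[symmetric] case_prod_unfold .
qed

lemma sw2_functional:
  "linear_on t ((*) :: 'k \<Rightarrow> _) UNIV \<phi> \<Longrightarrow> \<phi> (sw2 B f x) = sw2 B (\<lambda>a b. \<phi> (f a b)) x"
  by (rule sw2_additive) (simp add: linear_on_def)

text \<open>The chosen representation of a coproduct does not depend linearly on the element, so
  linearity cannot be read off termwise. After composition with a functional the sum is a value of
  \<open>comult B\<close>, which is linear.\<close>

lemma lin_sw2_arg:
  assumes t: "vector_space t" and F: "\<And>b. lin t (\<lambda>a. F a b)" "\<And>a. lin t (F a)" and g: "hlin g"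
  shows "lin t (\<lambda>x. sw2 B F (g x))"
proof -
  have "sw2 B F (x + y) = sw2 B F x + sw2 B F y" for x y
  proof (rule eq_by_functionals[OF t])
    fix \<phi> assume \<phi>: "linear_on t ((*) :: 'k \<Rightarrow> _) UNIV \<phi>"
    have f: "form (\<lambda>a b. \<phi> (F a b))" by (rule formI) (rule lin_comp[OF _ \<phi>], rule F)+
    show "\<phi> (sw2 B F (x + y)) = \<phi> (sw2 B F x + sw2 B F y)"
      using \<phi> by (simp add: sw2_functional[OF \<phi>] linear_on_def comult_add
          flip: comult_form[OF f])
  qed
  moreover have "sw2 B F (c \<star> x) = t c (sw2 B F x)" for c x
  proof (rule eq_by_functionals[OF t])
    fix \<phi> assume \<phi>: "linear_on t ((*) :: 'k \<Rightarrow> _) UNIV \<phi>"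
    have f: "form (\<lambda>a b. \<phi> (F a b))" by (rule formI) (rule lin_comp[OF _ \<phi>], rule F)+
    have "\<phi> (t c y) = c * \<phi> y" for y using \<phi> by (simp add: linear_on_def)
    then show "\<phi> (sw2 B F (c \<star> x)) = \<phi> (t c (sw2 B F x))"
      using comult_form[OF f, of x] comult_form[OF f, of "c \<star> x"]
      by (simp add: sw2_functional[OF \<phi>] comult_smul tscl_def)
  qed
  ultimately show ?thesis using g by (simp add: linear_on_def)
qed
lemmas lin_sw2_arg_HK [simp] = lin_sw2_arg[OF vs] lin_sw2_arg[OF vector_space_mult]

lemma sw2_push:
  "sw2 B f x \<odot> y = sw2 B (\<lambda>a b. f a b \<odot> y) x" "y \<odot> sw2 B f x = sw2 B (\<lambda>a b. y \<odot> f a b) x"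
  "c \<star> sw2 B f x = sw2 B (\<lambda>a b. c \<star> f a b) x" "sw2 B \<phi> x \<star> y = sw2 B (\<lambda>a b. \<phi> a b \<star> y) x"
  "c * sw2 B \<phi> x = sw2 B (\<lambda>a b. c * \<phi> a b) x" "sw2 B \<phi> x * c = sw2 B (\<lambda>a b. \<phi> a b * c) x"
  by (rule sw2_additive, simp add: mul_add_left mul_add_right V.scale_left_distrib
      V.scale_right_distrib algebra_simps)+

lemma sw2_lin: "hlin \<phi> \<Longrightarrow> \<phi> (sw2 B f x) = sw2 B (\<lambda>a b. \<phi> (f a b)) x"
  "klin \<psi> \<Longrightarrow> \<psi> (sw2 B f x) = sw2 B (\<lambda>a b. \<psi> (f a b)) x"
  by (rule sw2_additive, simp add: lin_addD)+

lemma sw2_counit_left: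
  assumes "lin t f" shows "sw2 B (\<lambda>a b. f (\<epsilon> a \<star> b)) x = f x"
  using coalg sw2_additive[of f B "\<lambda>a b. \<epsilon> a \<star> b" x] lin_addD[OF assms]
  by (simp add: coalgebra_axioms_def)

lemma sw2_counit_right:
  assumes "lin t f" shows "sw2 B (\<lambda>a b. f (\<epsilon> b \<star> a)) x = f x"
  using coalg sw2_additive[of f B "\<lambda>a b. \<epsilon> b \<star> a" x] lin_addD[OF assms]
  by (simp add: coalgebra_axioms_def)

lemma sw2_counit:
  "hlin f \<Longrightarrow> sw2 B (\<lambda>a b. \<epsilon> a \<star> f b) x = f x" "hlin f \<Longrightarrow> sw2 B (\<lambda>a b. \<epsilon> b \<star> f a) x = f x"
  "klin p \<Longrightarrow> sw2 B (\<lambda>a b. \<epsilon> a * p b) x = p x" "klin p \<Longrightarrow> sw2 B (\<lambda>a b. p a * \<epsilon> b) x = p x"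
  "klin p \<Longrightarrow> sw2 B (\<lambda>a b. p b * \<epsilon> a) x = p x" "klin p \<Longrightarrow> sw2 B (\<lambda>a b. \<epsilon> b * p a) x = p x"
  using sw2_counit_left[of "scl B" f x] sw2_counit_right[of "scl B" f x]
    sw2_counit_left[of "(*)" p x] sw2_counit_right[of "(*)" p x]
  by (simp_all add: lin_smulD mult.commute)

lemma tensor_eval:
  assumes "t \<in> tensor_space (scl B) (scl B) UNIV UNIV"
  obtains ps where "\<And>f. form f \<Longrightarrow> t f = (\<Sum>p\<leftarrow>ps. f (fst p) (snd p))"
proof -
  obtain ps where "t = (\<Sum>p\<leftarrow>ps. htens B (fst p) (snd p))"
    using assms by (auto simp: tensor_space_def represents_def case_prod_unfold)
  then show ?thesis using that[of ps]
    by (simp add: sum_list_fun_apply tens_def)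
qed

lemma tens_mem: "a \<in> C \<Longrightarrow> htens B a b \<in> tensor_space (scl B) (scl B) C UNIV"
  by (auto simp: tensor_space_def represents_def intro!: exI[of _ "[(a, b)]"])

lemmas tens_in = tens_mem[OF UNIV_I]

lemma tens_smul: "htens B (k \<star> a) c = tscl k (htens B a c)"
  by (auto simp: fun_eq_iff tens_def tscl_def bilinear_on_def linear_on_def)

lemma tensor_subspace:
  assumes "V.subspace C"
  shows "module.subspace tscl (tensor_space (scl B) (scl B) C UNIV)"
proof -
  interpret T: vector_space "tscl :: 'k \<Rightarrow> ('h, 'h, 'k) tensor \<Rightarrow> _" by (rule vector_space_tscl)
  let ?T = "tensor_space (scl B) (scl B) C UNIV"
  show ?thesis
  proof (rule T.subspaceI)
    show "0 \<in> ?T" by (auto simp: tensor_space_def represents_def intro!: exI[of _ "[]"])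
  next
    fix x y assume "x \<in> ?T" "y \<in> ?T"
    then obtain ps qs where "x = (\<Sum>p\<leftarrow>ps. htens B (fst p) (snd p))" "set ps \<subseteq> C \<times> UNIV"
      "y = (\<Sum>p\<leftarrow>qs. htens B (fst p) (snd p))" "set qs \<subseteq> C \<times> UNIV"
      by (auto simp: tensor_space_def represents_def case_prod_unfold)
    then show "x + y \<in> ?T"
      by (auto simp: tensor_space_def represents_def case_prod_unfold intro!: exI[of _ "ps @ qs"])
  next
    fix c x assume "x \<in> ?T"
    then obtain ps where x: "x = (\<Sum>p\<leftarrow>ps. htens B (fst p) (snd p))" "set ps \<subseteq> C \<times> UNIV"
      by (auto simp: tensor_space_def represents_def case_prod_unfold)
    have "tscl c x = (\<Sum>p\<leftarrow>map (\<lambda>p. (c \<star> fst p, snd p)) ps. htens B (fst p) (snd p))"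
      unfolding x by (subst additive_sum_list[of "tscl c"])
        (simp_all add: tens_smul T.scale_right_distrib o_def)
    then show "tscl c x \<in> ?T" using x(2) V.subspace_scale[OF assms]
      unfolding tensor_space_def represents_def case_prod_unfold mem_Collect_eq
      by (intro exI[of _ "map (\<lambda>p. (c \<star> fst p, snd p)) ps"]) auto
  qed
qed

lemmas tensor_space_subspace = tensor_subspace[OF V.subspace_UNIV]

text \<open>The axiom is an equation in H \<otimes> (H \<otimes> H) whose right factor is formally
  the whole type of functionals. To use it, a trilinear form has to be turned into a bilinear form
  on H and that type.\<close>

lemma coassoc_form:
  assumes f: "\<And>b c. klin (\<lambda>a. f a b c)" "\<And>a c. klin (\<lambda>b. f a b c)" "\<And>a b. klin (f a b)"
  shows "sw2 B (\<lambda>u c. sw2 B (\<lambda>a b. f a b c) u) x = sw2 B (\<lambda>a u. sw2 B (f a) u) x"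
proof -
  obtain P where P: "linear_on tscl tscl UNIV P"
    "\<And>t. P t \<in> tensor_space (scl B) (scl B) UNIV UNIV"
    "\<And>t. t \<in> tensor_space (scl B) (scl B) UNIV UNIV \<Longrightarrow> P t = t"
    using subspace_projection[OF vector_space_tscl tensor_space_subspace] by blast
  \<comment> \<open>An arbitrary functional \<open>t\<close> need not be additive on forms, so
    \<open>t (f a)\<close> need not be linear in \<open>a\<close>. Projecting \<open>t\<close> to
    the genuine tensors first makes \<open>F\<close> bilinear and changes nothing at
    tensors.\<close>
  define F where "F = (\<lambda>a t. P t (f a))"
  have fa: "form (f a)" for a by (rule formI) (rule f)+
  have "F (a + a') t = F a t + F a' t" "F (k \<star> a) t = k * F a t" for a a' k t
  proof -
    obtain ps where *: "\<And>f. form f \<Longrightarrow> P t f = (\<Sum>p\<leftarrow>ps. f (fst p) (snd p))"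
      using tensor_eval[OF P(2)] by blast
    show "F (a + a') t = F a t + F a' t" "F (k \<star> a) t = k * F a t"
      using lin_addD[OF f(1)] lin_smulD[OF f(1)]
      by (simp_all add: F_def * fa sum_list_addf sum_list_const_mult)
  qed
  moreover have "linear_on tscl (*) UNIV (F a)" for a
    using P(1) by (simp add: F_def linear_on_def tscl_def)
  ultimately have F: "bilinear_on (scl B) tscl (*) UNIV UNIV F"
    by (simp add: bilinear_on_def linear_on_def)
  have tensF: "tens (scl B) tscl a t F = F a t" for a t using F by (simp add: tens_def)
  have tens2: "htens B b c (f a) = f a b c" for a b c using fa by (simp add: tens_def)
  have "sw3 B (\<lambda>a1 a2 a3. tens (scl B) tscl a1 (htens B a2 a3)) x F =
        sw2 B (\<lambda>a1 u. tens (scl B) tscl a1 (comult B u)) x F"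
    using coalg by (simp add: coalgebra_axioms_def)
  then show ?thesis
    unfolding sw3_def sw2_apply tensF
    by (simp add: F_def P(3) comult_in tens_in comult_form[OF fa] tens2)
qed

lemma coassoc:
  assumes t: "vector_space t"
    and f: "\<And>b c. lin t (\<lambda>a. f a b c)" "\<And>a c. lin t (\<lambda>b. f a b c)" "\<And>a b. lin t (f a b)"
  shows "sw2 B (\<lambda>u c. sw2 B (\<lambda>a b. f a b c) u) x = sw2 B (\<lambda>a u. sw2 B (f a) u) x"
proof (rule eq_by_functionals[OF t])
  fix \<phi> assume \<phi>: "linear_on t ((*) :: 'k \<Rightarrow> _) UNIV \<phi>"
  show "\<phi> (sw2 B (\<lambda>u c. sw2 B (\<lambda>a b. f a b c) u) x) = \<phi> (sw2 B (\<lambda>a u. sw2 B (f a) u) x)"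
    unfolding sw2_functional[OF \<phi>] by (rule coassoc_form; rule lin_comp[OF _ \<phi>], rule f)
qed
lemmas coassoc_HK = coassoc[OF vs] coassoc[OF vector_space_mult]

lemma sw2_mul:
  assumes t: "vector_space t" and f: "\<And>b. lin t (\<lambda>a. f a b)" "\<And>a. lin t (f a)"
  shows "sw2 B f (x \<odot> y) = sw2 B (\<lambda>a b. sw2 B (\<lambda>c d. f (a \<odot> c) (b \<odot> d)) y) x"
proof (rule eq_by_functionals[OF t])
  fix \<phi> assume \<phi>: "linear_on t ((*) :: 'k \<Rightarrow> _) UNIV \<phi>"
  have F: "form (\<lambda>a b. \<phi> (f a b))" by (rule formI) (rule lin_comp[OF _ \<phi>], rule f)+
  have "comult B (x \<odot> y) = sw2 B (\<lambda>a b. sw2 B (\<lambda>c d. htens B (a \<odot> c) (b \<odot> d)) y) x"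
    using bialgebra by (simp add: bialgebra_def)
  then show "\<phi> (sw2 B f (x \<odot> y)) = \<phi> (sw2 B (\<lambda>a b. sw2 B (\<lambda>c d. f (a \<odot> c) (b \<odot> d)) y) x)"
    by (simp add: sw2_functional[OF \<phi>] comult_form[OF F, symmetric]) (simp add: sw2_apply tens_def F)
qed
lemmas sw2_mul_HK = sw2_mul[OF vs] sw2_mul[OF vector_space_mult]

lemma sw2_grouplike:
  assumes "comult B g = htens B g g" and t: "vector_space t"
    and f: "\<And>b. lin t (\<lambda>a. f a b)" "\<And>a. lin t (f a)"
  shows "sw2 B f g = f g g"
proof (rule eq_by_functionals[OF t])
  fix \<phi> assume \<phi>: "linear_on t ((*) :: 'k \<Rightarrow> _) UNIV \<phi>"
  have F: "form (\<lambda>a b. \<phi> (f a b))" by (rule formI) (rule lin_comp[OF _ \<phi>], rule f)+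
  show "\<phi> (sw2 B f g) = \<phi> (f g g)"
    by (simp add: sw2_functional[OF \<phi>] comult_form[OF F, symmetric] assms(1)) (simp add: tens_def F)
qed

lemma comult_unit: "comult B \<e> = htens B \<e> \<e>"
  using bialgebra by (simp add: bialgebra_def)

text \<open>Sums of pure tensors vanish at arguments that are not bilinear, so their values at forms
  determine them.\<close>

lemma tensor_eqI:
  assumes "t \<in> tensor_space (scl B) (scl B) UNIV UNIV" "u \<in> tensor_space (scl B) (scl B) UNIV UNIV"
    and "\<And>f. form f \<Longrightarrow> t f = u f"
  shows "t = u"
proof
  have *: "t f = 0" if "t \<in> tensor_space (scl B) (scl B) UNIV UNIV" "\<not> form f" for t f
    using that by (auto simp: tensor_space_def represents_def case_prod_unfold sum_list_fun_apply tens_def)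
  show "t f = u f" for f
    using assms(3)[of f] *[OF assms(1), of f] *[OF assms(2), of f] by (cases "form f") simp_all
qed

end

section \<open>The antipode of the opposite Hopf algebra\<close>

locale op_hopf_alg = bialg +
  fixes T :: "'b \<Rightarrow> 'b"
  assumes T_op: "is_antipode (B\<lparr>hmult := \<lambda>a b. hmult B b a\<rparr>) T"

lemma sw2_update [simp]: "sw2 (B\<lparr>hmult := m\<rparr>) = sw2 B" "sw2 (B\<lparr>antipode := S\<rparr>) = sw2 B"
  by (simp_all add: sw2_def fun_eq_iff)

context bialg
begin

lemma is_op_antipode:
  "is_antipode (B\<lparr>hmult := \<lambda>a b. hmult B b a\<rparr>) S \<longleftrightarrow> hlin S \<and>
     (\<forall>x. sw2 B (\<lambda>a b. b \<odot> S a) x = \<epsilon> x \<star> \<e>) \<and> (\<forall>x. sw2 B (\<lambda>a b. S b \<odot> a) x = \<epsilon> x \<star> \<e>)"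
  by (simp add: is_antipode_def)

text \<open>Uniqueness of convolution inverses; it is what makes the definite description in
  \<open>op_hopf\<close> denote a given \<open>T\<close>.\<close>

lemma op_antipode_unique:
  assumes S: "is_antipode (B\<lparr>hmult := \<lambda>a b. hmult B b a\<rparr>) S"
    and T: "is_antipode (B\<lparr>hmult := \<lambda>a b. hmult B b a\<rparr>) T"
  shows "S = T"
proof
  fix x
  have lin [simp]: "hlin f \<Longrightarrow> hlin (\<lambda>x. S (f x))" "hlin f \<Longrightarrow> hlin (\<lambda>x. T (f x))" for f
    using S T by (auto simp: is_op_antipode intro: lin_comp)
  have c: "\<epsilon> x \<star> \<e> = sw2 B (\<lambda>a b. b \<odot> T a) x" "\<epsilon> x \<star> \<e> = sw2 B (\<lambda>a b. S b \<odot> a) x" for x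
    using S T by (simp_all add: is_op_antipode)
  have "S x = sw2 B (\<lambda>u c. \<epsilon> u \<star> S c) x" by (simp add: sw2_counit)
  also have "\<dots> = sw2 B (\<lambda>u c. S c \<odot> (\<epsilon> u \<star> \<e>)) x" by simp
  also have "\<dots> = sw2 B (\<lambda>u c. sw2 B (\<lambda>a b. S c \<odot> (b \<odot> T a)) u) x" by (simp only: c(1) sw2_push)
  also have "\<dots> = sw2 B (\<lambda>a u. sw2 B (\<lambda>b c. S c \<odot> (b \<odot> T a)) u) x"
    by (rule coassoc_HK) simp_all
  also have "\<dots> = sw2 B (\<lambda>a u. (\<epsilon> u \<star> \<e>) \<odot> T a) x" by (simp only: c(2) sw2_push assoc)
  also have "\<dots> = T x" by (simp add: sw2_counit)
  finally show "S x = T x" .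
qed

end

context op_hopf_alg
begin

lemma antipode_op: "antipode (op_hopf B) = T"
proof -
  have "(THE S. is_antipode (B\<lparr>hmult := \<lambda>a b. hmult B b a\<rparr>) S) = T"
    using T_op op_antipode_unique by (intro the_equality) auto
  then show ?thesis by (simp add: op_hopf_def Let_def)
qed

lemma lin_T0: "hlin T" using T_op by (simp add: is_op_antipode)
lemma lin_T [simp]: "hlin f \<Longrightarrow> hlin (\<lambda>x. T (f x))" using lin_T0 by (rule lin_comp[rotated])
lemmas T_smul [simp] = lin_smulD[OF lin_T0]

lemma T_cancel:
  "sw2 B (\<lambda>a b. b \<odot> T a) x = \<epsilon> x \<star> \<e>" "sw2 B (\<lambda>a b. T b \<odot> a) x = \<epsilon> x \<star> \<e>"
  using T_op by (simp_all add: is_op_antipode)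

lemma T_cancel':
  "sw2 B (\<lambda>a b. b \<odot> (T a \<odot> z)) x = \<epsilon> x \<star> z" "sw2 B (\<lambda>a b. T b \<odot> (a \<odot> z)) x = \<epsilon> x \<star> z"
  by (simp_all add: T_cancel flip: assoc sw2_push)

lemma T_unit [simp]: "T \<e> = \<e>"
  using T_cancel(2)[of \<e>] by (subst (asm) sw2_grouplike[OF comult_unit vs]) simp_all

text \<open>Both sides are convolution inverses of the multiplication, viewed as a map from H
  \<otimes> H.\<close>

lemma T_mul: "T (x \<odot> y) = T y \<odot> T x"
proof -
  \<comment> \<open>To be summed over the triple coproducts \<open>a, b, u\<close> of
    \<open>x\<close> and \<open>c, d, v\<close> of \<open>y\<close>. Cancelling \<open>T u\<close>
    with \<open>b\<close> and then \<open>T v\<close> with \<open>d\<close> leaves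
    \<open>T (x \<odot> y)\<close>; cancelling \<open>b \<odot> d\<close> with
    \<open>T (a \<odot> c)\<close> leaves \<open>T y \<odot> T x\<close>.\<close>
  define F where "F = (\<lambda>a b u c d v. T v \<odot> (T u \<odot> (b \<odot> (d \<odot> T (a \<odot> c)))))"
  have "T (x \<odot> y) = sw2 B (\<lambda>a u. sw2 B (\<lambda>c v. \<epsilon> u \<star> \<epsilon> v \<star> T (a \<odot> c)) y) x"
    by (simp add: sw2_counit del: V.scale_scale flip: sw2_push)
  also have "\<dots> = sw2 B (\<lambda>a u. sw2 B (\<lambda>c v. sw2 B (\<lambda>d v'. sw2 B (\<lambda>b u'. F a b u' c d v') u) v) y) x"
    unfolding F_def by (simp add: T_cancel' flip: sw2_push)
  also have "\<dots> = sw2 B (\<lambda>a u. sw2 B (\<lambda>b u'. sw2 B (\<lambda>c v. sw2 B (\<lambda>d v'. F a b u' c d v') v) y) u) x"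
    by (subst sw2_swap[of B _ _ u for u]) (subst sw2_swap[of B _ _ u for u], rule refl)
  also have "\<dots> = sw2 B (\<lambda>p u. sw2 B (\<lambda>a b. sw2 B (\<lambda>q v. sw2 B (\<lambda>c d. F a b u c d v) q) y) p) x"
    by (simp add: coassoc_HK F_def)
  also have "\<dots> = sw2 B (\<lambda>p u. sw2 B (\<lambda>q v. sw2 B (\<lambda>a b. sw2 B (\<lambda>c d. F a b u c d v) q) p) y) x"
    by (subst sw2_swap) (rule refl)
  also have "\<dots> = sw2 B (\<lambda>p u. sw2 B (\<lambda>q v. sw2 B (\<lambda>s t. T v \<odot> (T u \<odot> (t \<odot> T s))) (p \<odot> q)) y) x"
    by (simp add: sw2_mul_HK F_def assoc)
  also have "\<dots> = T y \<odot> T x"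
    by (simp add: T_cancel sw2_counit flip: sw2_push V.scale_scale)
  finally show ?thesis .
qed

text \<open>The coproduct of \<open>T x\<close> and the flipped coproduct of \<open>x\<close> with
  \<open>T\<close> applied to both legs are convolution inverses of the same map, the coproduct, for
  the opposite product on H \<otimes> H.\<close>

lemma sw2_T_form:
  assumes f [simp]: "form f"
  shows "sw2 B f (T x) = sw2 B (\<lambda>a b. f (T b) (T a)) x"
proof -
  note lin_form [OF f, simp]
  \<comment> \<open>Here \<open>y, z\<close> will be the legs of \<open>T p\<close> for the first
    leg \<open>p\<close> of \<open>x\<close>, and \<open>a, b, c, d\<close> the fourfold coproduct
    of the rest. Fact 1 cancels \<open>T c\<close> with \<open>b\<close> and then \<open>T d\<close>
    with \<open>a\<close>; fact 2 recognises \<open>a \<odot> y\<close> and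
    \<open>b \<odot> z\<close> as the legs of \<open>w \<odot> T p\<close>, which sums to a multiple
    of the unit.\<close>
  define F where "F = (\<lambda>y z a b c d. f (T d \<odot> (a \<odot> y)) (T c \<odot> (b \<odot> z)))"
  have 1: "sw2 B (\<lambda>w v. sw2 B (\<lambda>a b. sw2 B (\<lambda>c d. F y z a b c d) v) w) u = \<epsilon> u * f y z" for y z u
  proof -
    have "sw2 B (\<lambda>w v. sw2 B (\<lambda>a b. sw2 B (\<lambda>c d. F y z a b c d) v) w) u =
      sw2 B (\<lambda>a w. sw2 B (\<lambda>s d. sw2 B (\<lambda>b c. F y z a b c d) s) w) u"
      by (simp add: coassoc_HK F_def)
    also have "\<dots> = sw2 B (\<lambda>a w. sw2 B (\<lambda>s d. f (T d \<odot> (a \<odot> y)) (sw2 B (\<lambda>b c. T c \<odot> (b \<odot> z)) s)) w) u"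
      unfolding F_def by (subst sw2_lin(2)[of "f _"]) simp_all
    also have "\<dots> = sw2 B (\<lambda>a w. f (T w \<odot> (a \<odot> y)) z) u"
      using lin_smulD[OF lin_form(2)[OF f lin_id]] by (simp add: T_cancel' sw2_counit)
    also have "\<dots> = f (sw2 B (\<lambda>a w. T w \<odot> (a \<odot> y)) u) z"
      by (subst sw2_lin(2)[of "\<lambda>x. f x z"]) simp_all
    finally show ?thesis
      using lin_smulD[OF lin_form(1)[OF f lin_id]] by (simp add: T_cancel')
  qed
  have 2: "sw2 B (\<lambda>p w. sw2 B (\<lambda>a b. sw2 B (\<lambda>y z. F y z a b c d) (T p)) w) q = \<epsilon> q * f (T d) (T c)" for c d q
  proof -
    define h where "h = (\<lambda>s t. f (T d \<odot> s) (T c \<odot> t))"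
    have h: "form h" unfolding h_def by (rule formI) simp_all
    note [simp] = lin_form[OF h] lin_form[OF h lin_id]
    have "sw2 B (\<lambda>p w. sw2 B (\<lambda>a b. sw2 B (\<lambda>y z. F y z a b c d) (T p)) w) q =
      sw2 B (\<lambda>p w. sw2 B h (w \<odot> T p)) q"
      by (simp add: sw2_mul_HK) (simp add: F_def h_def)
    also have "\<dots> = sw2 B h (\<epsilon> q \<star> \<e>)"
      using h by (simp add: T_cancel flip: sw2_lin(2)[of "sw2 B h"])
    also have "\<dots> = \<epsilon> q * sw2 B h \<e>"
      using h by (simp add: lin_smulD[of "(*)" "sw2 B h"])
    also have "sw2 B h \<e> = h \<e> \<e>"
      using h by (subst sw2_grouplike[OF comult_unit vector_space_mult]) simp_all
    finally show ?thesis by (simp add: h_def)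
  qed
  have "sw2 B f (T x) = sw2 B (\<lambda>p u. sw2 B (\<lambda>y z. \<epsilon> u * f y z) (T p)) x"
    by (simp add: sw2_counit flip: sw2_push)
  also have "\<dots> = sw2 B (\<lambda>p u. sw2 B (\<lambda>y z. sw2 B (\<lambda>w v. sw2 B (\<lambda>a b. sw2 B (\<lambda>c d. F y z a b c d) v) w) u) (T p)) x"
    by (simp add: 1)
  also have "\<dots> = sw2 B (\<lambda>p u. sw2 B (\<lambda>w v. sw2 B (\<lambda>y z. sw2 B (\<lambda>a b. sw2 B (\<lambda>c d. F y z a b c d) v) w) (T p)) u) x"
    by (subst sw2_swap) (rule refl)
  also have "\<dots> = sw2 B (\<lambda>q v. sw2 B (\<lambda>p w. sw2 B (\<lambda>y z. sw2 B (\<lambda>a b. sw2 B (\<lambda>c d. F y z a b c d) v) w) (T p)) q) x"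
    by (simp add: coassoc_HK F_def)
  also have "\<dots> = sw2 B (\<lambda>q v. sw2 B (\<lambda>p w. sw2 B (\<lambda>c d. sw2 B (\<lambda>a b. sw2 B (\<lambda>y z. F y z a b c d) (T p)) w) v) q) x"
  proof -
    have "sw2 B (\<lambda>y z. sw2 B (\<lambda>a b. sw2 B (\<lambda>c d. F y z a b c d) v) w) (T p) =
      sw2 B (\<lambda>c d. sw2 B (\<lambda>a b. sw2 B (\<lambda>y z. F y z a b c d) (T p)) w) v" for v w p
      by (simp only: sw2_swap[of B _ v w] sw2_swap[of B _ v "T p"] sw2_swap[of B _ w "T p"])
    then show ?thesis by (simp only:)
  qed
  also have "\<dots> = sw2 B (\<lambda>q v. sw2 B (\<lambda>c d. sw2 B (\<lambda>p w. sw2 B (\<lambda>a b. sw2 B (\<lambda>y z. F y z a b c d) (T p)) w) q) v) x"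
    by (subst sw2_swap) (rule refl)
  also have "\<dots> = sw2 B (\<lambda>a b. f (T b) (T a)) x"
    by (simp add: 2 sw2_counit flip: sw2_push)
  finally show ?thesis .
qed

lemma sw2_T:
  assumes t: "vector_space t" and f: "\<And>b. lin t (\<lambda>a. f a b)" "\<And>a. lin t (f a)"
  shows "sw2 B f (T x) = sw2 B (\<lambda>a b. f (T b) (T a)) x"
proof (rule eq_by_functionals[OF t])
  fix \<phi> assume \<phi>: "linear_on t ((*) :: 'a \<Rightarrow> _) UNIV \<phi>"
  show "\<phi> (sw2 B f (T x)) = \<phi> (sw2 B (\<lambda>a b. f (T b) (T a)) x)"
    unfolding sw2_functional[OF \<phi>] by (rule sw2_T_form, rule formI; rule lin_comp[OF _ \<phi>], rule f)
qed
lemmas sw2_T_HK = sw2_T[OF vs] sw2_T[OF vector_space_mult]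

end

section \<open>The modules generated by a grouplike element\<close>

lemma additive_sum_list_mem:
  assumes "module.subspace s S" "vector_space s" "\<And>p. p \<in> set ps \<Longrightarrow> f p \<in> S"
  shows "(\<Sum>p\<leftarrow>ps. f p) \<in> S"
proof -
  interpret vector_space s by fact
  show ?thesis using assms(3) by (induction ps) (auto intro: subspace_0 subspace_add assms(1))
qed

lemma sw2_mem:
  assumes "module.subspace s S" "vector_space s" "\<And>a b. F a b \<in> S"
  shows "sw2 B F x \<in> S"
  unfolding sw2_def tlift_def case_prod_unfold
  by (rule additive_sum_list_mem[OF assms(1,2)]) (rule assms(3))

lemma tens_linear:
  "linear_on sv tscl UNIV (\<lambda>v. tens sv sw v w)" "linear_on sw tscl UNIV (tens sv sw v)"
  by (auto simp: linear_on_def fun_eq_iff tens_def tscl_def bilinear_on_def)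

text \<open>The representation selected by \<open>swc\<close> has its left legs in the carrier, so
  agreement there suffices, with no linearity involved.\<close>

lemma swc_cong:
  assumes "coact M m \<in> tensor_space (yscl M) (scl B) (ycarrier M) UNIV"
    and "\<And>m0 m1. m0 \<in> ycarrier M \<Longrightarrow> f m0 m1 = f' m0 m1"
  shows "swc B M f m = swc B M f' m"
proof -
  define ps where "ps = (SOME ps. represents (yscl M) (scl B) (ycarrier M) UNIV ps (coact M m))"
  have "\<exists>ps. represents (yscl M) (scl B) (ycarrier M) UNIV ps (coact M m)"
    using assms(1) by (simp add: tensor_space_def)
  then have "represents (yscl M) (scl B) (ycarrier M) UNIV ps (coact M m)"
    unfolding ps_def by (rule someI_ex)
  then have "(\<Sum>p\<leftarrow>ps. f (fst p) (snd p)) = (\<Sum>p\<leftarrow>ps. f' (fst p) (snd p))"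
    by (intro arg_cong[of _ _ sum_list] map_cong refl assms(2)) (auto simp: represents_def)
  then show ?thesis unfolding swc_def tlift_def case_prod_unfold ps_def .
qed

lemma swc_eqI:
  assumes "ycarrier M' = ycarrier M" "yscl M' = yscl M" "coact M' = coact M"
  shows "swc B M' f m = swc B M f m"
  by (simp add: swc_def assms)

text \<open>The axioms evaluate the action only on the carrier. This transports the Yetter-Drinfeld
  structure to the twisted module, whose action is compared with another one only there.\<close>

lemma yd_module_cong:
  assumes M: "yd_module B M"
    and eq: "ycarrier M' = ycarrier M" "yscl M' = yscl M" "coact M' = coact M"
    and act: "\<And>a m. m \<in> ycarrier M \<Longrightarrow> act M' a m = act M a m"
  shows "yd_module B M'"
proof -
  note swc = swc_eqI[of M' M, OF eq]
  have 1: "coact M m \<in> tensor_space (yscl M) (scl B) (ycarrier M) UNIV" if "m \<in> ycarrier M" for m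
    using M that by (simp add: yd_module_def right_comodule_def)
  interpret vector_space "yscl M" using M by (simp add: yd_module_def)
  have "subspace (ycarrier M)" using M by (simp add: yd_module_def)
  then have closed: "\<And>x y. x \<in> ycarrier M \<Longrightarrow> y \<in> ycarrier M \<Longrightarrow> x + y \<in> ycarrier M"
    "\<And>c x. x \<in> ycarrier M \<Longrightarrow> yscl M c x \<in> ycarrier M"
    by (auto intro: subspace_add subspace_scale)
  have l: "left_module B M'"
    using M closed unfolding yd_module_def left_module_def bilinear_on_def linear_on_def
    by (simp add: eq act)
  have r: "right_comodule B M'"
    using M unfolding yd_module_def right_comodule_def by (simp add: eq swc)
  have "sw2 B (\<lambda>a1 a2. swc B M' (\<lambda>m0 m1. ytens B M' (act M' a1 m0) (hmult B a2 m1)) m) a =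
        sw2 B (\<lambda>a1 a2. swc B M' (\<lambda>n0 n1. ytens B M' n0 (hmult B n1 a1)) (act M' a2 m)) a"
    if m: "m \<in> ycarrier M" for a m
  proof -
    have "swc B M (\<lambda>m0 m1. ytens B M (act M' a1 m0) (hmult B a2 m1)) m =
      swc B M (\<lambda>m0 m1. ytens B M (act M a1 m0) (hmult B a2 m1)) m" for a1 a2
      by (rule swc_cong[OF 1[OF m]]) (simp add: act)
    then show ?thesis using M m by (simp add: swc eq act yd_module_def)
  qed
  then show ?thesis using M l r by (simp add: yd_module_def eq)
qed

context bialg
begin

text \<open>A representation with left legs in the carrier also represents the coproduct in H
  \<otimes> H. Coaction sums of subcomodules of H thus become ordinary Sweedler sums.\<close>

lemma swc_eq_sw2:
  assumes M: "yscl M = scl B" "coact M = comult B" and C: "V.subspace (ycarrier M)"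
    and m: "comult B m \<in> tensor_space (scl B) (scl B) (ycarrier M) UNIV"
    and t: "vector_space t" and f: "\<And>b. lin t (\<lambda>a. f a b)" "\<And>a. lin t (f a)"
  shows "swc B M f m = sw2 B f m"
proof -
  define ps where "ps = (SOME ps. represents (scl B) (scl B) (ycarrier M) UNIV ps (comult B m))"
  have "\<exists>ps. represents (scl B) (scl B) (ycarrier M) UNIV ps (comult B m)"
    using m by (simp add: tensor_space_def)
  then have "represents (scl B) (scl B) (ycarrier M) UNIV ps (comult B m)"
    unfolding ps_def by (rule someI_ex)
  then have ps: "represents (scl B) (scl B) UNIV UNIV ps (comult B m)"
    by (auto simp: represents_def)
  have "tlift (scl B) (scl B) UNIV UNIV f (comult B m) = (\<Sum>(v, w)\<leftarrow>ps. f v w)"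
    using ps tlift_sum[OF vs vs t V.subspace_UNIV V.subspace_UNIV, of f ps] f
    by (simp add: represents_def bilinear_on_def)
  then show ?thesis
    unfolding swc_def sw2_def M ps_def[symmetric] by (simp add: tlift_def ps_def[symmetric])
qed

lemma lin_tens [simp]:
  "hlin h \<Longrightarrow> lin tscl (\<lambda>x. tens (scl B) s (h x) w)" "lin t k \<Longrightarrow> lin tscl (\<lambda>x. tens s' t v (k x))"
  by (rule lin_comp[OF _ tens_linear(1)], assumption) (rule lin_comp[OF _ tens_linear(2)])

lemma lin_comult [simp]: "hlin h \<Longrightarrow> lin tscl (\<lambda>x. comult B (h x))"
  by (simp add: comult_add comult_smul linear_on_def)

lemmas lin_sw2_tensor [simp] =
  lin_sw2_inner[OF vector_space_tscl] lin_sw2_arg[OF vector_space_tscl]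

lemma sw2_tens: "sw2 B (htens B) x = comult B x"
  by (rule tensor_eqI[OF sw2_mem[OF tensor_space_subspace vector_space_tscl tens_in] comult_in])
    (simp add: sw2_apply comult_form tens_def)

end

section \<open>The action on H twisted by a character\<close>

locale op_hopf_char = op_hopf_alg +
  fixes \<beta> :: "'b \<Rightarrow> 'a"
  assumes lin_char0: "klin \<beta>" and char_mul [simp]: "\<beta> (x \<odot> y) = \<beta> x * \<beta> y"
    and char_unit [simp]: "\<beta> \<e> = 1"
begin

lemma lin_char [simp]: "hlin f \<Longrightarrow> klin (\<lambda>x. \<beta> (f x))"
  using lin_char0 by (rule lin_comp[rotated])

lemma bullet_eq:
  "bullet B \<beta> x a = sw2 B (\<lambda>x1 u. sw2 B (\<lambda>x2 x3. \<beta> x2 \<star> (x3 \<odot> (a \<odot> T x1))) u) x"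
  by (simp add: bullet_def sw3_def antipode_op assoc coassoc_HK)

lemma lin_bullet [simp]:
  "hlin f \<Longrightarrow> hlin (\<lambda>x. bullet B \<beta> (f x) a)" "hlin f \<Longrightarrow> hlin (\<lambda>x. bullet B \<beta> a (f x))"
  by (simp_all add: bullet_eq)

lemma bullet_add: "bullet B \<beta> (x + y) a = bullet B \<beta> x a + bullet B \<beta> y a"
    "bullet B \<beta> a (x + y) = bullet B \<beta> a x + bullet B \<beta> a y"
  and bullet_smul: "bullet B \<beta> (c \<star> x) a = c \<star> bullet B \<beta> x a"
    "bullet B \<beta> a (c \<star> x) = c \<star> bullet B \<beta> a x"
  using lin_addD[of "scl B" "\<lambda>x. bullet B \<beta> x a"] lin_addD[of "scl B" "bullet B \<beta> a"]
    lin_smulD[of "scl B" "\<lambda>x. bullet B \<beta> x a"] lin_smulD[of "scl B" "bullet B \<beta> a"]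
    lin_bullet(1)[OF lin_id] lin_bullet(2)[OF lin_id] by auto

lemma bullet_zero: "bullet B \<beta> 0 a = 0"
  by (rule lin_zeroD[of "scl B" "\<lambda>x. bullet B \<beta> x a"]) simp

lemma bullet_unit: "bullet B \<beta> \<e> a = a"
  unfolding bullet_eq by (simp add: sw2_grouplike[OF comult_unit vs])

lemma bullet_mul: "bullet B \<beta> (x \<odot> y) a = bullet B \<beta> x (bullet B \<beta> y a)"
proof -
  define F where "F = (\<lambda>x1 x2 x3 y1 y2 y3. (\<beta> x2 * \<beta> y2) \<star> (x3 \<odot> (y3 \<odot> (a \<odot> (T y1 \<odot> T x1)))))"
  have "bullet B \<beta> (x \<odot> y) a =
     sw2 B (\<lambda>x1 u. sw2 B (\<lambda>y1 v. sw2 B (\<lambda>x2 x3. sw2 B (\<lambda>y2 y3. F x1 x2 x3 y1 y2 y3) v) u) y) x"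
    by (simp add: bullet_eq sw2_mul_HK T_mul assoc F_def)
  also have "\<dots> = sw2 B (\<lambda>x1 u. sw2 B (\<lambda>x2 x3. sw2 B (\<lambda>y1 v. sw2 B (\<lambda>y2 y3. F x1 x2 x3 y1 y2 y3) v) y) u) x"
    by (subst sw2_swap) (rule refl)
  also have "\<dots> = bullet B \<beta> x (bullet B \<beta> y a)"
    by (simp add: bullet_eq F_def sw2_push assoc)
  finally show ?thesis .
qed

text \<open>Since \<open>T\<close> reverses coproducts, the legs of \<open>x\<close> occur in the
  order \<open>p, q, x2, s, t\<close> with \<open>T q\<close> in the first and \<open>T p\<close> in
  the second factor. The inner legs \<open>q, x2, s\<close> reassemble to an action on
  \<open>a1\<close>. The Yetter-Drinfeld condition and the stability of H.g under the coaction both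
  rest on this formula.\<close>

lemma sw2_bullet_form:
  assumes f: "form f"
  shows "sw2 B f (bullet B \<beta> x a) =
    sw2 B (\<lambda>x1 u. sw2 B (\<lambda>x2 x3. sw2 B (\<lambda>a1 a2. f (bullet B \<beta> x2 a1) (x3 \<odot> (a2 \<odot> T x1))) a) u) x"
proof -
  note [simp] = lin_form[OF f] lin_form[OF f lin_id]
  have f1: "f (c \<star> y) z = c * f y z" for c y z using f by (simp add: bilinear_on_def linear_on_def)
  have f2: "f (sw2 B h u) z = sw2 B (\<lambda>a b. f (h a b) z) u" for h u z
    by (rule sw2_lin(2)[of "\<lambda>y. f y z"]) simp
  define F where "F = (\<lambda>a1 a2 p q x s t. \<beta> x * f (s \<odot> (a1 \<odot> T q)) (t \<odot> (a2 \<odot> T p)))"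
  have [simp]: "hlin h \<Longrightarrow> klin (\<lambda>x. F a1 a2 (h x) q y s t)" "hlin h \<Longrightarrow> klin (\<lambda>x. F a1 a2 p (h x) y s t)"
    "hlin h \<Longrightarrow> klin (\<lambda>x. F a1 a2 p q (h x) s t)" "hlin h \<Longrightarrow> klin (\<lambda>x. F a1 a2 p q y (h x) t)"
    "hlin h \<Longrightarrow> klin (\<lambda>x. F a1 a2 p q y s (h x))" for a1 a2 h p q y s t by (simp_all add: F_def)
  have "sw2 B f (bullet B \<beta> x a) =
    sw2 B (\<lambda>x1 u. sw2 B (\<lambda>x2 x3. \<beta> x2 * sw2 B f (x3 \<odot> (a \<odot> T x1))) u) x"
    unfolding bullet_eq
    by (subst sw2_lin(2)[of "sw2 B f"], simp)+ (simp add: lin_smulD[of "(*)" "sw2 B f"])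
  also have "\<dots> = sw2 B (\<lambda>x1 u. sw2 B (\<lambda>x2 x3. sw2 B (\<lambda>s t. sw2 B (\<lambda>a1 a2.
      sw2 B (\<lambda>p q. F a1 a2 p q x2 s t) x1) a) x3) u) x"
    by (simp add: sw2_mul_HK sw2_T_HK sw2_push F_def)
  also have "\<dots> = sw2 B (\<lambda>a1 a2. sw2 B (\<lambda>x1 u. sw2 B (\<lambda>p q. sw2 B (\<lambda>x2 x3. sw2 B (\<lambda>s t.
       F a1 a2 p q x2 s t) x3) u) x1) x) a"
  proof -
    have "sw2 B (\<lambda>x1 u. sw2 B (\<lambda>x2 x3. sw2 B (\<lambda>s t. sw2 B (\<lambda>a1 a2.
      sw2 B (\<lambda>p q. F a1 a2 p q x2 s t) x1) a) x3) u) x = sw2 B (\<lambda>x1 u. sw2 B (\<lambda>a1 a2.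
       sw2 B (\<lambda>p q. sw2 B (\<lambda>x2 x3. sw2 B (\<lambda>s t. F a1 a2 p q x2 s t) x3) u) x1) a) x"
    proof -
      have "sw2 B (\<lambda>x2 x3. sw2 B (\<lambda>s t. sw2 B (\<lambda>a1 a2.
        sw2 B (\<lambda>p q. F a1 a2 p q x2 s t) x1) a) x3) u = sw2 B (\<lambda>a1 a2.
         sw2 B (\<lambda>p q. sw2 B (\<lambda>x2 x3. sw2 B (\<lambda>s t. F a1 a2 p q x2 s t) x3) u) x1) a" for x1 u
        by (simp only: sw2_swap[of B _ a], simp only: sw2_swap[of B _ x1 u] sw2_swap[of B _ x1 x3 for x3])
      then show ?thesis by (simp only:)
    qed
    then show ?thesis by (simp only: sw2_swap[of B _ a x])
  qed
  also have "\<dots> = sw2 B (\<lambda>a1 a2. sw2 B (\<lambda>p u. sw2 B (\<lambda>q v. sw2 B (\<lambda>x2 w. sw2 B (\<lambda>s t.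
       F a1 a2 p q x2 s t) w) v) u) x) a"
    by (simp add: coassoc_HK)
  also have "\<dots> = sw2 B (\<lambda>a1 a2. sw2 B (\<lambda>p u. sw2 B (\<lambda>v t. sw2 B (\<lambda>q w. sw2 B (\<lambda>x2 s.
       F a1 a2 p q x2 s t) w) v) u) x) a"
    by (simp add: coassoc_HK)
  also have "\<dots> = sw2 B (\<lambda>a1 a2. sw2 B (\<lambda>p u. sw2 B (\<lambda>v t. f (bullet B \<beta> v a1) (t \<odot> (a2 \<odot> T p))) u) x) a"
    by (simp add: bullet_eq f2 f1 F_def)
  also have "\<dots> = sw2 B (\<lambda>p u. sw2 B (\<lambda>v t. sw2 B (\<lambda>a1 a2. f (bullet B \<beta> v a1) (t \<odot> (a2 \<odot> T p))) a) u) x"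
    by (simp only: sw2_swap[of B _ _ a])
  finally show ?thesis .
qed

text \<open>On the right-hand side the factor \<open>y\<close> multiplied at the end meets
  \<open>T p\<close> for the adjacent leg \<open>p\<close>, and the two cancel to a counit.\<close>

lemma bullet_yd_form:
  assumes f: "form f"
  shows "sw2 B (\<lambda>x1 x2. sw2 B (\<lambda>m0 m1. f (bullet B \<beta> x1 m0) (x2 \<odot> m1)) m) x =
         sw2 B (\<lambda>x1 x2. sw2 B (\<lambda>n0 n1. f n0 (n1 \<odot> x1)) (bullet B \<beta> x2 m)) x"
proof -
  note [simp] = lin_form[OF f] lin_form[OF f lin_id]
  have f2: "sw2 B (\<lambda>a b. f y (h a b)) u = f y (sw2 B h u)" for h u y
    by (rule sw2_lin(2)[symmetric]) simp
  have f1: "f y (c \<star> z) = c * f y z" for c y z using f by (simp add: bilinear_on_def linear_on_def)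
  have f': "form (\<lambda>n0 n1. f n0 (n1 \<odot> x))" for x by (rule formI) simp_all
  have "sw2 B (\<lambda>x1 x2. sw2 B (\<lambda>n0 n1. f n0 (n1 \<odot> x1)) (bullet B \<beta> x2 m)) x =
    sw2 B (\<lambda>y u. sw2 B (\<lambda>p v. sw2 B (\<lambda>q r. sw2 B (\<lambda>m0 m1. f (bullet B \<beta> q m0) (r \<odot> (m1 \<odot> (T p \<odot> y)))) m) v) u) x"
    by (simp add: sw2_bullet_form[OF f'] assoc)
  also have "\<dots> = sw2 B (\<lambda>w v. sw2 B (\<lambda>y p. sw2 B (\<lambda>q r. sw2 B (\<lambda>m0 m1. f (bullet B \<beta> q m0) (r \<odot> (m1 \<odot> (T p \<odot> y)))) m) v) w) x"
    by (simp add: coassoc_HK)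
  also have "\<dots> = sw2 B (\<lambda>w v. sw2 B (\<lambda>q r. sw2 B (\<lambda>m0 m1. sw2 B (\<lambda>y p. f (bullet B \<beta> q m0) (r \<odot> (m1 \<odot> (T p \<odot> y)))) w) m) v) x"
  proof -
    have "sw2 B (\<lambda>y p. sw2 B (\<lambda>q r. sw2 B (\<lambda>m0 m1. f (bullet B \<beta> q m0) (r \<odot> (m1 \<odot> (T p \<odot> y)))) m) v) w
      = sw2 B (\<lambda>q r. sw2 B (\<lambda>m0 m1. sw2 B (\<lambda>y p. f (bullet B \<beta> q m0) (r \<odot> (m1 \<odot> (T p \<odot> y)))) w) m) v" for v w
      by (simp only: sw2_swap[of B _ _ w])
    then show ?thesis by (simp only:)
  qed
  also have "\<dots> = sw2 B (\<lambda>w v. \<epsilon> w * sw2 B (\<lambda>q r. sw2 B (\<lambda>m0 m1. f (bullet B \<beta> q m0) (r \<odot> m1)) m) v) x"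
    by (simp add: f2 T_cancel f1 flip: sw2_push)
  finally show ?thesis by (simp add: sw2_counit)
qed

lemma yd_module_cyclic:
  assumes g: "comult B g = htens B g g"
  shows "yd_module B (yd_cyclic B \<beta> g)" "\<And>m. m \<in> ycarrier (yd_cyclic B \<beta> g) \<Longrightarrow>
    comult B m \<in> tensor_space (scl B) (scl B) (ycarrier (yd_cyclic B \<beta> g)) UNIV"
    "V.subspace (ycarrier (yd_cyclic B \<beta> g))"
proof -
  define C where "C = {bullet B \<beta> x g | x. True}"
  define M where "M = yd_cyclic B \<beta> g"
  have M [simp]: "ycarrier M = C" "yscl M = scl B" "coact M = comult B" "act M = bullet B \<beta>"
    by (simp_all add: M_def yd_cyclic_def yd_regular_def C_def)
  have C: "V.subspace C"
  proof (rule V.subspaceI)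
    show "0 \<in> C" using bullet_zero[of g] by (force simp: C_def)
  next
    fix x y assume "x \<in> C" "y \<in> C"
    then show "x + y \<in> C" by (force simp: C_def bullet_add(1)[symmetric])
  next
    fix c x assume "x \<in> C"
    then show "c \<star> x \<in> C" by (force simp: C_def bullet_smul(1)[symmetric])
  qed
  have actC: "bullet B \<beta> a m \<in> C" if "m \<in> C" for a m
    using that by (force simp: C_def bullet_mul[symmetric])
  let ?T = "tensor_space (scl B) (scl B) C UNIV"
  have T: "comult B m \<in> ?T" if m: "m \<in> C" for m
  proof -
    obtain x where x: "m = bullet B \<beta> x g" using m by (auto simp: C_def)
    \<comment> \<open>The coproduct of \<open>x \<bullet> g\<close> for grouplike \<open>g\<close>,
      written so that its left legs visibly lie in \<open>C\<close>.\<close>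
    define t where "t = sw2 B (\<lambda>x1 u. sw2 B (\<lambda>x2 x3. htens B (bullet B \<beta> x2 g) (x3 \<odot> (g \<odot> T x1))) u) x"
    have tT: "t \<in> ?T" unfolding t_def
      by (intro sw2_mem[OF tensor_subspace[OF C] vector_space_tscl] tens_mem) (auto simp: C_def)
    have "comult B m = t"
    proof (rule tensor_eqI[OF comult_in])
      show "t \<in> tensor_space (scl B) (scl B) UNIV UNIV"
        using tT by (auto simp: tensor_space_def represents_def)
      fix f assume f: "form f"
      note [simp] = lin_form[OF f] lin_form[OF f lin_id]
      show "comult B m f = t f"
        using f by (simp add: comult_form t_def sw2_apply x sw2_bullet_form
            sw2_grouplike[OF g vector_space_mult]) (simp add: tens_def f)
    qed
    then show ?thesis using tT by simp
  qed
  note swc = swc_eq_sw2[of M, simplified, OF C T]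
  have [simp]: "lin tscl (comult B)" "lin tscl (tens s (scl B) y)" for s y
    using lin_comult[OF lin_id] tens_linear(2) by auto
  have 1: "left_module B M"
    by (simp add: left_module_def actC bullet_mul bullet_unit bilinear_on_def linear_on_def
        bullet_add bullet_smul)
  have 2: "right_comodule B M"
    unfolding right_comodule_def M
  proof (intro conjI ballI)
    fix m assume m: "m \<in> C"
    show "comult B m \<in> ?T" using m by (rule T)
    have "swc B M (\<lambda>u m2. swc B M (\<lambda>m0 m1. tens (scl B) tscl m0 (htens B m1 m2)) u) m =
      swc B M (\<lambda>u m2. sw2 B (\<lambda>m0 m1. tens (scl B) tscl m0 (htens B m1 m2)) u) m"
    proof (rule swc_cong)
      fix u m2 assume "u \<in> ycarrier M"
      then have u: "u \<in> C" by simp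
      show "swc B M (\<lambda>m0 m1. tens (scl B) tscl m0 (htens B m1 m2)) u =
        sw2 B (\<lambda>m0 m1. tens (scl B) tscl m0 (htens B m1 m2)) u"
        by (rule swc[OF u vector_space_tscl]) simp_all
    qed (simp add: T m)
    also have "\<dots> = sw2 B (\<lambda>u m2. sw2 B (\<lambda>m0 m1. tens (scl B) tscl m0 (htens B m1 m2)) u) m"
      by (rule swc[OF m vector_space_tscl]) simp_all
    also have "\<dots> = sw2 B (\<lambda>m0 u. tens (scl B) tscl m0 (comult B u)) m"
      using coalg by (simp add: coalgebra_axioms_def sw3_def)
    also have "\<dots> = swc B M (\<lambda>m0 u. tens (scl B) tscl m0 (comult B u)) m"
      by (rule swc[OF m vector_space_tscl, symmetric]) simp_all
    finally show "swc B M (\<lambda>u m2. swc B M (\<lambda>m0 m1. tens (scl B) tscl m0 (htens B m1 m2)) u) m =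
      swc B M (\<lambda>m0 u. tens (scl B) tscl m0 (comult B u)) m" .
    show "swc B M (\<lambda>m0 m1. \<epsilon> m1 \<star> m0) m = m"
      by (simp add: m swc[OF _ vs] sw2_counit)
  qed (simp add: linear_on_def comult_add comult_smul)
  have 3: "sw2 B (\<lambda>a1 a2. swc B M (\<lambda>m0 m1. htens B (bullet B \<beta> a1 m0) (a2 \<odot> m1)) m) a =
        sw2 B (\<lambda>a1 a2. swc B M (\<lambda>n0 n1. htens B n0 (n1 \<odot> a1)) (bullet B \<beta> a2 m)) a"
    if m: "m \<in> C" for a m
  proof
    fix f
    show "sw2 B (\<lambda>a1 a2. swc B M (\<lambda>m0 m1. htens B (bullet B \<beta> a1 m0) (a2 \<odot> m1)) m) a f =
        sw2 B (\<lambda>a1 a2. swc B M (\<lambda>n0 n1. htens B n0 (n1 \<odot> a1)) (bullet B \<beta> a2 m)) a f"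
      using bullet_yd_form[of f m a]
      by (cases "form f") (simp_all add: m actC swc[OF _ vector_space_tscl] sw2_apply,
          simp_all add: tens_def)
  qed
  show "yd_module B (yd_cyclic B \<beta> g)"
    unfolding M_def[symmetric] yd_module_def M using vs C 1 2 3 by blast
  show "\<And>m. m \<in> ycarrier (yd_cyclic B \<beta> g) \<Longrightarrow>
    comult B m \<in> tensor_space (scl B) (scl B) (ycarrier (yd_cyclic B \<beta> g)) UNIV"
    using T by (simp flip: M_def)
  show "V.subspace (ycarrier (yd_cyclic B \<beta> g))" using C by (simp flip: M_def)
qed

end

section \<open>Degree zero coefficients\<close>

text \<open>\<open>E g x\<close> stands for the coefficient of \<open>g\<close> in pi(x).
  \<open>E_E\<close> and \<open>E_sum\<close> say that pi is a coalgebra map, \<open>E_mul\<close>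
  that it is multiplicative, \<open>E_G\<close> that it fixes \<open>G\<close>. The bidegree
  calculus uses the grading only through these facts.\<close>

locale group_projection = bialg +
  fixes G :: "'b set" and E :: "'b \<Rightarrow> 'b \<Rightarrow> 'a"
  assumes fin [simp]: "finite G" and comm: "comm_group (grp B G)"
    and G_comult: "g \<in> G \<Longrightarrow> comult B g = htens B g g" and G_counit: "g \<in> G \<Longrightarrow> \<epsilon> g = 1"
    and lin_E0: "klin (E g)"
    and E_E: "g \<in> G \<Longrightarrow> h \<in> G \<Longrightarrow> sw2 B (\<lambda>a b. E g a * E h b) x = (if g = h then E g x else 0)"
    and E_sum: "(\<Sum>g\<in>G. E g x) = \<epsilon> x"
    and E_mul: "g \<in> G \<Longrightarrow> E g (x \<odot> y) = (\<Sum>h\<in>G. \<Sum>k\<in>G. if h \<odot> k = g then E h x * E k y else 0)"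
    and E_G: "h \<in> G \<Longrightarrow> E g h = (if g = h then 1 else 0)"

section \<open>The coefficient functionals of a graded Hopf algebra\<close>

locale graded_group_bialg =
  fixes B :: "('k::field, 'h::ab_group_add) hopf" and Gr :: "nat \<Rightarrow> 'h set" and G :: "'h set"
  assumes graded: "graded_hopf_algebra B Gr" and deg_zero: "degree_zero_group_algebra B Gr G"
    and comm: "comm_group (grp B G)" and fin [simp]: "finite G"
    and bounded: "\<exists>n>0. \<forall>m\<ge>n. Gr m = {0}"
begin

sublocale bialg B
  using graded by unfold_locales (simp add: graded_hopf_algebra_def hopf_algebra_def)

lemma Gr_subspace: "V.subspace (Gr n)"
  and mul_Gr: "a \<in> Gr i \<Longrightarrow> b \<in> Gr j \<Longrightarrow> a \<odot> b \<in> Gr (i + j)"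
  and decomp_ex1: "\<exists>!c. graded_decomp Gr x c"
  and counit_Gr: "n > 0 \<Longrightarrow> a \<in> Gr n \<Longrightarrow> \<epsilon> a = 0"
  and comult_Gr: "a \<in> Gr n \<Longrightarrow> \<exists>t. (\<forall>i\<le>n. t i \<in> tensor_space (scl B) (scl B) (Gr i) (Gr (n - i))) \<and>
        comult B a = (\<Sum>i\<le>n. t i)"
  using graded by (auto simp: graded_hopf_algebra_def Suc_le_eq)

lemma G_indep: "V.independent G" and span_G: "V.span G = Gr 0"
  and G_comult: "g \<in> G \<Longrightarrow> comult B g = htens B g g" and G_counit: "g \<in> G \<Longrightarrow> \<epsilon> g = 1"
  using deg_zero by (auto simp: degree_zero_group_algebra_def)

definition part :: "'h \<Rightarrow> nat \<Rightarrow> 'h" where "part x = (THE c. graded_decomp Gr x c)"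

lemma part_decomp: "graded_decomp Gr x (part x)"
  unfolding part_def using decomp_ex1 by (rule theI')

lemma part_eqI: "graded_decomp Gr x c \<Longrightarrow> part x = c"
  using decomp_ex1[of x] part_decomp by blast

lemma deg0_part: "deg0 Gr x = part x 0"
  by (simp add: deg0_def part_def)

lemma graded_decompI:
  assumes "\<And>n. c n \<in> Gr n" "finite A" "\<And>n. n \<notin> A \<Longrightarrow> c n = 0" "x = (\<Sum>n\<in>A. c n)"
  shows "graded_decomp Gr x c"
proof -
  have sub: "{n. c n \<noteq> 0} \<subseteq> A" using assms(3) by blast
  then have "finite {n. c n \<noteq> 0}" using assms(2) by (rule finite_subset)
  moreover have "x = (\<Sum>n\<in>{n. c n \<noteq> 0}. c n)"
    unfolding assms(4) using assms(2) sub by (intro sum.mono_neutral_right) auto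
  ultimately show ?thesis using assms(1) by (simp add: graded_decomp_def)
qed

lemma part_Gr: "part x n \<in> Gr n" and part_finite: "finite {n. part x n \<noteq> 0}"
  and part_sum0: "x = (\<Sum>n\<in>{n. part x n \<noteq> 0}. part x n)"
  using part_decomp[of x] by (auto simp: graded_decomp_def)

lemma part_sum: "finite A \<Longrightarrow> {n. part x n \<noteq> 0} \<subseteq> A \<Longrightarrow> x = (\<Sum>n\<in>A. part x n)"
  by (subst part_sum0[of x]) (intro sum.mono_neutral_left, auto)

lemma part_add: "part (x + y) n = part x n + part y n"
proof -
  let ?A = "{n. part x n \<noteq> 0} \<union> {n. part y n \<noteq> 0}"
  have "graded_decomp Gr (x + y) (\<lambda>n. part x n + part y n)"
    using part_sum[of ?A x] part_sum[of ?A y] part_finite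
    by (intro graded_decompI[of _ ?A])
      (auto simp: sum.distrib intro: V.subspace_add[OF Gr_subspace] part_Gr)
  from part_eqI[OF this] show ?thesis by simp
qed

lemma part_smul: "part (c \<star> x) n = c \<star> part x n"
proof -
  let ?A = "{n. part x n \<noteq> 0}"
  have "graded_decomp Gr (c \<star> x) (\<lambda>n. c \<star> part x n)"
    using part_sum0[of x] part_finite
    by (intro graded_decompI[of _ ?A])
      (auto simp: V.scale_sum_right[symmetric] intro: V.subspace_scale[OF Gr_subspace] part_Gr)
  from part_eqI[OF this] show ?thesis by simp
qed

lemma part_hom: "a \<in> Gr n \<Longrightarrow> part a m = (if m = n then a else 0)"
  using part_eqI[of a "\<lambda>m. if m = n then a else 0"]
    graded_decompI[of "\<lambda>m. if m = n then a else 0" "{n}" a] V.subspace_0[OF Gr_subspace] by simp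

lemma graded_induct [case_names hom add]:
  assumes "\<And>n a. a \<in> Gr n \<Longrightarrow> P a" "\<And>x y. P x \<Longrightarrow> P y \<Longrightarrow> P (x + y)"
  shows "P x"
proof -
  have "P 0" using assms(1)[of 0 0] V.subspace_0[OF Gr_subspace] by blast
  have "P (\<Sum>n\<in>A. part x n)" for A
    by (induction A rule: infinite_finite_induct) (auto intro: assms part_Gr \<open>P 0\<close>)
  then show ?thesis using part_sum0[of x] by metis
qed

lemma eq_on_Gr0:
  assumes "lin t f" "lin t f'" "vector_space t" "\<And>g. g \<in> G \<Longrightarrow> f g = f' g" "x \<in> Gr 0"
  shows "f x = f' x"
proof -
  have "x \<in> V.span G" using assms(5) span_G by simp
  then show ?thesis
  proof (induction rule: V.span_induct_alt)
    case base
    show ?case using lin_zeroD[OF assms(1)] lin_zeroD[OF assms(2)] by simp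
  next
    case (step c x y)
    then show ?case
      using assms(4) by (simp add: lin_addD[OF assms(1)] lin_addD[OF assms(2)]
          lin_smulD[OF assms(1)] lin_smulD[OF assms(2)])
  qed
qed

text \<open>The coproduct has a representation by legs of complementary degrees, but the one
  selected by \<open>sw2\<close> need not be homogeneous; functionals allow passing from one to the
  other.\<close>

lemma sw2_Gr_zero:
  assumes a: "a \<in> Gr n" and t: "vector_space t" and F: "\<And>b. lin t (\<lambda>a. F a b)" "\<And>a. lin t (F a)"
    and zero: "\<And>i u v. i \<le> n \<Longrightarrow> u \<in> Gr i \<Longrightarrow> v \<in> Gr (n - i) \<Longrightarrow> F u v = 0"
  shows "sw2 B F a = 0"
proof (rule eq_by_functionals[OF t])
  fix \<phi> assume \<phi>: "linear_on t ((*) :: 'k \<Rightarrow> _) UNIV \<phi>"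
  have \<phi>0: "\<phi> 0 = 0" by (rule additive_zero) (use \<phi> in \<open>simp add: linear_on_def\<close>)
  have f: "form (\<lambda>a b. \<phi> (F a b))" by (rule formI) (rule lin_comp[OF _ \<phi>], rule F)+
  obtain t where t: "\<And>i. i \<le> n \<Longrightarrow> t i \<in> tensor_space (scl B) (scl B) (Gr i) (Gr (n - i))"
    "comult B a = (\<Sum>i\<le>n. t i)" using comult_Gr[OF a] by blast
  have "t i (\<lambda>a b. \<phi> (F a b)) = 0" if i: "i \<le> n" for i
  proof -
    obtain ps where ps: "t i = (\<Sum>p\<leftarrow>ps. htens B (fst p) (snd p))" "set ps \<subseteq> Gr i \<times> Gr (n - i)"
      using t(1)[OF i] by (auto simp: tensor_space_def represents_def case_prod_unfold)
    have "t i (\<lambda>a b. \<phi> (F a b)) = (\<Sum>p\<leftarrow>ps. \<phi> (F (fst p) (snd p)))"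
      by (simp add: ps(1) sum_list_fun_apply tens_def f)
    also have "\<dots> = (\<Sum>p\<leftarrow>ps. 0)"
      using ps(2) zero[OF i] by (intro arg_cong[of _ _ sum_list] map_cong) (auto simp: \<phi>0)
    finally show ?thesis by simp
  qed
  moreover have "(\<Sum>i\<in>A. t i) f = (\<Sum>i\<in>A. t i f)" for A f
    by (induction A rule: infinite_finite_induct) simp_all
  ultimately have "comult B a (\<lambda>a b. \<phi> (F a b)) = 0"
    using t(2) by simp
  then show "\<phi> (sw2 B F a) = \<phi> 0"
    by (simp add: sw2_functional[OF \<phi>] comult_form[OF f] \<phi>0)
qed

definition E :: "'h \<Rightarrow> 'h \<Rightarrow> 'k" where "E g x = gcoeff B Gr G x g"

lemma deg0_span: "deg0 Gr x \<in> V.span G"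
  by (simp add: span_G deg0_part part_Gr)

lemma lin_E0: "klin (E g)"
  unfolding E_def gcoeff_def using deg0_span V.representation_add[OF G_indep] V.representation_scale[OF G_indep]
  by (intro linI) (simp_all add: deg0_part part_add part_smul)

lemma lin_E [simp]: "hlin f \<Longrightarrow> klin (\<lambda>x. E g (f x))"
  by (rule lin_comp[OF _ lin_E0])

lemma E_Gr: "a \<in> Gr n \<Longrightarrow> n > 0 \<Longrightarrow> E g a = 0"
  by (simp add: E_def gcoeff_def deg0_part part_hom V.representation_zero)

lemma G_Gr: "g \<in> G \<Longrightarrow> g \<in> Gr 0"
  using span_G V.span_base by blast

lemma E_G: "h \<in> G \<Longrightarrow> E g h = (if g = h then 1 else 0)"
  using V.representation_basis[OF G_indep, of h] G_Gr[of h]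
  by (simp add: E_def gcoeff_def deg0_part part_hom)

text \<open>Degrees are nonnegative, so no term in the coproduct of an element of positive degree
  has both legs in degree zero. This leaves the case of group elements; \<open>E_mul\<close> below
  holds for the analogous reason.\<close>

lemma E_E:
  assumes g: "g \<in> G" and h: "h \<in> G"
  shows "sw2 B (\<lambda>a b. E g a * E h b) x = (if g = h then E g x else 0)"
proof (induction x rule: graded_induct)
  case (hom n a)
  show ?case
  proof (cases "n = 0")
    case True
    then have a: "a \<in> Gr 0" using hom by simp
    show ?thesis
      by (rule eq_on_Gr0[OF _ _ vector_space_mult _ a])
        (auto simp: sw2_grouplike[OF G_comult vector_space_mult] E_G lin_E0)
  next
    case False
    have "E g u * E h v = 0" if "i \<le> n" "u \<in> Gr i" "v \<in> Gr (n - i)" for i u v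
      using that False E_Gr[of u i g] E_Gr[of v "n - i" h] by (cases "i = 0") auto
    then have "sw2 B (\<lambda>a b. E g a * E h b) a = 0"
      by (intro sw2_Gr_zero[OF hom vector_space_mult]) (simp_all add: lin_E0)
    then show ?thesis using False E_Gr[OF hom] by simp
  qed
next
  case (add x y)
  have "klin (sw2 B (\<lambda>a b. E g a * E h b))" using lin_sw2_arg_HK(2)[OF _ _ lin_id, of "\<lambda>a b. E g a * E h b"]
    by (simp add: lin_E0)
  from lin_addD[OF this] show ?case using add lin_addD[OF lin_E0] by simp
qed

lemma E_sum: "(\<Sum>g\<in>G. E g x) = \<epsilon> x"
proof (induction x rule: graded_induct)
  case (hom n a)
  show ?case
  proof (cases "n = 0")
    case True
    then have a: "a \<in> Gr 0" using hom by simp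
    show ?thesis
      by (rule eq_on_Gr0[OF _ _ vector_space_mult _ a]) (simp_all add: E_G G_counit)
  qed (use hom E_Gr counit_Gr in simp)
next
  case (add x y)
  then show ?case using lin_addD[OF lin_E0] by (simp add: sum.distrib counit_add)
qed

lemma group_G: "group (grp B G)"
  using comm by (simp add: comm_group_def)

lemma G_closed: "g \<in> G \<Longrightarrow> h \<in> G \<Longrightarrow> g \<odot> h \<in> G"
  using monoid.m_closed[OF group.is_monoid[OF group_G]] by (simp add: grp_def)

lemma E_mul:
  assumes g: "g \<in> G"
  shows "E g (x \<odot> y) = (\<Sum>h\<in>G. \<Sum>k\<in>G. if h \<odot> k = g then E h x * E k y else 0)"
proof (induction x rule: graded_induct)
  case (hom i x)
  note x = hom
  show ?case
  proof (induction y rule: graded_induct)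
    case (hom j y)
    show ?case
    proof (cases "i = 0 \<and> j = 0")
      case True
      then have x: "x \<in> Gr 0" and y: "y \<in> Gr 0" using x hom by auto
      have 1: "E g (x \<odot> y) = (\<Sum>h\<in>G. \<Sum>k\<in>G. if h \<odot> k = g then E h x * E k y else 0)" if y: "y \<in> G" for y
      proof (rule eq_on_Gr0[OF _ _ vector_space_mult _ x])
        show "E g (x \<odot> y) = (\<Sum>h\<in>G. \<Sum>k\<in>G. if h \<odot> k = g then E h x * E k y else 0)" if x: "x \<in> G" for x
        proof -
          have "(\<Sum>h\<in>G. \<Sum>k\<in>G. if h \<odot> k = g then E h x * E k y else 0) =
            (\<Sum>h\<in>G. if h = x then (\<Sum>k\<in>G. if k = y then if h \<odot> k = g then 1 else 0 else 0) else 0)"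
          proof (intro sum.cong refl)
            fix h
            show "(\<Sum>k\<in>G. if h \<odot> k = g then E h x * E k y else 0) =
              (if h = x then (\<Sum>k\<in>G. if k = y then if h \<odot> k = g then 1 else 0 else 0) else 0)"
            proof (cases "h = x")
              case True
              have "(\<Sum>k\<in>G. if h \<odot> k = g then E h x * E k y else 0) =
                (\<Sum>k\<in>G. if k = y then if h \<odot> k = g then 1 else 0 else 0)"
                by (rule sum.cong) (use x y True in \<open>auto simp: E_G\<close>)
              with True show ?thesis by (simp only: simp_thms if_True)
            next
              case False
              then show ?thesis using x by (simp add: E_G cong: if_cong)
            qed
          qed
          then show ?thesis using x y by (simp add: sum.delta E_G G_closed)
        qed
      qed simp_all
      show ?thesis
        by (rule eq_on_Gr0[OF _ _ vector_space_mult 1 y]) simp_all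
    next
      case False
      then have "E h x * E k y = 0" for h k using x hom E_Gr[of x i h] E_Gr[of y j k] by auto
      then have "(\<Sum>h\<in>G. \<Sum>k\<in>G. if h \<odot> k = g then E h x * E k y else 0) = 0"
        by (intro sum.neutral ballI) simp
      then show ?thesis using False E_Gr[OF mul_Gr[OF x hom]] by simp
    qed
  next
    case (add y y')
    have "klin (\<lambda>y. \<Sum>h\<in>G. \<Sum>k\<in>G. if h \<odot> k = g then E h x * E k y else 0)" by simp
    from lin_addD[OF this, of y y'] show ?case using add lin_addD[OF lin_E0] by (simp add: mul_add_right)
  qed
next
  case (add x x')
  have "klin (\<lambda>x. \<Sum>h\<in>G. \<Sum>k\<in>G. if h \<odot> k = g then E h x * E k y else 0)"
    by (intro lin_sum_K) (auto simp: linear_on_def lin_addD[OF lin_E0] lin_smulD[OF lin_E0] algebra_simps)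
  from lin_addD[OF this, of x x'] show ?case using add lin_addD[OF lin_E0] by (simp add: mul_add_left)
qed

sublocale group_projection B G E
  by (intro group_projection.intro bialg_axioms group_projection_axioms.intro fin comm G_comult
      G_counit lin_E0 E_E E_sum E_mul E_G)

end

section \<open>Existence of the antipode of the opposite Hopf algebra\<close>

context graded_group_bialg
begin

interpretation grp: group "grp B G" by (rule group_G)

lemma inv_G: "g \<in> G \<Longrightarrow> inv\<^bsub>grp B G\<^esub> g \<in> G"
    "g \<in> G \<Longrightarrow> inv\<^bsub>grp B G\<^esub> g \<odot> g = \<e>" "g \<in> G \<Longrightarrow> g \<odot> inv\<^bsub>grp B G\<^esub> g = \<e>"
  using grp.inv_closed[of g] grp.l_inv[of g] grp.r_inv[of g] by (simp_all add: grp_def)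

text \<open>Convolution with values in the opposite algebra: the antipode of the opposite Hopf
  algebra is the two-sided inverse of the identity for \<open>conv\<close>.\<close>

definition conv :: "('h \<Rightarrow> 'h) \<Rightarrow> ('h \<Rightarrow> 'h) \<Rightarrow> 'h \<Rightarrow> 'h" where
  "conv F Z x = sw2 B (\<lambda>a b. Z b \<odot> F a) x"

lemma lin_conv: "hlin F \<Longrightarrow> hlin Z \<Longrightarrow> hlin (conv F Z)"
  using lin_sw2_arg_HK(1)[OF _ _ lin_id, of "\<lambda>a b. Z b \<odot> F a"] by (simp add: conv_def[abs_def])

lemma conv_assoc:
  assumes "hlin F" "hlin Z" "hlin W"
  shows "conv (conv F Z) W = conv F (conv Z W)"
proof
  fix x
  note [simp] = assms lin_comp[OF _ assms(1)] lin_comp[OF _ assms(2)] lin_comp[OF _ assms(3)]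
  show "conv (conv F Z) W x = conv F (conv Z W) x"
    by (simp add: conv_def sw2_push coassoc_HK assoc)
qed

lemma conv_unit: "hlin F \<Longrightarrow> conv (\<lambda>x. \<epsilon> x \<star> \<e>) F = F" "hlin F \<Longrightarrow> conv F (\<lambda>x. \<epsilon> x \<star> \<e>) = F"
  by (auto simp: conv_def sw2_counit)

lemma lin_diff: "hlin f \<Longrightarrow> hlin g \<Longrightarrow> hlin (\<lambda>x. f x - g x)"
  by (simp add: linear_on_def V.scale_right_diff_distrib)

lemma conv_group: "g \<in> G \<Longrightarrow> hlin F \<Longrightarrow> hlin Z \<Longrightarrow> conv F Z g = Z g \<odot> F g"
  unfolding conv_def by (rule sw2_grouplike[OF G_comult vs]) simp_all

text \<open>The kernel of \<open>\<nu> = \<epsilon> - F * Z\<close> contains the degree zero part, so \<open>\<nu>\<close> is nilpotent for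
  the convolution product and the geometric series inverts \<open>F * Z\<close>.\<close>

lemma conv_left_inverse:
  assumes F: "hlin F" and Z: "hlin Z" and inv: "\<And>g. g \<in> G \<Longrightarrow> F g \<odot> Z g = \<e>"
  obtains L where "hlin L" "conv L F = (\<lambda>x. \<epsilon> x \<star> \<e>)"
proof -
  let ?\<eta> = "\<lambda>x. \<epsilon> x \<star> \<e>"
  define \<nu> where "\<nu> = (\<lambda>x. ?\<eta> x - conv Z F x)"
  have lin_\<nu>: "hlin \<nu>" unfolding \<nu>_def by (intro lin_diff lin_conv Z F) simp
  have \<nu>0: "\<nu> x = 0" if "x \<in> Gr 0" for x
  proof (rule eq_on_Gr0[OF lin_\<nu> _ vs _ that, of "\<lambda>_. 0"])
    show "hlin (\<lambda>_. 0)" by (simp add: linear_on_def)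
    show "\<nu> g = 0" if "g \<in> G" for g using that by (simp add: \<nu>_def conv_group Z F inv G_counit)
  qed
  define pw where "pw = (\<lambda>n. ((\<lambda>f. conv f \<nu>) ^^ n) ?\<eta>)"
  have pw: "pw 0 = ?\<eta>" "pw (Suc n) = conv (pw n) \<nu>" for n by (simp_all add: pw_def)
  have lin_pw: "hlin (pw n)" for n
    by (induction n) (simp_all add: pw lin_conv lin_\<nu>)
  \<comment> \<open>Among \<open>k\<close> legs whose degrees add up to \<open>j < k\<close>, one
    has degree zero and is killed by \<open>\<nu>\<close>.\<close>
  have pw0: "pw k a = 0" if "a \<in> Gr j" "j < k" for k j a
    using that
  proof (induction k arbitrary: a j)
    case (Suc k)
    show ?case unfolding pw conv_def
    proof (rule sw2_Gr_zero[OF Suc.prems(1) vs])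
      fix i u v assume *: "i \<le> j" "u \<in> Gr i" "v \<in> Gr (j - i)"
      show "\<nu> v \<odot> pw k u = 0"
      proof (cases "i = j")
        case True
        then show ?thesis using * \<nu>0[of v] mul_smul_left[of 0 0] by simp
      next
        case False
        then have "pw k u = 0" using * Suc by auto
        then show ?thesis using mul_smul_right[of _ 0 0] by simp
      qed
    qed (simp_all add: lin_\<nu> lin_pw)
  qed simp
  obtain N where N: "\<And>m. m \<ge> N \<Longrightarrow> Gr m = {0}" using bounded by blast
  have pwN: "pw N x = 0" for x
  proof (induction x rule: graded_induct)
    case (hom n a)
    show ?case
    proof (cases "n < N")
      case False
      then show ?thesis using N[of n] hom lin_zeroD[OF lin_pw] by simp
    qed (use pw0 hom in blast)
  qed (simp add: lin_addD[OF lin_pw])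
  define S where "S = (\<lambda>x. \<Sum>n<N. pw n x)"
  have lin_S: "hlin S" unfolding S_def by (simp add: lin_pw)
  have "conv (conv S Z) F = conv S (conv Z F)" by (rule conv_assoc[OF lin_S Z F])
  also have "conv Z F = (\<lambda>x. ?\<eta> x - \<nu> x)" by (simp add: \<nu>_def)
  also have "conv S (\<lambda>x. ?\<eta> x - \<nu> x) = ?\<eta>"
  proof
    fix x
    have "conv S (\<lambda>x. ?\<eta> x - \<nu> x) x + conv S \<nu> x = conv S ?\<eta> x"
      unfolding conv_def by (simp add: sw2_add[symmetric] mul_add_left[symmetric])
    also have "conv S ?\<eta> x = (\<Sum>n<N. pw n x)" by (simp add: conv_unit lin_S) (simp add: S_def)
    also have "conv S \<nu> x = (\<Sum>n<N. pw (Suc n) x)"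
      unfolding pw conv_def S_def sw2_sum[symmetric]
      by (subst additive_sum[of "\<lambda>z. y \<odot> z" for y]) (simp_all add: mul_add_right)
    finally have "conv S (\<lambda>x. ?\<eta> x - \<nu> x) x = (\<Sum>n<N. pw n x - pw (Suc n) x)"
      by (simp add: sum_subtractf algebra_simps)
    also have "\<dots> = pw 0 x - pw N x" by (rule sum_lessThan_telescope')
    finally show "conv S (\<lambda>x. ?\<eta> x - \<nu> x) x = ?\<eta> x" by (simp add: pwN pw)
  qed
  finally show ?thesis using that lin_conv[OF lin_S Z] by blast
qed

text \<open>In a monoid, a left inverse that itself has a left inverse is two-sided. So one-sided
  inversion is applied twice, first to the identity and then to the result.\<close>

lemma op_antipode_exists:
  obtains T where "op_hopf_alg B T"
proof -
  let ?i = "\<lambda>g. inv\<^bsub>grp B G\<^esub> g"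
  let ?\<eta> = "\<lambda>x. \<epsilon> x \<star> \<e>"
  \<comment> \<open>The antipode of KG composed with the projection: a linear map on H that inverts
    the identity on \<open>G\<close>.\<close>
  define S where "S = (\<lambda>x. \<Sum>g\<in>G. E g x \<star> ?i g)"
  have S: "hlin S" unfolding S_def by simp
  have SG: "S g = ?i g" if "g \<in> G" for g
  proof -
    have "S g = (\<Sum>h\<in>G. if h = g then ?i h else 0)"
      unfolding S_def using that by (intro sum.cong) (simp_all add: E_G)
    then show ?thesis using that by simp
  qed
  obtain L where L: "hlin L" "conv L (\<lambda>x. x) = ?\<eta>"
    by (rule conv_left_inverse[of "\<lambda>x. x" S]) (use S SG inv_G in auto)
  have "g \<odot> L g = \<e>" if g: "g \<in> G" for g
    using conv_group[OF g L(1) lin_id] L(2) G_counit[OF g] by (simp add: fun_eq_iff)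
  then have "L g = ?i g" if g: "g \<in> G" for g
    using g by (metis assoc inv_G(2) unit_left unit_right)
  \<comment> \<open>On \<open>G\<close> the map \<open>L\<close> is inversion, so there the identity
    inverts it and the construction applies again. Associativity then forces \<open>L'\<close> to be
    the identity.\<close>
  then obtain L' where L': "hlin L'" "conv L' L = ?\<eta>"
    by (rule_tac conv_left_inverse[of L "\<lambda>x. x"]) (use L inv_G in auto)
  have "L' = conv L' (conv L (\<lambda>x. x))" by (simp add: L conv_unit L')
  also have "\<dots> = conv (conv L' L) (\<lambda>x. x)" by (rule conv_assoc[symmetric]) (simp_all add: L L')
  also have "\<dots> = (\<lambda>x. x)" by (simp add: L' conv_unit)
  finally have "conv (\<lambda>x. x) L = ?\<eta>" using L' by simp
  with L have "is_antipode (B\<lparr>hmult := \<lambda>a b. hmult B b a\<rparr>) L"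
    by (simp add: is_op_antipode conv_def fun_eq_iff)
  then show ?thesis
    using that bialg_axioms by (simp add: op_hopf_alg_def op_hopf_alg_axioms_def)
qed

end

section \<open>Bihomogeneous elements\<close>

context group_projection
begin

interpretation grp: comm_group "grp B G" by (rule comm)

abbreviation iv where "iv g \<equiv> inv\<^bsub>grp B G\<^esub> g"

lemma G_closed [simp]: "g \<in> G \<Longrightarrow> h \<in> G \<Longrightarrow> g \<odot> h \<in> G" and G_unit [simp]: "\<e> \<in> G"
  and iv_closed [simp]: "g \<in> G \<Longrightarrow> iv g \<in> G" and iv_left [simp]: "g \<in> G \<Longrightarrow> iv g \<odot> g = \<e>"
  and iv_right [simp]: "g \<in> G \<Longrightarrow> g \<odot> iv g = \<e>" and G_comm: "g \<in> G \<Longrightarrow> h \<in> G \<Longrightarrow> g \<odot> h = h \<odot> g"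
  using grp.m_closed[of g h] grp.one_closed grp.inv_closed[of g] grp.l_inv[of g] grp.r_inv[of g]
    grp.m_comm[of g h] by (simp_all add: grp_def)

lemma iv_cancel [simp]: "g \<in> G \<Longrightarrow> iv g \<odot> (g \<odot> x) = x" "g \<in> G \<Longrightarrow> g \<odot> (iv g \<odot> x) = x"
  by (simp_all flip: assoc)

lemma lin_E [simp]: "hlin f \<Longrightarrow> klin (\<lambda>x. E g (f x))"
  by (rule lin_comp[OF _ lin_E0])

text \<open>The components of the KG-coactions induced by pi: (pi \<otimes> id) applied to the
  coproduct of \<open>x\<close> is the sum of the \<open>g \<otimes> lproj g x\<close>, and
  symmetrically for \<open>rproj\<close>.\<close>

definition lproj :: "'b \<Rightarrow> 'b \<Rightarrow> 'b" where "lproj g x = sw2 B (\<lambda>a b. E g a \<star> b) x"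
definition rproj :: "'b \<Rightarrow> 'b \<Rightarrow> 'b" where "rproj g x = sw2 B (\<lambda>a b. E g b \<star> a) x"

lemma lin_proj [simp]: "hlin f \<Longrightarrow> hlin (\<lambda>x. lproj g (f x))" "hlin f \<Longrightarrow> hlin (\<lambda>x. rproj g (f x))"
  by (simp_all add: lproj_def rproj_def)

lemma proj_smul [simp]: "lproj g (c \<star> x) = c \<star> lproj g x" "rproj g (c \<star> x) = c \<star> rproj g x"
  using lin_smulD[OF lin_proj(1)[OF lin_id]] lin_smulD[OF lin_proj(2)[OF lin_id]] by auto
lemma proj_add: "lproj g (x + y) = lproj g x + lproj g y" "rproj g (x + y) = rproj g x + rproj g y"
  using lin_addD[OF lin_proj(1)[OF lin_id]] lin_addD[OF lin_proj(2)[OF lin_id]] by auto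
lemma proj_sw2: "lproj g (sw2 B F x) = sw2 B (\<lambda>a b. lproj g (F a b)) x"
    "rproj g (sw2 B F x) = sw2 B (\<lambda>a b. rproj g (F a b)) x"
  by (rule sw2_lin(1)[of "lproj g"], simp add: linear_on_def proj_add)
    (rule sw2_lin(1)[of "rproj g"], simp add: linear_on_def proj_add)

lemma E_smul [simp]: "E g (c \<star> x) = c * E g x"
  and E_add: "E g (x + y) = E g x + E g y"
  and E_sw2: "E g (sw2 B F x) = sw2 B (\<lambda>a b. E g (F a b)) x"
  by (simp_all add: lin_smulD[OF lin_E0] lin_addD[OF lin_E0] sw2_lin(2)[OF lin_E0])

lemma E_proj:
  "g \<in> G \<Longrightarrow> h \<in> G \<Longrightarrow> E g (lproj h x) = (if g = h then E g x else 0)"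
  "g \<in> G \<Longrightarrow> h \<in> G \<Longrightarrow> E g (rproj h x) = (if g = h then E g x else 0)"
  using E_E[of h g x] E_E[of g h x] by (auto simp: lproj_def rproj_def E_sw2 mult.commute)

lemma sw2_proj_form:
  assumes f: "form f"
  shows "sw2 B f (lproj g x) = sw2 B (\<lambda>a b. f (lproj g a) b) x"
    "sw2 B f (rproj g x) = sw2 B (\<lambda>a b. f a (rproj g b)) x"
proof -
  note [simp] = lin_form[OF f] lin_form[OF f lin_id]
  have f1: "f (c \<star> y) z = c * f y z" "f y (c \<star> z) = c * f y z" for c y z
    using f by (simp_all add: bilinear_on_def linear_on_def)
  have f2: "f (sw2 B h u) z = sw2 B (\<lambda>a b. f (h a b) z) u"
    "f z (sw2 B h u) = sw2 B (\<lambda>a b. f z (h a b)) u" for h u z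
    by (rule sw2_lin(2)[of "\<lambda>y. f y z"], simp) (rule sw2_lin(2)[of "f z"], simp)
  have l: "klin (sw2 B f)" using lin_sw2_arg_HK(2)[OF _ _ lin_id, of f] by simp
  show "sw2 B f (lproj g x) = sw2 B (\<lambda>a b. f (lproj g a) b) x"
    "sw2 B f (rproj g x) = sw2 B (\<lambda>a b. f a (rproj g b)) x"
    by (simp_all add: lproj_def rproj_def f1 f2 sw2_lin(2)[OF l] lin_smulD[OF l] sw2_push coassoc_HK)
qed

lemma sw2_proj:
  assumes t: "vector_space t" and f: "\<And>b. lin t (\<lambda>a. f a b)" "\<And>a. lin t (f a)"
  shows "sw2 B f (lproj g x) = sw2 B (\<lambda>a b. f (lproj g a) b) x"
    "sw2 B f (rproj g x) = sw2 B (\<lambda>a b. f a (rproj g b)) x"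
proof -
  have *: "form (\<lambda>a b. \<phi> (f a b))" if \<phi>: "linear_on t ((*) :: 'a \<Rightarrow> _) UNIV \<phi>" for \<phi>
    by (rule formI; rule lin_comp[OF _ \<phi>], rule f)
  show "sw2 B f (lproj g x) = sw2 B (\<lambda>a b. f (lproj g a) b) x"
    by (rule eq_by_functionals[OF t]) (simp add: sw2_functional sw2_proj_form(1)[OF *])
  show "sw2 B f (rproj g x) = sw2 B (\<lambda>a b. f a (rproj g b)) x"
    by (rule eq_by_functionals[OF t]) (simp add: sw2_functional sw2_proj_form(2)[OF *])
qed

lemma proj_idem:
  assumes "g \<in> G" "h \<in> G"
  shows "lproj g (lproj h x) = (if g = h then lproj g x else 0)"
    "rproj g (rproj h x) = (if g = h then rproj g x else 0)"
  by (simp_all add: lproj_def[of g] rproj_def[of g] sw2_proj[OF vs] E_proj assms)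
    (simp_all add: lproj_def rproj_def)

lemma proj_commute: "rproj h (lproj g x) = lproj g (rproj h x)"
  unfolding rproj_def[of h] by (simp add: sw2_proj[OF vs] proj_sw2)

lemma proj_sum: "(\<Sum>g\<in>G. lproj g x) = x" "(\<Sum>g\<in>G. rproj g x) = x"
  by (simp_all add: lproj_def rproj_def sw2_sum[symmetric] V.scale_sum_left[symmetric] E_sum sw2_counit)

text \<open>The coproduct takes values in the cotensor product over KG: the right degree of the
  first leg matches the left degree of the second. This matching is what makes inner cocycle values
  cancel later.\<close>

lemma sw2_middle_form:
  assumes f: "form f"
  shows "sw2 B f x = (\<Sum>t\<in>G. sw2 B (\<lambda>a b. f (rproj t a) (lproj t b)) x)"
proof -
  note [simp] = lin_form[OF f] lin_form[OF f lin_id]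
  have f1: "f (c \<star> y) z = c * f y z" "f y (c \<star> z) = c * f y z" for c y z
    using f by (simp_all add: bilinear_on_def linear_on_def)
  have f2: "f (sw2 B h u) z = sw2 B (\<lambda>a b. f (h a b) z) u"
    "f z (sw2 B h u) = sw2 B (\<lambda>a b. f z (h a b)) u" for h u z
    by (rule sw2_lin(2)[of "\<lambda>y. f y z"], simp) (rule sw2_lin(2)[of "f z"], simp)
  \<comment> \<open>By coassociativity the coefficient that \<open>rproj t\<close> splits off the
    left leg may be split off the right leg instead, where it becomes a second application of the
    idempotent \<open>lproj t\<close>.\<close>
  have "sw2 B (\<lambda>a b. f (rproj t a) (lproj t b)) x = sw2 B (\<lambda>a b. f a (lproj t b)) x" if t: "t \<in> G" for t
  proof -
    have "sw2 B (\<lambda>a b. f (rproj t a) (lproj t b)) x =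
      sw2 B (\<lambda>u v. sw2 B (\<lambda>a s. E t s * f a (lproj t v)) u) x"
      by (simp add: rproj_def f1 f2)
    also have "\<dots> = sw2 B (\<lambda>a u. sw2 B (\<lambda>s v. E t s * f a (lproj t v)) u) x"
      by (simp add: coassoc_HK)
    also have "\<dots> = sw2 B (\<lambda>a u. f a (lproj t (lproj t u))) x"
    proof -
      have "lproj t (lproj t u) = sw2 B (\<lambda>s v. E t s \<star> lproj t v) u" for u
        by (subst (2) lproj_def) (simp add: proj_sw2)
      then show ?thesis by (simp add: f1 f2)
    qed
    finally show ?thesis using t by (simp add: proj_idem)
  qed
  then have "(\<Sum>t\<in>G. sw2 B (\<lambda>a b. f (rproj t a) (lproj t b)) x) =
    sw2 B (\<lambda>a b. \<Sum>t\<in>G. f a (lproj t b)) x"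
    by (simp add: sw2_sum)
  also have "\<dots> = sw2 B f x"
    by (simp add: lin_sumD[of "(*)" "f _", symmetric] proj_sum)
  finally show ?thesis ..
qed

definition bihom :: "'b \<Rightarrow> 'b \<Rightarrow> 'b \<Rightarrow> bool" where
  "bihom p q x \<longleftrightarrow> p \<in> G \<and> q \<in> G \<and> lproj p x = x \<and> rproj q x = x"

lemma bihomD: "bihom p q x \<Longrightarrow> p \<in> G" "bihom p q x \<Longrightarrow> q \<in> G"
  by (simp_all add: bihom_def)

lemma bihom_proj:
  "p \<in> G \<Longrightarrow> q \<in> G \<Longrightarrow> bihom p q (lproj p (rproj q x))"
  "bihom p q x \<Longrightarrow> h \<in> G \<Longrightarrow> lproj h x = (if h = p then x else 0)"
  "bihom p q x \<Longrightarrow> h \<in> G \<Longrightarrow> rproj h x = (if h = q then x else 0)"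
  using proj_idem[of h p x] proj_idem[of h q x] by (auto simp: bihom_def proj_idem proj_commute)

lemma bihom_smul: "bihom p q x \<Longrightarrow> bihom p q (c \<star> x)"
  by (simp add: bihom_def)

lemma bihom_zero: "p \<in> G \<Longrightarrow> q \<in> G \<Longrightarrow> bihom p q 0"
  using proj_smul[of p 0 0] proj_smul[of q 0 0] by (simp add: bihom_def)

lemma bihom_induct [case_names bihom add]:
  assumes "\<And>p q x. bihom p q x \<Longrightarrow> R x" "\<And>x y. R x \<Longrightarrow> R y \<Longrightarrow> R (x + y)"
  shows "R x"
proof -
  have R0: "R 0" by (rule assms(1)[OF bihom_zero[OF G_unit G_unit]])
  have sum: "R (\<Sum>i\<in>A. f i)" if "\<And>i. i \<in> A \<Longrightarrow> R (f i)" for A and f :: "'b \<Rightarrow> 'b"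
    using that by (induction A rule: infinite_finite_induct) (auto intro: R0 assms(2))
  have "R (\<Sum>p\<in>G. lproj p (\<Sum>q\<in>G. rproj q x))"
    by (subst lin_sumD[of "scl B" "lproj _"], simp add: linear_on_def proj_add)
      (intro sum assms(1)[OF bihom_proj(1)])
  then show ?thesis by (simp add: proj_sum)
qed

text \<open>The working tool for cocycles: the legs of \<open>x\<close> may be assumed of bidegrees
  \<open>(p, s)\<close> and \<open>(s, q)\<close>, where cocycle values are constants.\<close>

lemma sw2_bihom_cong:
  assumes x: "bihom p q x" and t: "vector_space t"
    and f: "\<And>b. lin t (\<lambda>a. f a b)" "\<And>a. lin t (f a)"
    and f': "\<And>b. lin t (\<lambda>a. f' a b)" "\<And>a. lin t (f' a)"
    and eq: "\<And>s u v. bihom p s u \<Longrightarrow> bihom s q v \<Longrightarrow> f u v = f' u v"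
  shows "sw2 B f x = sw2 B f' x"
proof (rule eq_by_functionals[OF t])
  fix \<phi> assume \<phi>: "linear_on t ((*) :: 'a \<Rightarrow> _) UNIV \<phi>"
  \<comment> \<open>The outer projections \<open>lproj p\<close> and \<open>rproj q\<close> fix
    \<open>x\<close> and may be inserted; the middle degree is then summed over.\<close>
  have *: "sw2 B (\<lambda>a b. \<phi> (h a b)) x =
      (\<Sum>s\<in>G. sw2 B (\<lambda>a b. \<phi> (h (lproj p (rproj s a)) (lproj s (rproj q b)))) x)"
    if h: "\<And>b. lin t (\<lambda>a. h a b)" "\<And>a. lin t (h a)" for h
  proof -
    have h1: "form (\<lambda>a b. \<phi> (h a b))" by (rule formI; rule lin_comp[OF _ \<phi>], rule h)
    note lin_form[OF h1, simp]
    have h2: "form (\<lambda>a b. \<phi> (h (lproj p a) b))" "form (\<lambda>a b. \<phi> (h (lproj p a) (rproj q b)))"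
      by (rule formI; simp)+
    have "sw2 B (\<lambda>a b. \<phi> (h a b)) (rproj q (lproj p x)) =
      sw2 B (\<lambda>a b. \<phi> (h (lproj p a) (rproj q b))) x"
      using sw2_proj_form(1)[OF h1] sw2_proj_form(2)[OF h2(1)] by (simp add: proj_commute)
    then show ?thesis
      using x sw2_middle_form[OF h2(2), of x] by (simp add: bihom_def proj_commute)
  qed
  show "\<phi> (sw2 B f x) = \<phi> (sw2 B f' x)"
    unfolding sw2_functional[OF \<phi>] *[OF f] *[OF f']
    using x by (intro sum.cong refl) (simp add: eq[OF bihom_proj(1) bihom_proj(1)] bihom_def)
qed

text \<open>Both projections fix \<open>x\<close>, so its only possible nonzero coefficient is at
  \<open>k = p = q\<close>; the counit, being the sum of all coefficients, equals this one.\<close>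

lemma E_bihom: "bihom p q x \<Longrightarrow> k \<in> G \<Longrightarrow> E k x = (if k = p then \<epsilon> x else 0)"
  and counit_bihom: "bihom p q x \<Longrightarrow> p \<noteq> q \<Longrightarrow> \<epsilon> x = 0"
proof -
  have 0: "E k x = (if k = p \<and> k = q then E k x else 0)" if "bihom p q x" "k \<in> G" for k
    using E_proj[of k p x] E_proj[of k q x] that unfolding bihom_def by metis
  show "E k x = (if k = p then \<epsilon> x else 0)" if x: "bihom p q x" "k \<in> G"
  proof -
    have "\<epsilon> x = (\<Sum>g\<in>G. if g = p then E g x else 0)"
      unfolding E_sum[symmetric] by (intro sum.cong refl) (metis 0[OF x(1)])
    then show ?thesis using 0[OF x] x by (auto simp: bihom_def)
  qed
  show "\<epsilon> x = 0" if x: "bihom p q x" "p \<noteq> q"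
    unfolding E_sum[symmetric] using x(2) by (intro sum.neutral ballI) (metis 0[OF x(1)])
qed

lemma bihom_G: "g \<in> G \<Longrightarrow> bihom g g g"
  by (simp add: bihom_def lproj_def rproj_def sw2_grouplike[OF G_comult vs] E_G)

lemma lproj_mul: "g \<in> G \<Longrightarrow> lproj g (x \<odot> y) = (\<Sum>h\<in>G. \<Sum>k\<in>G. if h \<odot> k = g then lproj h x \<odot> lproj k y else 0)"
  and rproj_mul: "g \<in> G \<Longrightarrow> rproj g (x \<odot> y) = (\<Sum>h\<in>G. \<Sum>k\<in>G. if h \<odot> k = g then rproj h x \<odot> rproj k y else 0)"
proof -
  assume g: "g \<in> G"
  have 1: "(\<Sum>h\<in>G. \<Sum>k\<in>G. if h \<odot> k = g then c h k else 0) \<star> z =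
    (\<Sum>h\<in>G. \<Sum>k\<in>G. if h \<odot> k = g then c h k \<star> z else 0)" for c z
    by (simp add: V.scale_sum_left if_distrib[of "\<lambda>c. c \<star> z"] cong: if_cong)
  have 2: "sw2 B (\<lambda>a b. \<Sum>h\<in>G. \<Sum>k\<in>G. if h \<odot> k = g then F h k a b else 0) w =
    (\<Sum>h\<in>G. \<Sum>k\<in>G. if h \<odot> k = g then sw2 B (F h k) w else 0)" for F :: "'b \<Rightarrow> 'b \<Rightarrow> 'b \<Rightarrow> 'b \<Rightarrow> 'b" and w
    unfolding sw2_sum by (intro sum.cong refl) simp
  have 3: "sw2 B F u \<odot> sw2 B F' v = sw2 B (\<lambda>a b. sw2 B (\<lambda>c d. F a b \<odot> F' c d) v) u" for F F' u v
    by (simp only: sw2_push) (rule sw2_swap)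
  show "lproj g (x \<odot> y) = (\<Sum>h\<in>G. \<Sum>k\<in>G. if h \<odot> k = g then lproj h x \<odot> lproj k y else 0)"
    "rproj g (x \<odot> y) = (\<Sum>h\<in>G. \<Sum>k\<in>G. if h \<odot> k = g then rproj h x \<odot> rproj k y else 0)"
    by (simp_all add: lproj_def rproj_def sw2_mul_HK E_mul[OF g] 1 2 3 mult.commute cong: if_cong)
qed

lemma bihom_mul:
  assumes x: "bihom p q x" and y: "bihom k l y"
  shows "bihom (p \<odot> k) (q \<odot> l) (x \<odot> y)"
proof -
  note G = bihomD[OF x] bihomD[OF y]
  have *: "(\<Sum>h\<in>G. \<Sum>h'\<in>G. if h \<odot> h' = a \<odot> b then F h h' else 0) = F a b"
    if ab: "a \<in> G" "b \<in> G" and F: "\<And>h h'. h \<in> G \<Longrightarrow> h' \<in> G \<Longrightarrow> \<not> (h = a \<and> h' = b) \<Longrightarrow> F h h' = 0"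
    for a b and F :: "'b \<Rightarrow> 'b \<Rightarrow> 'b"
  proof -
    have "(\<Sum>h\<in>G. \<Sum>h'\<in>G. if h \<odot> h' = a \<odot> b then F h h' else 0) =
      (\<Sum>h\<in>G. \<Sum>h'\<in>G. if h' = b then (if h = a then F a b else 0) else 0)"
      using F by (intro sum.cong refl) auto
    then show ?thesis using ab by simp
  qed
  have z: "0 \<odot> c = 0" "c \<odot> 0 = 0" for c
    using mul_smul_left[of 0 0 c] mul_smul_right[of c 0 0] by simp_all
  have "lproj (p \<odot> k) (x \<odot> y) = lproj p x \<odot> lproj k y"
    unfolding lproj_mul[OF G_closed[OF G(1,3)]]
    by (rule *[OF G(1,3)]) (auto simp: bihom_proj(2)[OF x] bihom_proj(2)[OF y] z)
  moreover have "rproj (q \<odot> l) (x \<odot> y) = rproj q x \<odot> rproj l y"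
    unfolding rproj_mul[OF G_closed[OF G(2,4)]]
    by (rule *[OF G(2,4)]) (auto simp: bihom_proj(3)[OF x] bihom_proj(3)[OF y] z)
  ultimately show ?thesis using x y by (simp add: bihom_def)
qed

end

section \<open>Degrees under the antipode of the opposite algebra\<close>

locale group_projection_op = group_projection + op_hopf_alg
begin

text \<open>A coefficient of the identity
  \<open>\<Sum> b \<odot> T a = \<epsilon> x \<star> \<e>\<close> is compared for \<open>x\<close>
  of bidegree \<open>(p, q)\<close>: the leg \<open>b\<close> has right degree \<open>q\<close>, so
  only its coefficient at \<open>q\<close> contributes and the coefficient of \<open>T x\<close> is
  isolated.\<close>

lemma E_T:
  assumes k: "k \<in> G" shows "E k (T x) = E (iv k) x"
proof (induction x rule: bihom_induct)
  case (bihom p q x)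
  note G = bihomD[OF bihom]
  \<comment> \<open>Chosen so that \<open>iv q \<odot> g\<close> is \<open>k\<close>.\<close>
  define g where "g = q \<odot> k"
  have g: "g \<in> G" using G k by (simp add: g_def)
  have kq: "h \<odot> k' = g \<longleftrightarrow> k' = iv h \<odot> g" if "h \<in> G" "k' \<in> G" for h k'
    using that by auto
  have "E g (sw2 B (\<lambda>a b. b \<odot> T a) x) = sw2 B (\<lambda>a b. E (iv q \<odot> g) (T a) * E q b) x"
  proof -
    have "E g (b \<odot> T a) = (\<Sum>h\<in>G. E h b * E (iv h \<odot> g) (T a))" for a b
    proof -
      have "E g (b \<odot> T a) = (\<Sum>h\<in>G. \<Sum>k'\<in>G. if k' = iv h \<odot> g then E h b * E k' (T a) else 0)"
        unfolding E_mul[OF g] by (intro sum.cong refl) (simp add: kq)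
      then show ?thesis using g by simp
    qed
    then have "E g (sw2 B (\<lambda>a b. b \<odot> T a) x) = sw2 B (\<lambda>a b. \<Sum>h\<in>G. E h b * E (iv h \<odot> g) (T a)) x"
      by (simp add: E_sw2)
    also have "\<dots> = sw2 B (\<lambda>a b. E (iv q \<odot> g) (T a) * E q b) x"
    proof (rule sw2_bihom_cong[OF bihom vector_space_mult])
      fix s u v assume v: "bihom s q v"
      have "E h v = (if h = q then E q v else 0)" if h: "h \<in> G" for h
        using E_bihom[OF v h] E_bihom[OF v G(2)] counit_bihom[OF v] by auto
      then have "(\<Sum>h\<in>G. E h v * E (iv h \<odot> g) (T u)) = (\<Sum>h\<in>G. if h = q then E q v * E (iv q \<odot> g) (T u) else 0)"
        by (intro sum.cong refl) auto
      then show "(\<Sum>h\<in>G. E h v * E (iv h \<odot> g) (T u)) = E (iv q \<odot> g) (T u) * E q v"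
        using G by simp
    qed simp_all
    finally show ?thesis .
  qed
  also have "\<dots> = E (iv q \<odot> g) (T (rproj q x))"
    by (simp add: rproj_def sw2_lin(1)[OF lin_T0] E_sw2 mult.commute)
  also have "\<dots> = E k (T x)" using bihom by (simp add: bihom_def g_def)
  finally have "E k (T x) = \<epsilon> x * E g \<e>" by (simp add: T_cancel)
  also have "\<dots> = (if k = iv q then \<epsilon> x else 0)"
  proof -
    have "g = \<e> \<longleftrightarrow> k = iv q" using G k unfolding g_def by (metis iv_cancel(1) iv_right unit_right)
    then show ?thesis by (simp add: E_G)
  qed
  also have "\<dots> = E (iv k) x"
  proof -
    have "k = iv q \<longleftrightarrow> iv k = q" using G k by (metis iv_cancel(1) iv_left iv_right iv_closed unit_right)
    then show ?thesis using E_bihom[OF bihom, of "iv k"] k counit_bihom[OF bihom] by auto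
  qed
  finally show ?case .
qed (simp add: E_add lin_addD[OF lin_T0])

lemma proj_T: "g \<in> G \<Longrightarrow> lproj g (T x) = T (rproj (iv g) x)" "g \<in> G \<Longrightarrow> rproj g (T x) = T (lproj (iv g) x)"
  by (simp_all add: lproj_def rproj_def sw2_T_HK E_T sw2_lin(1)[OF lin_T0])

lemma iv_iv [simp]: "g \<in> G \<Longrightarrow> iv (iv g) = g"
  by (metis iv_cancel(1) iv_left iv_closed unit_right)

lemma bihom_T: "bihom p q x \<Longrightarrow> bihom (iv q) (iv p) (T x)"
  by (simp add: bihom_def proj_T)

end

section \<open>The cocycle twist\<close>

context bialg
begin

lemma sw3_eq:
  assumes t: "vector_space t"
    and f: "\<And>b c. lin t (\<lambda>a. f a b c)" "\<And>a c. lin t (\<lambda>b. f a b c)" "\<And>a b. lin t (f a b)"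
  shows "sw3 B f x = sw2 B (\<lambda>a u. sw2 B (f a) u) x"
  unfolding sw3_def by (rule coassoc) (rule t f)+

end

locale cocycle_twist = group_projection_op +
  fixes \<sigma> :: "'b \<Rightarrow> 'b \<Rightarrow> 'a" and \<beta> :: "'b \<Rightarrow> 'a" and S :: "'b \<Rightarrow> 'b" and g :: 'b
  assumes cocycle: "h \<in> G \<Longrightarrow> k \<in> G \<Longrightarrow> l \<in> G \<Longrightarrow> \<sigma> h k * \<sigma> (h \<odot> k) l = \<sigma> k l * \<sigma> h (k \<odot> l)"
    and nonzero [simp]: "h \<in> G \<Longrightarrow> k \<in> G \<Longrightarrow> \<sigma> h k \<noteq> 0"
    and normal [simp]: "h \<in> G \<Longrightarrow> \<sigma> h \<e> = 1" "h \<in> G \<Longrightarrow> \<sigma> \<e> h = 1"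
    and \<beta>_mul: "h \<in> G \<Longrightarrow> k \<in> G \<Longrightarrow> \<beta> (h \<odot> k) = \<beta> h * \<beta> k" and \<beta>_unit: "\<beta> \<e> = 1"
    and g [simp]: "g \<in> G"
begin

definition ext2 :: "('b \<Rightarrow> 'b \<Rightarrow> 'a) \<Rightarrow> 'b \<Rightarrow> 'b \<Rightarrow> 'a" where
  "ext2 \<tau> x y = (\<Sum>h\<in>G. \<Sum>k\<in>G. E h x * E k y * \<tau> h k)"

abbreviation "\<sigma>' \<equiv> \<lambda>h k. inverse (\<sigma> h k)"
abbreviation "s \<equiv> ext2 \<sigma>"
abbreviation "s' \<equiv> ext2 \<sigma>'"

definition xchar :: "('b \<Rightarrow> 'a) \<Rightarrow> 'b \<Rightarrow> 'a" where "xchar \<gamma> x = (\<Sum>h\<in>G. E h x * \<gamma> h)"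

definition tm :: "'b \<Rightarrow> 'b \<Rightarrow> 'b" where
  "tm a b = sw3 B (\<lambda>a1 a2 a3. sw3 B (\<lambda>b1 b2 b3. (s a1 b1 * s' a3 b3) \<star> (a2 \<odot> b2)) b) a"

definition K :: "('a, 'b) hopf" where "K = B\<lparr>hmult := tm, antipode := S\<rparr>"

text \<open>The scalar is dictated by \<open>\<Sum> b \<cdot> TK a = \<epsilon> x\<close> in the
  twisted product. For legs of bidegrees \<open>(p, t)\<close> and \<open>(t, q)\<close> that
  product contributes \<open>\<sigma> t (iv t)\<close>, which the factor
  \<open>\<sigma>' t (iv t)\<close> of \<open>TK\<close> removes; the factor at \<open>p\<close>
  makes the rest 1 when \<open>p = q\<close>.\<close>

definition TK :: "'b \<Rightarrow> 'b" where
  "TK x = (\<Sum>p\<in>G. \<Sum>q\<in>G. (\<sigma> p (iv p) * \<sigma>' q (iv q)) \<star> T (lproj p (rproj q x)))"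

definition \<beta>' :: "'b \<Rightarrow> 'a" where "\<beta>' h = \<beta> h * \<sigma> g h * inverse (\<sigma> h g)"

lemma lin_ext2 [simp]:
  "hlin f \<Longrightarrow> klin (\<lambda>x. ext2 \<tau> (f x) y)" "hlin f \<Longrightarrow> klin (\<lambda>x. ext2 \<tau> y (f x))"
  by (simp_all add: ext2_def)

lemma lin_xchar [simp]: "hlin f \<Longrightarrow> klin (\<lambda>x. xchar \<gamma> (f x))"
  by (simp add: xchar_def)

lemma tm_eq: "tm a b = sw2 B (\<lambda>a1 u. sw2 B (\<lambda>a2 a3. sw2 B (\<lambda>b1 v. sw2 B (\<lambda>b2 b3.
    (s a1 b1 * s' a3 b3) \<star> (a2 \<odot> b2)) v) b) u) a"
  unfolding tm_def by (simp add: sw3_eq[OF vs])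

lemma lin_tm [simp]: "hlin f \<Longrightarrow> hlin (\<lambda>x. tm (f x) y)" "hlin f \<Longrightarrow> hlin (\<lambda>x. tm y (f x))"
  by (simp_all add: tm_eq)

lemma tm_add: "tm (x + y) z = tm x z + tm y z" "tm z (x + y) = tm z x + tm z y"
  and tm_smul [simp]: "tm (c \<star> x) z = c \<star> tm x z" "tm z (c \<star> x) = c \<star> tm z x"
  using lin_addD[OF lin_tm(1)[OF lin_id]] lin_addD[OF lin_tm(2)[OF lin_id]]
    lin_smulD[OF lin_tm(1)[OF lin_id]] lin_smulD[OF lin_tm(2)[OF lin_id]] by auto

text \<open>Left and right degrees are interchangeable here because the counit vanishes on elements
  whose two degrees differ. Which version applies depends on the side on which a leg's degree is
  known.\<close>

lemma ext2_bihom: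
  assumes x: "bihom p q x" and y: "bihom k l y"
  shows "ext2 \<tau> x y = \<tau> p k * \<epsilon> x * \<epsilon> y" "ext2 \<tau> x y = \<tau> q l * \<epsilon> x * \<epsilon> y"
proof -
  note G = bihomD[OF x] bihomD[OF y]
  have "ext2 \<tau> x y = (\<Sum>h\<in>G. \<Sum>h'\<in>G. if h' = k then (if h = p then \<tau> p k * \<epsilon> x * \<epsilon> y else 0) else 0)"
    unfolding ext2_def by (intro sum.cong refl) (simp add: E_bihom[OF x] E_bihom[OF y])
  then show 1: "ext2 \<tau> x y = \<tau> p k * \<epsilon> x * \<epsilon> y" using G by simp
  then show "ext2 \<tau> x y = \<tau> q l * \<epsilon> x * \<epsilon> y"
    using counit_bihom[OF x] counit_bihom[OF y] by auto
qed

lemma xchar_bihom: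
  assumes x: "bihom p q x"
  shows "xchar \<gamma> x = \<gamma> p * \<epsilon> x" "p \<noteq> q \<Longrightarrow> xchar \<gamma> x = 0"
proof -
  have "xchar \<gamma> x = (\<Sum>h\<in>G. if h = p then \<gamma> p * \<epsilon> x else 0)"
    unfolding xchar_def by (intro sum.cong refl) (simp add: E_bihom[OF x])
  then show "xchar \<gamma> x = \<gamma> p * \<epsilon> x" using bihomD[OF x] by simp
  then show "p \<noteq> q \<Longrightarrow> xchar \<gamma> x = 0" using counit_bihom[OF x] by simp
qed

lemma sw2_bihom_cong3:
  assumes x: "bihom p q x" and t: "vector_space t"
    and f: "\<And>b c. lin t (\<lambda>a. f a b c)" "\<And>a c. lin t (\<lambda>b. f a b c)" "\<And>a b. lin t (f a b)"
    and f': "\<And>b c. lin t (\<lambda>a. f' a b c)" "\<And>a c. lin t (\<lambda>b. f' a b c)" "\<And>a b. lin t (f' a b)"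
    and eq: "\<And>r s u v w. bihom p r u \<Longrightarrow> bihom r s v \<Longrightarrow> bihom s q w \<Longrightarrow> f u v w = f' u v w"
  shows "sw2 B (\<lambda>a u. sw2 B (f a) u) x = sw2 B (\<lambda>a u. sw2 B (f' a) u) x"
proof (rule sw2_bihom_cong[OF x t])
  fix s u v assume u: "bihom p s u" and v: "bihom s q v"
  show "sw2 B (f u) v = sw2 B (f' u) v"
    by (rule sw2_bihom_cong[OF v t]) (use f f' eq[OF u] in auto)
qed (use f f' in \<open>auto intro: lin_sw2_inner[OF t] lin_sw2_arg[OF t _ _ lin_id]\<close>)

text \<open>The first legs have left degrees \<open>p, k\<close> and the last legs right degrees
  \<open>q, l\<close>, so both cocycle factors are constants times counits, and the counits absorb
  the outer legs.\<close>

lemma tm_bihom: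
  assumes a: "bihom p q a" and b: "bihom k l b"
  shows "tm a b = (\<sigma> p k * \<sigma>' q l) \<star> (a \<odot> b)"
proof -
  let ?c = "\<sigma> p k * \<sigma>' q l"
  have "tm a b = sw2 B (\<lambda>a1 u. sw2 B (\<lambda>a2 a3. sw2 B (\<lambda>b1 v. sw2 B (\<lambda>b2 b3.
    ?c \<star> \<epsilon> a1 \<star> \<epsilon> a3 \<star> \<epsilon> b1 \<star> \<epsilon> b3 \<star> (a2 \<odot> b2)) v) b) u) a"
    unfolding tm_eq
  proof (rule sw2_bihom_cong3[OF a vs])
    fix r t a1 a2 a3 assume a: "bihom p r a1" "bihom r t a2" "bihom t q a3"
    show "sw2 B (\<lambda>b1 v. sw2 B (\<lambda>b2 b3. (s a1 b1 * s' a3 b3) \<star> (a2 \<odot> b2)) v) b =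
      sw2 B (\<lambda>b1 v. sw2 B (\<lambda>b2 b3. ?c \<star> \<epsilon> a1 \<star> \<epsilon> a3 \<star> \<epsilon> b1 \<star> \<epsilon> b3 \<star> (a2 \<odot> b2)) v) b"
    proof (rule sw2_bihom_cong3[OF b vs])
      fix r' t' b1 b2 b3 assume b: "bihom k r' b1" "bihom r' t' b2" "bihom t' l b3"
      show "(s a1 b1 * s' a3 b3) \<star> (a2 \<odot> b2) = ?c \<star> \<epsilon> a1 \<star> \<epsilon> a3 \<star> \<epsilon> b1 \<star> \<epsilon> b3 \<star> (a2 \<odot> b2)"
        using ext2_bihom(1)[OF a(1) b(1)] ext2_bihom(2)[OF a(3) b(3)] by (simp add: mult_ac)
    qed (simp_all del: V.scale_scale)
  qed (simp_all del: V.scale_scale)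
  also have "\<dots> = ?c \<star> (a \<odot> b)"
    by (simp add: sw2_counit del: V.scale_scale flip: sw2_push)
  finally show ?thesis .
qed

lemma bihom_tm: "bihom p q a \<Longrightarrow> bihom k l b \<Longrightarrow> bihom (p \<odot> k) (q \<odot> l) (tm a b)"
  by (simp add: tm_bihom bihom_smul bihom_mul)

lemma tm_assoc: "tm (tm x y) z = tm x (tm y z)"
proof (induction x rule: bihom_induct)
  case (bihom p q x)
  note x = this
  show ?case
  proof (induction y rule: bihom_induct)
    case (bihom k l y)
    note y = this
    show ?case
    proof (induction z rule: bihom_induct)
      case (bihom m n z)
      note G = bihomD[OF x] bihomD[OF y] bihomD[OF bihom]
      have 1: "\<sigma> p k * \<sigma> (p \<odot> k) m = \<sigma> k m * \<sigma> p (k \<odot> m)"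
        "\<sigma>' q l * \<sigma>' (q \<odot> l) n = \<sigma>' l n * \<sigma>' q (l \<odot> n)"
        using G by (simp_all add: cocycle flip: inverse_mult_distrib)
      have "\<sigma> p k * \<sigma>' q l * (\<sigma> (p \<odot> k) m * \<sigma>' (q \<odot> l) n) =
        \<sigma> p k * \<sigma> (p \<odot> k) m * (\<sigma>' q l * \<sigma>' (q \<odot> l) n)" by (simp only: mult_ac)
      also have "\<dots> = \<sigma> k m * \<sigma>' l n * (\<sigma> p (k \<odot> m) * \<sigma>' q (l \<odot> n))"
        unfolding 1 by (simp only: mult_ac)
      finally show ?case
        using tm_bihom[OF bihom_mul[OF x y] bihom] tm_bihom[OF x bihom_mul[OF y bihom]]
        by (simp add: tm_bihom[OF x y] tm_bihom[OF y bihom] assoc)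
    qed (simp add: tm_add)
  qed (simp add: tm_add)
qed (simp add: tm_add)

lemma tm_unit: "tm \<e> x = x" "tm x \<e> = x"
  by (induction x rule: bihom_induct)
    (simp_all add: tm_add tm_bihom[OF bihom_G[OF G_unit]] tm_bihom[OF _ bihom_G[OF G_unit]] bihomD)

lemma tm_counit: "\<epsilon> (tm x y) = \<epsilon> x * \<epsilon> y"
proof (induction x rule: bihom_induct)
  case (bihom p q x)
  note x = this
  show ?case
  proof (induction y rule: bihom_induct)
    case (bihom k l y)
    then show ?case using counit_bihom[OF x] counit_bihom[OF bihom] bihomD[OF x] bihomD[OF bihom]
      by (cases "p = q \<and> k = l") (auto simp: tm_bihom[OF x bihom])
  qed (simp add: tm_add counit_add algebra_simps)
qed (simp add: tm_add counit_add algebra_simps)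

text \<open>For legs with middle degrees \<open>r\<close> and \<open>t\<close>, the first product
  contributes \<open>\<sigma>' r t\<close> and the second \<open>\<sigma> r t\<close>; these cancel
  and leave the scalar of the undivided product.\<close>

lemma tm_comult_form:
  assumes f: "form f"
  shows "sw2 B f (tm x y) = sw2 B (\<lambda>a b. sw2 B (\<lambda>c d. f (tm a c) (tm b d)) y) x"
proof -
  note [simp] = lin_form[OF f] lin_form[OF f lin_id]
  have f1: "f (c \<star> y) z = c * f y z" "f y (c \<star> z) = c * f y z" for c y z
    using f by (simp_all add: bilinear_on_def linear_on_def)
  have l: "klin (sw2 B f)" using lin_sw2_arg_HK(2)[OF _ _ lin_id, of f] by simp
  have l1: "klin (\<lambda>y. sw2 B (\<lambda>a b. sw2 B (\<lambda>c d. f (tm a c) (tm b d)) y) x)" for x by simp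
  have l2: "klin (\<lambda>x. sw2 B (\<lambda>a b. sw2 B (\<lambda>c d. f (tm a c) (tm b d)) y) x)" for y by simp
  show ?thesis
  proof (induction x rule: bihom_induct)
    case (bihom p q x)
    note x = this
    show ?case
    proof (induction y rule: bihom_induct)
      case (bihom k l y)
      have "sw2 B (\<lambda>a b. sw2 B (\<lambda>c d. f (tm a c) (tm b d)) y) x =
        sw2 B (\<lambda>a b. sw2 B (\<lambda>c d. (\<sigma> p k * \<sigma>' q l) * f (a \<odot> c) (b \<odot> d)) y) x"
      proof (rule sw2_bihom_cong[OF x vector_space_mult])
        fix r a b assume ab: "bihom p r a" "bihom r q b"
        show "sw2 B (\<lambda>c d. f (tm a c) (tm b d)) y =
          sw2 B (\<lambda>c d. (\<sigma> p k * \<sigma>' q l) * f (a \<odot> c) (b \<odot> d)) y"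
        proof (rule sw2_bihom_cong[OF bihom vector_space_mult])
          fix t c d assume cd: "bihom k t c" "bihom t l d"
          show "f (tm a c) (tm b d) = (\<sigma> p k * \<sigma>' q l) * f (a \<odot> c) (b \<odot> d)"
            using bihomD[OF ab(1)] bihomD[OF cd(1)]
            by (simp add: tm_bihom[OF ab(1) cd(1)] tm_bihom[OF ab(2) cd(2)] f1 field_simps)
        qed simp_all
      qed simp_all
      also have "\<dots> = (\<sigma> p k * \<sigma>' q l) * sw2 B f (x \<odot> y)"
        by (simp add: sw2_mul_HK sw2_push)
      finally show ?case by (simp add: tm_bihom[OF x bihom] lin_smulD[OF l])
    qed (simp add: tm_add lin_addD[OF l] lin_addD[OF l1])
  qed (simp add: tm_add lin_addD[OF l] lin_addD[OF l2])
qed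

lemma K_simps [simp]: "scl K = scl B" "hmult K = tm" "hunit K = \<e>" "comult K = comult B" "counit K = \<epsilon>"
  by (simp_all add: K_def)

lemma sw_K [simp]: "sw2 K = sw2 B" "sw3 K = sw3 B"
  by (simp_all add: fun_eq_iff sw2_def sw3_def)

lemma bialgebra_K: "bialgebra K"
proof -
  have "comult B (tm a b) = sw2 B (\<lambda>a1 a2. sw2 B (\<lambda>b1 b2. htens B (tm a1 b1) (tm a2 b2)) b) a" for a b
  proof (rule tensor_eqI)
    show "sw2 B (\<lambda>a1 a2. sw2 B (\<lambda>b1 b2. htens B (tm a1 b1) (tm a2 b2)) b) a \<in> tensor_space (scl B) (scl B) UNIV UNIV"
      by (intro sw2_mem[OF tensor_space_subspace vector_space_tscl] tens_in)
    show "comult B (tm a b) f = sw2 B (\<lambda>a1 a2. sw2 B (\<lambda>b1 b2. htens B (tm a1 b1) (tm a2 b2)) b) a f"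
      if f: "form f" for f
      using f by (simp add: comult_form tm_comult_form sw2_apply) (simp add: tens_def)
  qed (rule comult_in)
  moreover have "algebra_axioms K"
    by (simp add: algebra_axioms_def tm_assoc tm_unit bilinear_on_def)
  moreover have "coalgebra_axioms K" using coalg by (simp add: coalgebra_axioms_def)
  ultimately show ?thesis using vs comult_unit by (simp add: bialgebra_def tm_counit)
qed

lemma lin_TK0: "hlin TK" unfolding TK_def[abs_def] by simp
lemma lin_TK [simp]: "hlin f \<Longrightarrow> hlin (\<lambda>x. TK (f x))" using lin_TK0 by (rule lin_comp[rotated])

lemma TK_bihom:
  assumes x: "bihom p q x"
  shows "TK x = (\<sigma> p (iv p) * \<sigma>' q (iv q)) \<star> T x"
proof -
  have "TK x = (\<Sum>h\<in>G. \<Sum>k\<in>G. if k = q then (if h = p then (\<sigma> p (iv p) * \<sigma>' q (iv q)) \<star> T x else 0) else 0)"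
    unfolding TK_def
    by (intro sum.cong refl) (auto simp: bihom_proj(2,3)[OF x] lin_zeroD[OF lin_T0]
        lin_zeroD[OF lin_proj(1)[OF lin_id]])
  then show ?thesis using bihomD[OF x] by simp
qed

lemma \<sigma>_iv: "h \<in> G \<Longrightarrow> \<sigma> (iv h) h = \<sigma> h (iv h)"
  using cocycle[of h "iv h" h] by simp

lemma TK_op: "is_antipode (K\<lparr>hmult := \<lambda>a b. hmult K b a\<rparr>) TK"
proof -
  have 1: "sw2 B (\<lambda>a b. tm b (TK a)) x = \<epsilon> x \<star> \<e>" for x
  proof (induction x rule: bihom_induct)
    case (bihom p q x)
    note G = bihomD[OF bihom]
    have "sw2 B (\<lambda>a b. tm b (TK a)) x = sw2 B (\<lambda>a b. (\<sigma> p (iv p) * \<sigma>' q (iv p)) \<star> (b \<odot> T a)) x"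
    proof (rule sw2_bihom_cong[OF bihom vs])
      fix t u v assume u: "bihom p t u" and v: "bihom t q v"
      show "tm v (TK u) = (\<sigma> p (iv p) * \<sigma>' q (iv p)) \<star> (v \<odot> T u)"
        using bihomD[OF v] by (simp add: TK_bihom[OF u] tm_bihom[OF v bihom_T[OF u]] field_simps)
    qed simp_all
    also have "\<dots> = (\<sigma> p (iv p) * \<sigma>' q (iv p) * \<epsilon> x) \<star> \<e>"
      by (simp add: T_cancel flip: sw2_push)
    \<comment> \<open>The scalar is 1 for \<open>p = q\<close>; otherwise the counit of
      \<open>x\<close> vanishes.\<close>
    finally show ?case using counit_bihom[OF bihom] G by (cases "p = q") simp_all
  next
    case (add x y)
    have "hlin (sw2 B (\<lambda>a b. tm b (TK a)))"
      using lin_sw2_arg_HK(1)[OF _ _ lin_id, of "\<lambda>a b. tm b (TK a)"] by (simp add: lin_TK0)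
    from lin_addD[OF this] show ?case using add by (simp add: counit_add V.scale_left_distrib)
  qed
  have 2: "sw2 B (\<lambda>a b. tm (TK b) a) x = \<epsilon> x \<star> \<e>" for x
  proof (induction x rule: bihom_induct)
    case (bihom p q x)
    note G = bihomD[OF bihom]
    have "sw2 B (\<lambda>a b. tm (TK b) a) x = sw2 B (\<lambda>a b. (\<sigma> (iv q) p * \<sigma>' q (iv q)) \<star> (T b \<odot> a)) x"
    proof (rule sw2_bihom_cong[OF bihom vs])
      fix t u v assume u: "bihom p t u" and v: "bihom t q v"
      show "tm (TK v) u = (\<sigma> (iv q) p * \<sigma>' q (iv q)) \<star> (T v \<odot> u)"
        using bihomD[OF v] by (simp add: TK_bihom[OF v] tm_bihom[OF bihom_T[OF v] u] \<sigma>_iv field_simps)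
    qed simp_all
    also have "\<dots> = (\<sigma> (iv q) p * \<sigma>' q (iv q) * \<epsilon> x) \<star> \<e>"
      by (simp add: T_cancel flip: sw2_push)
    finally show ?case using counit_bihom[OF bihom] G by (cases "p = q") (simp_all add: \<sigma>_iv)
  next
    case (add x y)
    have "hlin (sw2 B (\<lambda>a b. tm (TK b) a))"
      using lin_sw2_arg_HK(1)[OF _ _ lin_id, of "\<lambda>a b. tm (TK b) a"] by (simp add: lin_TK0)
    from lin_addD[OF this] show ?case using add by (simp add: counit_add V.scale_left_distrib)
  qed
  show ?thesis using 1 2 lin_TK0 by (simp add: is_antipode_def)
qed

text \<open>An extended character lives where left and right degrees agree, and there the twisted
  product carries the scalar \<open>\<sigma> p k * \<sigma>' p k = 1\<close>.\<close>

lemma xchar_mul: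
  assumes m: "\<And>h k. h \<in> G \<Longrightarrow> k \<in> G \<Longrightarrow> \<gamma> (h \<odot> k) = \<gamma> h * \<gamma> k"
  shows "xchar \<gamma> (x \<odot> y) = xchar \<gamma> x * xchar \<gamma> y" "xchar \<gamma> (tm x y) = xchar \<gamma> x * xchar \<gamma> y"
proof -
  have l: "klin (xchar \<gamma>)" using lin_xchar[OF lin_id] by simp
  have *: "xchar \<gamma> (x \<odot> y) = xchar \<gamma> x * xchar \<gamma> y \<and> xchar \<gamma> (tm x y) = xchar \<gamma> x * xchar \<gamma> y"
  proof (induction x rule: bihom_induct)
    case (bihom p q x)
    note x = this
    show ?case
    proof (induction y rule: bihom_induct)
      case (bihom k l y)
      note G = bihomD[OF x] bihomD[OF bihom]
      have "xchar \<gamma> (x \<odot> y) = xchar \<gamma> x * xchar \<gamma> y"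
        using G by (simp add: xchar_bihom(1)[OF bihom_mul[OF x bihom]] xchar_bihom(1)[OF x] xchar_bihom(1)[OF bihom] m)
      moreover have "xchar \<gamma> (tm x y) = xchar \<gamma> x * xchar \<gamma> y"
        using G counit_bihom[OF x] counit_bihom[OF bihom]
        by (cases "p = q \<and> k = l")
          (auto simp: xchar_bihom(1)[OF bihom_tm[OF x bihom]] xchar_bihom(1)[OF x]
            xchar_bihom(1)[OF bihom] m tm_counit)
      ultimately show ?case by blast
    qed (simp add: mul_add_right tm_add lin_addD[OF l] algebra_simps)
  qed (simp add: mul_add_left tm_add lin_addD[OF l] algebra_simps)
  show "xchar \<gamma> (x \<odot> y) = xchar \<gamma> x * xchar \<gamma> y" "xchar \<gamma> (tm x y) = xchar \<gamma> x * xchar \<gamma> y"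
    using * by auto
qed

lemma xchar_unit: "\<gamma> \<e> = 1 \<Longrightarrow> xchar \<gamma> \<e> = 1"
  by (simp add: xchar_bihom(1)[OF bihom_G[OF G_unit]])

lemma \<beta>'_unit: "\<beta>' \<e> = 1" by (simp add: \<beta>'_def \<beta>_unit)

text \<open>Since \<open>G\<close> is abelian, \<open>(h, k) \<mapsto> \<sigma> h k / \<sigma> k h\<close> is a bicharacter.\<close>

lemma \<beta>'_mul:
  assumes h: "h \<in> G" and k: "k \<in> G" shows "\<beta>' (h \<odot> k) = \<beta>' h * \<beta>' k"
proof -
  note nz = nonzero[OF g h] nonzero[OF h g] nonzero[OF g k] nonzero[OF k g] nonzero[OF h k]
    nonzero[OF g G_closed[OF h k]] nonzero[OF G_closed[OF h k] g] nonzero[OF h G_closed[OF g k]]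
    nonzero[OF G_closed[OF g h] k]
  have 1: "\<sigma> g h * \<sigma> (g \<odot> h) k = \<sigma> h k * \<sigma> g (h \<odot> k)" using cocycle[OF g h k] .
  have 2: "\<sigma> h g * \<sigma> (g \<odot> h) k = \<sigma> g k * \<sigma> h (g \<odot> k)"
    using cocycle[OF h g k] G_comm[OF g h] by simp
  have 3: "\<sigma> h k * \<sigma> (h \<odot> k) g = \<sigma> k g * \<sigma> h (g \<odot> k)"
    using cocycle[OF h k g] G_comm[OF g k] by simp
  \<comment> \<open>Times the nonzero last bracket, both sides of the claim regroup into the three
    cocycle identities, whose terms match because \<open>G\<close> is commutative.\<close>
  have "(\<sigma> g (h \<odot> k) * \<sigma> h g * \<sigma> k g) * (\<sigma> h k * \<sigma> (g \<odot> h) k * \<sigma> h (g \<odot> k)) =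
    (\<sigma> h k * \<sigma> g (h \<odot> k)) * (\<sigma> h g * \<sigma> (g \<odot> h) k) * (\<sigma> k g * \<sigma> h (g \<odot> k))" by (simp only: mult_ac)
  also have "\<dots> = (\<sigma> (h \<odot> k) g * \<sigma> g h * \<sigma> g k) * (\<sigma> h k * \<sigma> (g \<odot> h) k * \<sigma> h (g \<odot> k))"
    unfolding 1[symmetric] 2 3[symmetric] by (simp only: mult_ac)
  finally have "\<sigma> g (h \<odot> k) * \<sigma> h g * \<sigma> k g = \<sigma> (h \<odot> k) g * \<sigma> g h * \<sigma> g k"
    using nz by simp
  then show ?thesis using nz by (simp add: \<beta>'_def \<beta>_mul[OF h k] field_simps)
qed

lemma char_B: "op_hopf_char B T (xchar \<beta>)"
  using xchar_mul[of \<beta>, OF \<beta>_mul] xchar_unit[of \<beta>, OF \<beta>_unit] lin_xchar[OF lin_id]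
  by (intro op_hopf_char.intro op_hopf_alg_axioms op_hopf_char_axioms.intro) simp_all

lemma char_K: "op_hopf_char K TK (xchar \<beta>')"
  using xchar_mul[of \<beta>', OF \<beta>'_mul] xchar_unit[of \<beta>', OF \<beta>'_unit] lin_xchar[OF lin_id]
  by (intro op_hopf_char.intro op_hopf_alg.intro bialg.intro op_hopf_alg_axioms.intro bialgebra_K TK_op
      op_hopf_char_axioms.intro) simp_all

end

section \<open>Comparison of the two actions\<close>

context cocycle_twist
begin

abbreviation "bul \<equiv> bullet B (xchar \<beta>)"
abbreviation "bulK \<equiv> bullet K (xchar \<beta>')"

interpretation ch: op_hopf_char B T "xchar \<beta>" by (rule char_B)

lemma bulK_eq: "bulK x a = sw2 B (\<lambda>x1 u. sw2 B (\<lambda>x2 x3. xchar \<beta>' x2 \<star> tm x3 (tm a (TK x1))) u) x"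
  using op_hopf_char.bullet_eq[OF char_K] by simp

lemma lin_bulK: "hlin f \<Longrightarrow> hlin (\<lambda>x. bulK (f x) a)" "hlin f \<Longrightarrow> hlin (\<lambda>x. bulK a (f x))"
  by (simp_all add: bulK_eq)

text \<open>The scalar by which the twisted action of a bihomogeneous element of bidegree \<open>(p, q)\<close>
  on an element of bidegree \<open>(g, r)\<close> differs from the original one.\<close>

definition twist_scalar :: "'b \<Rightarrow> 'b \<Rightarrow> 'b \<Rightarrow> 'a" where
  "twist_scalar p q r = \<sigma> (q \<odot> (r \<odot> iv p)) p * \<sigma>' q r"

text \<open>The definition is the scalar that the twisted module produces; the right-hand side is
  what \<open>TK\<close> and two twisted products leave after the inner degree is absorbed. The
  cocycle identity at \<open>(q, r, iv p)\<close> and at \<open>(q \<odot> r, iv p, p)\<close> links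
  them.\<close>

lemma twist_scalar_eq:
  assumes "p \<in> G" "q \<in> G" "r \<in> G"
  shows "twist_scalar p q r = \<sigma> p (iv p) * \<sigma>' r (iv p) * \<sigma>' q (r \<odot> iv p)"
proof -
  have 1: "\<sigma> q r * \<sigma> (q \<odot> r) (iv p) = \<sigma> r (iv p) * \<sigma> q (r \<odot> iv p)"
    by (rule cocycle) (use assms in simp_all)
  have 2: "\<sigma> (q \<odot> r) (iv p) * \<sigma> (q \<odot> (r \<odot> iv p)) p = \<sigma> p (iv p)"
    using cocycle[of "q \<odot> r" "iv p" p] assms by (simp add: assoc \<sigma>_iv)
  have "\<sigma> (q \<odot> (r \<odot> iv p)) p * (\<sigma> r (iv p) * \<sigma> q (r \<odot> iv p)) = \<sigma> p (iv p) * \<sigma> q r"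
    unfolding 1[symmetric] 2[symmetric] by (simp only: mult_ac)
  then show ?thesis using assms by (simp add: twist_scalar_def field_simps)
qed

text \<open>The origin of the twisted character: \<open>\<beta>'\<close> is the correction of
  \<open>\<beta>\<close> that makes all factors depending on the inner degree \<open>t\<close>
  collapse to \<open>\<beta> t\<close>.\<close>

lemma char_scalar:
  assumes "t \<in> G"
  shows "\<beta>' t * \<sigma> g (iv t) * \<sigma> t (g \<odot> iv t) = \<beta> t * \<sigma> t (iv t)"
proof -
  have 1: "\<sigma> t g * \<sigma> (g \<odot> t) (iv t) = \<sigma> g (iv t) * \<sigma> t (g \<odot> iv t)"
    using cocycle[of t g "iv t"] assms G_comm[of t g] by simp
  have 2: "\<sigma> g t * \<sigma> (g \<odot> t) (iv t) = \<sigma> t (iv t)"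
    using cocycle[of g t "iv t"] assms by simp
  have "\<beta>' t * (\<sigma> g (iv t) * \<sigma> t (g \<odot> iv t)) = \<beta> t * (\<sigma> g t * \<sigma> (g \<odot> t) (iv t))"
    unfolding 1[symmetric] using assms by (simp add: \<beta>'_def)
  then show ?thesis by (simp add: 2 mult.assoc)
qed

lemma bulK_bihom:
  assumes a: "bihom p q a" and m: "bihom g r m"
  shows "bulK a m = twist_scalar p q r \<star> bul a m"
proof -
  note G = bihomD[OF a] bihomD[OF m]
  have "bulK a m = sw2 B (\<lambda>x1 u. sw2 B (\<lambda>x2 x3. twist_scalar p q r \<star> xchar \<beta> x2 \<star> (x3 \<odot> (m \<odot> T x1))) u) a"
    unfolding bulK_eq
  proof (rule sw2_bihom_cong3[OF a vs])
    fix t t' u v w assume u: "bihom p t u" and v: "bihom t t' v" and w: "bihom t' q w"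
    note G' = bihomD[OF u] bihomD[OF w]
    show "xchar \<beta>' v \<star> tm w (tm m (TK u)) = twist_scalar p q r \<star> xchar \<beta> v \<star> (w \<odot> (m \<odot> T u))"
    \<comment> \<open>The character kills the middle leg unless its two degrees agree, so a single
      inner degree \<open>t\<close> remains.\<close>
    proof (cases "t = t'")
      case True
      have mT: "bihom (g \<odot> iv t) (r \<odot> iv p) (m \<odot> T u)" by (rule bihom_mul[OF m bihom_T[OF u]])
      have "\<beta>' t * (\<sigma> p (iv p) * \<sigma>' t (iv t)) * (\<sigma> g (iv t) * \<sigma>' r (iv p)) *
          (\<sigma> t (g \<odot> iv t) * \<sigma>' q (r \<odot> iv p)) =
        (\<beta>' t * \<sigma> g (iv t) * \<sigma> t (g \<odot> iv t)) * \<sigma>' t (iv t) * twist_scalar p q r"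
        unfolding twist_scalar_eq[OF G(1,2,4)] by (simp only: mult_ac)
      also have "\<dots> = twist_scalar p q r * \<beta> t"
        unfolding char_scalar[OF G'(2)] using G' by simp
      finally show ?thesis using True
        by (simp add: TK_bihom[OF u] tm_bihom[OF m bihom_T[OF u]] tm_bihom[OF w mT] xchar_bihom(1)[OF v] mult_ac)
    qed (simp add: xchar_bihom(2)[OF v])
  qed (simp_all del: V.scale_scale)
  also have "\<dots> = twist_scalar p q r \<star> bul a m"
    by (simp add: ch.bullet_eq del: V.scale_scale flip: sw2_push)
  finally show ?thesis .
qed

text \<open>Where the character is nonzero, the leg on the left and the \<open>T\<close>-leg on the
  right contribute left degrees \<open>t\<close> and \<open>iv t\<close>, which cancel because
  \<open>G\<close> is abelian. Right degrees multiply to \<open>q\<close>, \<open>r\<close>,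
  \<open>iv p\<close>.\<close>

lemma bul_proj:
  assumes a: "bihom p q a" and m: "bihom k r m"
  shows "bihom k (q \<odot> (r \<odot> iv p)) (bul a m)"
proof -
  note G = bihomD[OF a] bihomD[OF m]
  have *: "bihom k (q \<odot> (r \<odot> iv p)) (xchar \<beta> v \<star> (w \<odot> (m \<odot> T u)))"
    if u: "bihom p t u" and v: "bihom t t' v" and w: "bihom t' q w" for t t' u v w
  proof (cases "t = t'")
    case True
    have "t \<odot> (k \<odot> iv t) = k" using bihomD[OF u] G G_comm[of k "iv t"] by simp
    then show ?thesis
      using True bihom_smul[OF bihom_mul[OF w bihom_mul[OF m bihom_T[OF u]]]] by simp
  next
    case False
    then show ?thesis using G by (simp add: xchar_bihom(2)[OF v] bihom_zero)
  qed
  have "lproj k (bul a m) = bul a m" unfolding ch.bullet_eq proj_sw2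
    by (rule sw2_bihom_cong3[OF a vs]) (use * in \<open>simp_all del: proj_smul add: bihom_def[of k]\<close>)
  moreover have "rproj (q \<odot> (r \<odot> iv p)) (bul a m) = bul a m" unfolding ch.bullet_eq proj_sw2
    by (rule sw2_bihom_cong3[OF a vs]) (use * in \<open>simp_all del: proj_smul add: bihom_def[of k]\<close>)
  ultimately show ?thesis using G by (simp add: bihom_def)
qed

definition tw :: "'b \<Rightarrow> 'b \<Rightarrow> 'b" where
  "tw a m = sw3 B (\<lambda>a1 a2 a3. sw2 B (\<lambda>m0 m1. sw2 B (\<lambda>n0 n1. (s n1 a1 * s' a3 m1) \<star> n0) (bul a2 m0)) m) a"

lemma tw_eq: "tw a m = sw2 B (\<lambda>a1 u. sw2 B (\<lambda>a2 a3. sw2 B (\<lambda>m0 m1.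
    sw2 B (\<lambda>n0 n1. (s n1 a1 * s' a3 m1) \<star> n0) (bul a2 m0)) m) u) a"
  unfolding tw_def by (simp add: sw3_eq[OF vs])

lemma lin_tw: "hlin f \<Longrightarrow> hlin (\<lambda>x. tw (f x) a)" "hlin f \<Longrightarrow> hlin (\<lambda>x. tw a (f x))"
  by (simp_all add: tw_eq)

text \<open>The inverse cocycle sees the right degrees \<open>q\<close> of \<open>a3\<close> and
  \<open>r\<close> of \<open>m1\<close> and is split off first. The remaining cocycle sees
  \<open>p\<close> and the right degree of the result.\<close>

lemma tw_bihom:
  assumes a: "bihom p q a" and m: "bihom g r m"
  shows "tw a m = twist_scalar p q r \<star> bul a m"
proof -
  note G = bihomD[OF a] bihomD[OF m]
  have "tw a m = sw2 B (\<lambda>a1 u. sw2 B (\<lambda>a2 a3. sw2 B (\<lambda>m0 m1.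
    \<sigma>' q r \<star> \<epsilon> m1 \<star> \<epsilon> a3 \<star> sw2 B (\<lambda>n0 n1. s n1 a1 \<star> n0) (bul a2 m0)) m) u) a"
    unfolding tw_eq
  proof (rule sw2_bihom_cong3[OF a vs])
    fix t t' a1 a2 a3 assume a: "bihom p t a1" "bihom t t' a2" "bihom t' q a3"
    show "sw2 B (\<lambda>m0 m1. sw2 B (\<lambda>n0 n1. (s n1 a1 * s' a3 m1) \<star> n0) (bul a2 m0)) m =
      sw2 B (\<lambda>m0 m1. \<sigma>' q r \<star> \<epsilon> m1 \<star> \<epsilon> a3 \<star> sw2 B (\<lambda>n0 n1. s n1 a1 \<star> n0) (bul a2 m0)) m"
    proof (rule sw2_bihom_cong[OF m vs])
      fix w m0 m1 assume "bihom w r m1"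
      from ext2_bihom(2)[OF a(3) this, of \<sigma>']
      show "sw2 B (\<lambda>n0 n1. (s n1 a1 * s' a3 m1) \<star> n0) (bul a2 m0) =
        \<sigma>' q r \<star> \<epsilon> m1 \<star> \<epsilon> a3 \<star> sw2 B (\<lambda>n0 n1. s n1 a1 \<star> n0) (bul a2 m0)"
        by (simp add: sw2_push mult_ac)
    qed (simp_all del: V.scale_scale)
  qed (simp_all del: V.scale_scale)
  also have "\<dots> = \<sigma>' q r \<star> sw2 B (\<lambda>a1 u. sw2 B (\<lambda>n0 n1. s n1 a1 \<star> n0) (bul u m)) a"
    by (simp add: sw2_counit del: V.scale_scale flip: sw2_push(3))
  also have "sw2 B (\<lambda>a1 u. sw2 B (\<lambda>n0 n1. s n1 a1 \<star> n0) (bul u m)) a =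
     sw2 B (\<lambda>a1 u. \<epsilon> a1 \<star> \<sigma> (q \<odot> (r \<odot> iv p)) p \<star> bul u m) a"
  proof (rule sw2_bihom_cong[OF a vs])
    fix t a1 u assume a1: "bihom p t a1" and u: "bihom t q u"
    show "sw2 B (\<lambda>n0 n1. s n1 a1 \<star> n0) (bul u m) = \<epsilon> a1 \<star> \<sigma> (q \<odot> (r \<odot> iv p)) p \<star> bul u m"
    \<comment> \<open>The leg \<open>a1\<close> enters through its counit, so only
      \<open>p = t\<close> matters; then \<open>bul u m\<close> has right degree
      \<open>q \<odot> (r \<odot> iv p)\<close>, the first argument of the cocycle.\<close>
    proof (cases "p = t")
      case True
      then have "sw2 B (\<lambda>n0 n1. s n1 a1 \<star> n0) (bul u m) =
        sw2 B (\<lambda>n0 n1. \<epsilon> a1 \<star> \<sigma> (q \<odot> (r \<odot> iv p)) p \<star> \<epsilon> n1 \<star> n0) (bul u m)"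
      proof (intro sw2_bihom_cong[OF bul_proj[OF u m] vs])
        fix w n0 n1 assume n1: "bihom w (q \<odot> (r \<odot> iv t)) n1"
        show "s n1 a1 \<star> n0 = \<epsilon> a1 \<star> \<sigma> (q \<odot> (r \<odot> iv p)) p \<star> \<epsilon> n1 \<star> n0"
          using True ext2_bihom(2)[OF n1 a1, of \<sigma>] by (simp add: mult_ac)
      qed (simp_all del: V.scale_scale)
      then show ?thesis by (simp add: sw2_counit del: V.scale_scale flip: sw2_push(3))
    next
      case False
      have [simp]: "hlin (\<lambda>_. 0)" by (simp add: linear_on_def)
      have "sw2 B (\<lambda>n0 n1. s n1 a1 \<star> n0) (bul u m) = sw2 B (\<lambda>n0 n1. 0) (bul u m)"
      proof (intro sw2_bihom_cong[OF bul_proj[OF u m] vs])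
        fix w n0 n1 assume n1: "bihom w (q \<odot> (r \<odot> iv t)) n1"
        show "s n1 a1 \<star> n0 = 0"
          using False ext2_bihom(2)[OF n1 a1, of \<sigma>] counit_bihom[OF a1] by simp
      qed simp_all
      then show ?thesis using False counit_bihom[OF a1] by simp
    qed
  qed (simp_all del: V.scale_scale)
  also have "\<dots> = \<sigma> (q \<odot> (r \<odot> iv p)) p \<star> bul a m"
    by (simp add: sw2_counit del: V.scale_scale)
  finally show ?thesis by (simp add: twist_scalar_def mult_ac)
qed

text \<open>Elements of H.g share the left degree \<open>g\<close> but mix right degrees, on which
  the scalar depends. Splitting \<open>m\<close> by right degree reduces the claim to equal scalars
  on each component.\<close>

lemma tw_eq_bulK:
  assumes m: "lproj g m = m"
  shows "tw a m = bulK a m"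
proof (induction a rule: bihom_induct)
  case (bihom p q a)
  have "tw a (rproj r m) = bulK a (rproj r m)" if "r \<in> G" for r
  proof -
    have "bihom g r (rproj r m)"
      using bihom_proj(1)[OF g that, of m] m by (simp add: proj_commute[symmetric])
    from tw_bihom[OF bihom this] bulK_bihom[OF bihom this] show ?thesis by simp
  qed
  then have "(\<Sum>r\<in>G. tw a (rproj r m)) = (\<Sum>r\<in>G. bulK a (rproj r m))"
    by (intro sum.cong refl)
  then show ?case
    by (simp add: proj_sum lin_sumD[OF lin_tw(2)[OF lin_id], symmetric]
        lin_sumD[OF lin_bulK(2)[OF lin_id], symmetric])
qed (simp add: lin_addD[OF lin_tw(1)[OF lin_id]] lin_addD[OF lin_bulK(1)[OF lin_id]])

lemma lproj_bul_g: "lproj g (bul x g) = bul x g"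
proof (induction x rule: bihom_induct)
  case (bihom p q x)
  show ?case using bul_proj[OF bihom bihom_G[OF g]] by (simp add: bihom_def)
qed (simp add: ch.bullet_add proj_add)

section \<open>The common carrier and the isomorphism\<close>

definition "C = ycarrier (yd_cyclic B (xchar \<beta>) g)"
definition "C' = ycarrier (yd_cyclic K (xchar \<beta>') g)"

lemma C_eq: "C = {bul x g | x. True}" "C' = {bulK x g | x. True}"
  by (simp_all add: C_def C'_def yd_cyclic_def)

lemma C_subspace: "V.subspace C" "V.subspace C'"
  and C_comult: "m \<in> C \<Longrightarrow> comult B m \<in> tensor_space (scl B) (scl B) C UNIV"
  using ch.yd_module_cyclic(2,3)[OF G_comult[OF g]] op_hopf_char.yd_module_cyclic(3)[OF char_K, of g]
    G_comult[OF g] by (auto simp: C_def C'_def)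

text \<open>For bihomogeneous \<open>x\<close> the two generated elements differ by a nonzero
  scalar. For general \<open>x\<close> they need not be proportional, but the subspaces they form
  coincide.\<close>

lemma C_eq_C': "C = C'"
proof -
  have "bulK x g \<in> C" for x
  proof (induction x rule: bihom_induct)
    case (bihom p q x)
    show ?case unfolding bulK_bihom[OF bihom bihom_G[OF g]]
      by (rule V.subspace_scale[OF C_subspace(1)]) (auto simp: C_eq)
  qed (simp add: lin_addD[OF lin_bulK(1)[OF lin_id]] V.subspace_add[OF C_subspace(1)])
  moreover have "bul x g \<in> C'" for x
  proof (induction x rule: bihom_induct)
    case (bihom p q x)
    have "twist_scalar p q g \<noteq> 0" using bihomD[OF bihom] by (simp add: twist_scalar_def)
    then have "bul x g = inverse (twist_scalar p q g) \<star> bulK x g"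
      by (simp add: bulK_bihom[OF bihom bihom_G[OF g]])
    also have "\<dots> \<in> C'"
      by (rule V.subspace_scale[OF C_subspace(2)]) (auto simp: C_eq)
    finally show ?case .
  qed (simp add: ch.bullet_add V.subspace_add[OF C_subspace(2)])
  ultimately show ?thesis by (auto simp: C_eq)
qed

lemma twisted_iso:
  assumes M: "ycarrier M = C" "yscl M = scl B" "coact M = comult B"
    and act: "\<And>a m. m \<in> C \<Longrightarrow> act M a m = tw a m"
  shows "yd_iso K M (yd_cyclic K (xchar \<beta>') g) (\<lambda>x. x)"
    "act M a g = bulK a g"
proof -
  let ?N = "yd_cyclic K (xchar \<beta>') g"
  have N: "ycarrier ?N = C" "yscl ?N = scl B" "coact ?N = comult B" "act ?N = bulK"
    by (simp add: C_eq_C' C'_def) (simp_all add: yd_cyclic_def yd_regular_def)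
  have act': "act M a m = bulK a m" if "m \<in> C" for a m
    using that act tw_eq_bulK lproj_bul_g by (auto simp: C_eq)
  have ydN: "yd_module K ?N"
    using op_hopf_char.yd_module_cyclic(1)[OF char_K, of g] G_comult[OF g] by simp
  have ydM: "yd_module K M"
    by (rule yd_module_cong[OF ydN]) (simp_all add: N M act')
  have "bulK a m \<in> C" if "m \<in> C" for a m
    using ydN that by (simp add: yd_module_def left_module_def N)
  moreover have "comult B m = swc K M (\<lambda>m0 m1. htens B m0 m1) m" if m: "m \<in> C" for m
  proof -
    have "swc B M (htens B) m = sw2 B (htens B) m"
      by (rule swc_eq_sw2[OF _ _ _ _ vector_space_tscl])
        (use M C_subspace C_comult[OF m] tens_linear in simp_all)
    then show ?thesis by (simp add: sw2_tens) (simp add: swc_def)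
  qed
  ultimately have "yd_hom K M ?N (\<lambda>x. x)"
    by (simp add: yd_hom_def N M act' linear_on_def)
  then show "yd_iso K M ?N (\<lambda>x. x)"
    using ydM ydN by (simp add: yd_iso_def N M bij_betw_def inj_on_def)
  have "g \<in> C" using ch.bullet_unit[of g, symmetric] by (auto simp: C_eq)
  then show "act M a g = bulK a g" by (rule act')
qed

text \<open>The inner coaction in the definition of \<open>yd_twist\<close> is only used at elements of the carrier.\<close>

lemma yd_twist_act:
  assumes m: "m \<in> C" and Y: "Y = yd_cyclic B (xchar \<beta>) g"
  shows "sw3 B (\<lambda>a1 a2 a3. swc B Y (\<lambda>m0 m1. swc B Y (\<lambda>n0 n1.
           yscl Y (s n1 a1 * s' a3 m1) n0) (act Y a2 m0)) m) a = tw a m"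
proof -
  have [simp]: "ycarrier Y = C" "yscl Y = scl B" "coact Y = comult B" "act Y = bul"
    by (simp_all add: Y C_def) (simp_all add: yd_cyclic_def yd_regular_def)
  have closed: "bul a m \<in> C" if "m \<in> C" for a m
    using that by (force simp: C_eq ch.bullet_mul[symmetric])
  have swc: "swc B Y f m = sw2 B f m"
    if "m \<in> C" "\<And>b. hlin (\<lambda>a. f a b)" "\<And>a. hlin (f a)" for f :: "'b \<Rightarrow> 'b \<Rightarrow> 'b" and m
    by (rule swc_eq_sw2[OF _ _ _ _ vs]) (use that C_subspace C_comult in simp_all)
  have "swc B Y (\<lambda>m0 m1. swc B Y (\<lambda>n0 n1. (s n1 a1 * s' a3 m1) \<star> n0) (bul a2 m0)) m =
    sw2 B (\<lambda>m0 m1. sw2 B (\<lambda>n0 n1. (s n1 a1 * s' a3 m1) \<star> n0) (bul a2 m0)) m" for a1 a2 a3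
  proof -
    have "swc B Y (\<lambda>m0 m1. swc B Y (\<lambda>n0 n1. (s n1 a1 * s' a3 m1) \<star> n0) (bul a2 m0)) m =
      swc B Y (\<lambda>m0 m1. sw2 B (\<lambda>n0 n1. (s n1 a1 * s' a3 m1) \<star> n0) (bul a2 m0)) m"
    proof (rule swc_cong)
      fix m0 m1 assume "m0 \<in> ycarrier Y"
      then have m0: "m0 \<in> C" by simp
      show "swc B Y (\<lambda>n0 n1. (s n1 a1 * s' a3 m1) \<star> n0) (bul a2 m0) =
        sw2 B (\<lambda>n0 n1. (s n1 a1 * s' a3 m1) \<star> n0) (bul a2 m0)"
        by (rule swc[OF closed[OF m0]]) simp_all
    qed (use m C_comult in simp)
    also have "\<dots> = sw2 B (\<lambda>m0 m1. sw2 B (\<lambda>n0 n1. (s n1 a1 * s' a3 m1) \<star> n0) (bul a2 m0)) m"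
      by (rule swc[OF m]) simp_all
    finally show ?thesis .
  qed
  then show ?thesis by (simp add: tw_def)
qed

end

theorem theorem3p9:
  fixes H :: "('k::{alg_closed_field, field_char_0}, 'h::ab_group_add) hopf"
    and Gr :: "nat \<Rightarrow> 'h set"
    and G :: "'h set"
    and \<sigma> :: "'h \<Rightarrow> 'h \<Rightarrow> 'k"
    and \<beta> :: "'h \<Rightarrow> 'k"
    and g :: 'h
  assumes "graded_hopf_algebra H Gr"
    and "degree_zero_group_algebra H Gr G"
    and "comm_group (grp H G)" and "finite G"
    and "\<exists>n>0. \<forall>m\<ge>n. Gr m = {0}"
    and "normalized_2cocycle H G \<sigma>"
    and "\<beta> \<in> characters H G" and "g \<in> G"
  shows "twisted_char \<sigma> \<beta> g \<in> characters H G \<and>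
    (let K = hopf_twist H Gr G \<sigma>;
         M = yd_twist H Gr G \<sigma> (yd_cyclic H (ext_char H Gr G \<beta>) g);
         \<beta>' = ext_char K Gr G (twisted_char \<sigma> \<beta> g)
     in \<exists>f. yd_iso K M (yd_cyclic K \<beta>' g) f \<and>
            (\<forall>h. f (act M h g) = bullet K \<beta>' h g))"
proof -
  interpret H: graded_group_bialg H Gr G
    by (rule graded_group_bialg.intro) (fact assms)+
  obtain T where T: "op_hopf_alg H T" by (rule H.op_antipode_exists)
  \<comment> \<open>With this choice the record \<open>W.K\<close> is equal to
    \<open>hopf_twist H Gr G \<sigma>\<close>.\<close>
  define S where "S = antipode (hopf_twist H Gr G \<sigma>)"
  have \<beta>: "\<And>h. h \<in> G \<Longrightarrow> \<beta> h \<noteq> 0" "\<And>h k. h \<in> G \<Longrightarrow> k \<in> G \<Longrightarrow> \<beta> (hmult H h k) = \<beta> h * \<beta> k"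
    using assms(7) by (auto simp: characters_def hom_def grp_def units_group_def)
  have "\<beta> (hunit H) = 1"
    using \<beta>(2)[OF H.G_unit H.G_unit] \<beta>(1)[OF H.G_unit] by simp
  then interpret W: cocycle_twist H G H.E T \<sigma> \<beta> S g
    using assms(6,8) \<beta>
    by (intro cocycle_twist.intro group_projection_op.intro H.group_projection_axioms T
        cocycle_twist_axioms.intro) (simp_all add: normalized_2cocycle_def)
  have ext: "ext_cocycle H Gr G \<sigma> = W.ext2 \<sigma>" "ext_cocycle_inv H Gr G \<sigma> = W.ext2 (\<lambda>h k. inverse (\<sigma> h k))"
    by (simp_all add: fun_eq_iff ext_cocycle_def ext_cocycle_inv_def W.ext2_def H.E_def)
  have K: "hopf_twist H Gr G \<sigma> = W.K"
    unfolding W.K_def by (simp add: S_def hopf_twist_def Let_def ext W.tm_def[abs_def])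
  have \<beta>': "twisted_char \<sigma> \<beta> g = W.\<beta>'"
    by (simp add: twisted_char_def W.\<beta>'_def[abs_def])
  have xc: "ext_char H Gr G \<beta> = W.xchar \<beta>"
    by (simp add: fun_eq_iff ext_char_def W.xchar_def H.E_def)
  \<comment> \<open>Coefficients depend on the Hopf algebra only through its scalar multiplication,
    which twisting leaves alone; so characters extend to H^sigma by the same functionals.\<close>
  have "gcoeff W.K Gr G = gcoeff H Gr G" by (simp add: fun_eq_iff gcoeff_def)
  then have xcK: "ext_char W.K Gr G W.\<beta>' = W.xchar W.\<beta>'"
    by (simp add: fun_eq_iff ext_char_def W.xchar_def H.E_def)
  have "W.\<beta>' h \<noteq> 0" if "h \<in> G" for h
    using that \<beta>(1) W.nonzero[OF that assms(8)] W.nonzero[OF assms(8) that] by (simp add: W.\<beta>'_def)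
  then have ch: "W.\<beta>' \<in> characters H G"
    using W.\<beta>'_mul by (auto simp: characters_def hom_def grp_def units_group_def)
  define Y where "Y = yd_cyclic H (W.xchar \<beta>) g"
  let ?M = "yd_twist H Gr G \<sigma> Y"
  have M: "ycarrier ?M = W.C" "yscl ?M = scl H" "coact ?M = comult H"
    by (simp_all add: yd_twist_def Let_def Y_def W.C_def) (simp_all add: yd_cyclic_def yd_regular_def)
  have act: "act ?M a m = W.tw a m" if "m \<in> W.C" for a m
    using W.yd_twist_act[OF that Y_def] by (simp add: yd_twist_def Let_def ext)
  show ?thesis
    using ch W.twisted_iso[OF M act] by (auto simp: K \<beta>' xc xcK Let_def Y_def intro!: exI[of _ "\<lambda>x. x"])
qed

end
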